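(* The functor $R:\mathsf{OrdCMon}\to\mathsf{MonSiMonCat}$ is fully faithful and has a left adjoint $L:\mathsf{MonSiMonCat}\to\mathsf{OrdCMon}$. Hence $\mathsf{OrdCMon}$ is a reflective subcategory of $\mathsf{MonSiMonCat}$.
   Context: $\mathsf{MonCat}_\ell$ is the category of monoidal categories that are small with respect to a fixed Grothendieck universe, with lax monoidal functors as morphisms; it is itself monoidal under the product of categories (unit: the terminal monoidal category $*$ with one object $\bullet$). Let $\mathbb{U}$ be a Grothendieck universe large enough that $\mathbb{U}\mathsf{MonCat}_\ell$, the 2-category of $\mathbb{U}$-small monoidal categories, lax monoidal functors (1-cells) and monoidal natural transformations (2-cells), contains $\mathsf{MonCat}_\ell$ as an object. $\mathsf{MonSiMonCat}$ (the category of monoidal strictly-indexed monoidal categories) is the lax-slice 2-category $\mathbb{U}\mathsf{MonCat}_\ell/\!/\mathsf{MonCat}_\ell$, regarded here as a 1-category. Explicitly, objects are pairs $(\mathsf{C},N)$ with $\mathsf{C}\in\mathbb{U}\mathsf{MonCat}_\ell$ (a $\mathbb{U}$-small monoidal category) and $N:\mathsf{C}^{\mathrm{op}}\to\mathsf{MonCat}_\ell$ a lax monoidal functor. Morphisms $(\mathsf{C},N)\to(\mathsf{D},M)$ are pairs $(F,\gamma)$ with $F:\mathsf{C}\to\mathsf{D}$ a lax monoidal functor and $\gamma:N\Rightarrow MF^{\mathrm{op}}$ a monoidal natural transformation. Composition: $(F_2,\gamma_2)\circ(F_1,\gamma_1)=(F_2F_1,\ \gamma_2F_1^{\mathrm{op}}\circ\gamma_1)$.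 $\mathsf{OrdCMon}$ is the category of partially ordered commutative monoids (with $x\ge y,\ z\ge w\Rightarrow x+z\ge y+w$) and order-preserving monoid homomorphisms. Each $W\in\mathsf{OrdCMon}$ is viewed as a symmetric monoidal skeletal posetal category, an object of $\mathsf{MonCat}_\ell$, whose objects are the elements of $W$, with a morphism $a\to b$ iff $a\ge b$, and tensor product $+$. $R$ sends $W$ to $( *,N_W)$, where $N_W:*\to\mathsf{MonCat}_\ell$ is the lax monoidal functor with $N_W(\bullet)=W$ and coherence maps $+:W\times W\to W$ and $0:*\to W$; $R$ sends a morphism $t:W\to W'$ to $(\mathrm{id}_*,\gamma)$ with $\gamma_\bullet=t$.
   Formalization: As stated the left adjoint fails for size reasons (C = P(V) discrete, N constant at * ); it is claimed only if U-small sets are no larger than the small sets of MonCat_ℓ. Morphisms (F,γ) take F^op, not F, to be lax monoidal, as in the lax slice, so that MF^op is lax. *)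

theory Defs
  imports "HOL-Algebra.Group"
begin

section \<open>Grothendieck universes\<close>

text \<open>
  The type \<open>'u\<close> is the universe itself and \<open>el x\<close> is the set of members of \<open>x\<close>;
  transitivity of the universe is implicit in the type of \<open>el\<close>. A set of elements of \<open>'u\<close>
  is small if it is (the extension of) a member of the universe.
\<close>

locale grothendieck_universe =
  fixes el :: "'u \<Rightarrow> 'u set"
  assumes extensionality: "inj el"
    and foundation: "wf {(x, y). x \<in> el y}"
    and subset_closed: "A \<subseteq> el x \<Longrightarrow> A \<in> range el"
    and pair_closed: "{x, y} \<in> range el"
    and power_closed: "{z. el z \<subseteq> el x} \<in> range el"
    and union_closed: "(\<Union>i\<in>el x. el (f i)) \<in> range el"

definition small :: "('u \<Rightarrow> 'u set) \<Rightarrow> 'u set \<Rightarrow> bool"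
  where "small el A \<longleftrightarrow> A \<in> range el"

definition uset :: "('u \<Rightarrow> 'u set) \<Rightarrow> 'u set \<Rightarrow> 'u"
  where "uset el A = the_inv el A"

text \<open>Kuratowski pairs inside the universe, and their projections.\<close>

definition upair :: "('u \<Rightarrow> 'u set) \<Rightarrow> 'u \<Rightarrow> 'u \<Rightarrow> 'u"
  where "upair el x y = uset el {uset el {x}, uset el {x, y}}"

definition ufst :: "('u \<Rightarrow> 'u set) \<Rightarrow> 'u \<Rightarrow> 'u"
  where "ufst el p = (THE x. \<exists>y. p = upair el x y)"

definition usnd :: "('u \<Rightarrow> 'u set) \<Rightarrow> 'u \<Rightarrow> 'u"
  where "usnd el p = (THE y. \<exists>x. p = upair el x y)"

text \<open>
  Every set of the universe \<open>'u\<close> is equipotent to a set of the universe \<open>'v\<close>. The reflection of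
  \<open>(C, N)\<close> is a quotient of the disjoint union of the object sets of all \<open>N c\<close>, and can have as
  many elements as \<open>C\<close> has objects; so it is a small ordered monoid only if \<open>C\<close> is no larger than
  the universe of the fibres.
\<close>

definition no_larger :: "('u \<Rightarrow> 'u set) \<Rightarrow> ('v \<Rightarrow> 'v set) \<Rightarrow> bool"
  where "no_larger elU elV \<longleftrightarrow> (\<forall>x. \<exists>y f. bij_betw f (elU x) (elV y))"


section \<open>Categories, functors, adjunctions\<close>

record ('o, 'm) cat =
  Obj :: "'o set"
  Arr :: "'m set"
  Dom :: "'m \<Rightarrow> 'o"
  Cod :: "'m \<Rightarrow> 'o"
  ident :: "'o \<Rightarrow> 'm"
  cmp :: "'m \<Rightarrow> 'm \<Rightarrow> 'm" (infixr \<open>\<cdot>\<index>\<close> 70)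

definition homset :: "('o, 'm, 'z) cat_scheme \<Rightarrow> 'o \<Rightarrow> 'o \<Rightarrow> 'm set"
  where "homset C a b = {f \<in> Arr C. Dom C f = a \<and> Cod C f = b}"

locale category =
  fixes C :: "('o, 'm, 'z) cat_scheme" (structure)
  assumes dom_obj: "f \<in> Arr C \<Longrightarrow> Dom C f \<in> Obj C"
    and cod_obj: "f \<in> Arr C \<Longrightarrow> Cod C f \<in> Obj C"
    and ident_hom: "a \<in> Obj C \<Longrightarrow> ident C a \<in> homset C a a"
    and cmp_hom: "f \<in> homset C a b \<Longrightarrow> g \<in> homset C b c \<Longrightarrow> g \<cdot> f \<in> homset C a c"
    and ident_left: "f \<in> homset C a b \<Longrightarrow> ident C b \<cdot> f = f"
    and ident_right: "f \<in> homset C a b \<Longrightarrow> f \<cdot> ident C a = f"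
    and cmp_assoc: "f \<in> homset C a b \<Longrightarrow> g \<in> homset C b c \<Longrightarrow> h \<in> homset C c d
      \<Longrightarrow> (h \<cdot> g) \<cdot> f = h \<cdot> (g \<cdot> f)"

definition inverse_arrows :: "('o, 'm, 'z) cat_scheme \<Rightarrow> 'm \<Rightarrow> 'm \<Rightarrow> bool"
  where "inverse_arrows C f g \<longleftrightarrow>
    f \<in> Arr C \<and> g \<in> homset C (Cod C f) (Dom C f) \<and>
    g \<cdot>\<^bsub>C\<^esub> f = ident C (Dom C f) \<and> f \<cdot>\<^bsub>C\<^esub> g = ident C (Cod C f)"

definition is_iso :: "('o, 'm, 'z) cat_scheme \<Rightarrow> 'm \<Rightarrow> bool"
  where "is_iso C f \<longleftrightarrow> (\<exists>g. inverse_arrows C f g)"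

definition inv_arr :: "('o, 'm, 'z) cat_scheme \<Rightarrow> 'm \<Rightarrow> 'm"
  where "inv_arr C f = (THE g. inverse_arrows C f g)"

record ('o, 'm, 'p, 'q) func =
  fobj :: "'o \<Rightarrow> 'p"
  farr :: "'m \<Rightarrow> 'q"

locale is_functor = A: category A + B: category B
  for A :: "('o, 'm, 'y) cat_scheme" and B :: "('p, 'q, 'z) cat_scheme"
    and F :: "('o, 'm, 'p, 'q, 'w) func_scheme" +
  assumes fobj_obj: "a \<in> Obj A \<Longrightarrow> fobj F a \<in> Obj B"
    and farr_hom: "f \<in> homset A a b \<Longrightarrow> farr F f \<in> homset B (fobj F a) (fobj F b)"
    and farr_ident: "a \<in> Obj A \<Longrightarrow> farr F (ident A a) = ident B (fobj F a)"
    and farr_cmp: "f \<in> homset A a b \<Longrightarrow> g \<in> homset A b c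
      \<Longrightarrow> farr F (g \<cdot>\<^bsub>A\<^esub> f) = farr F g \<cdot>\<^bsub>B\<^esub> farr F f"

definition fully_faithful ::
  "('o, 'm, 'y) cat_scheme \<Rightarrow> ('p, 'q, 'z) cat_scheme \<Rightarrow> ('o, 'm, 'p, 'q, 'w) func_scheme \<Rightarrow> bool"
  where "fully_faithful A B F \<longleftrightarrow> is_functor A B F \<and>
    (\<forall>a\<in>Obj A. \<forall>b\<in>Obj A. bij_betw (farr F) (homset A a b) (homset B (fobj F a) (fobj F b)))"

text \<open>\<open>L : B \<rightarrow> A\<close> is left adjoint to \<open>R : A \<rightarrow> B\<close>.\<close>

definition left_adjoint ::
  "('o, 'm, 'y) cat_scheme \<Rightarrow> ('p, 'q, 'z) cat_scheme \<Rightarrow> ('p, 'q, 'o, 'm, 'v) func_scheme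
    \<Rightarrow> ('o, 'm, 'p, 'q, 'w) func_scheme \<Rightarrow> bool"
  where "left_adjoint A B L R \<longleftrightarrow> is_functor B A L \<and> is_functor A B R \<and>
    (\<exists>\<Phi>. (\<forall>b\<in>Obj B. \<forall>a\<in>Obj A.
            bij_betw (\<Phi> b a) (homset A (fobj L b) a) (homset B b (fobj R a))) \<and>
         (\<forall>b\<in>Obj B. \<forall>b'\<in>Obj B. \<forall>a\<in>Obj A. \<forall>a'\<in>Obj A.
            \<forall>g\<in>homset B b' b. \<forall>h\<in>homset A a a'. \<forall>f\<in>homset A (fobj L b) a.
              \<Phi> b' a' (h \<cdot>\<^bsub>A\<^esub> (f \<cdot>\<^bsub>A\<^esub> farr L g)) = farr R h \<cdot>\<^bsub>B\<^esub> (\<Phi> b a f \<cdot>\<^bsub>B\<^esub> g)))"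

definition reflective_subcategory ::
  "('o, 'm, 'y) cat_scheme \<Rightarrow> ('p, 'q, 'z) cat_scheme \<Rightarrow> ('o, 'm, 'p, 'q, 'w) func_scheme \<Rightarrow> bool"
  where "reflective_subcategory A B R \<longleftrightarrow> fully_faithful A B R \<and>
    (\<exists>L :: ('p, 'q, 'o, 'm) func. left_adjoint A B L R)"


section \<open>Monoidal categories and lax monoidal functors\<close>

record ('o, 'm) moncat = "('o, 'm) cat" +
  tobj :: "'o \<Rightarrow> 'o \<Rightarrow> 'o" (infixl \<open>\<odot>\<index>\<close> 75)
  tarr :: "'m \<Rightarrow> 'm \<Rightarrow> 'm" (infixl \<open>\<boxtimes>\<index>\<close> 75)
  tunit :: "'o" (\<open>\<I>\<index>\<close>)
  assoc :: "'o \<Rightarrow> 'o \<Rightarrow> 'o \<Rightarrow> 'm"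
  lunit :: "'o \<Rightarrow> 'm"
  runit :: "'o \<Rightarrow> 'm"

locale monoidal_category = category C for C :: "('o, 'm, 'z) moncat_scheme" (structure) +
  assumes tobj_obj: "a \<in> Obj C \<Longrightarrow> b \<in> Obj C \<Longrightarrow> a \<odot> b \<in> Obj C"
    and tarr_hom: "f \<in> homset C a a' \<Longrightarrow> g \<in> homset C b b' \<Longrightarrow> f \<boxtimes> g \<in> homset C (a \<odot> b) (a' \<odot> b')"
    and tarr_ident: "a \<in> Obj C \<Longrightarrow> b \<in> Obj C \<Longrightarrow> ident C a \<boxtimes> ident C b = ident C (a \<odot> b)"
    and tarr_cmp: "f \<in> homset C a a' \<Longrightarrow> f' \<in> homset C a' a'' \<Longrightarrow>
      g \<in> homset C b b' \<Longrightarrow> g' \<in> homset C b' b'' \<Longrightarrow>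
      (f' \<cdot> f) \<boxtimes> (g' \<cdot> g) = (f' \<boxtimes> g') \<cdot> (f \<boxtimes> g)"
    and tunit_obj: "\<I> \<in> Obj C"
    and assoc_hom: "a \<in> Obj C \<Longrightarrow> b \<in> Obj C \<Longrightarrow> c \<in> Obj C \<Longrightarrow>
      assoc C a b c \<in> homset C ((a \<odot> b) \<odot> c) (a \<odot> (b \<odot> c))"
    and assoc_iso: "a \<in> Obj C \<Longrightarrow> b \<in> Obj C \<Longrightarrow> c \<in> Obj C \<Longrightarrow> is_iso C (assoc C a b c)"
    and assoc_natural: "f \<in> homset C a a' \<Longrightarrow> g \<in> homset C b b' \<Longrightarrow> h \<in> homset C c c' \<Longrightarrow>
      assoc C a' b' c' \<cdot> ((f \<boxtimes> g) \<boxtimes> h) = (f \<boxtimes> (g \<boxtimes> h)) \<cdot> assoc C a b c"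
    and lunit_hom: "a \<in> Obj C \<Longrightarrow> lunit C a \<in> homset C (\<I> \<odot> a) a"
    and lunit_iso: "a \<in> Obj C \<Longrightarrow> is_iso C (lunit C a)"
    and lunit_natural: "f \<in> homset C a a' \<Longrightarrow> lunit C a' \<cdot> (ident C \<I> \<boxtimes> f) = f \<cdot> lunit C a"
    and runit_hom: "a \<in> Obj C \<Longrightarrow> runit C a \<in> homset C (a \<odot> \<I>) a"
    and runit_iso: "a \<in> Obj C \<Longrightarrow> is_iso C (runit C a)"
    and runit_natural: "f \<in> homset C a a' \<Longrightarrow> runit C a' \<cdot> (f \<boxtimes> ident C \<I>) = f \<cdot> runit C a"
    and pentagon: "a \<in> Obj C \<Longrightarrow> b \<in> Obj C \<Longrightarrow> c \<in> Obj C \<Longrightarrow> d \<in> Obj C \<Longrightarrow>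
      (ident C a \<boxtimes> assoc C b c d) \<cdot> (assoc C a (b \<odot> c) d \<cdot> (assoc C a b c \<boxtimes> ident C d))
        = assoc C a b (c \<odot> d) \<cdot> assoc C (a \<odot> b) c d"
    and triangle: "a \<in> Obj C \<Longrightarrow> b \<in> Obj C \<Longrightarrow>
      (ident C a \<boxtimes> lunit C b) \<cdot> assoc C a \<I> b = runit C a \<boxtimes> ident C b"

definition op_moncat :: "('o, 'm) moncat \<Rightarrow> ('o, 'm) moncat"
  where "op_moncat C = \<lparr>Obj = Obj C, Arr = Arr C, Dom = Cod C, Cod = Dom C, ident = ident C,
    cmp = (\<lambda>g f. f \<cdot>\<^bsub>C\<^esub> g), tobj = tobj C, tarr = tarr C, tunit = tunit C,
    assoc = (\<lambda>a b c. inv_arr C (assoc C a b c)),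
    lunit = (\<lambda>a. inv_arr C (lunit C a)), runit = (\<lambda>a. inv_arr C (runit C a))\<rparr>"

text \<open>
  A lax monoidal functor carries its source and target, so that it can serve as an arrow, and all
  its component functions are \<^const>\<open>undefined\<close> outside their domains, so that equality of lax
  monoidal functors is equality of records.
\<close>

record ('o, 'm, 'p, 'q) laxfun = "('o, 'm, 'p, 'q) func" +
  src :: "('o, 'm) moncat"
  tgt :: "('p, 'q) moncat"
  lmul :: "'o \<times> 'o \<Rightarrow> 'q"
  lone :: "'q"

locale lax_monoidal_functor = is_functor "src F" "tgt F" F
  for F :: "('o, 'm, 'p, 'q) laxfun" +
  assumes fobj_ext: "fobj F \<in> extensional (Obj (src F))"
    and farr_ext: "farr F \<in> extensional (Arr (src F))"
    and lmul_ext: "lmul F \<in> extensional (Obj (src F) \<times> Obj (src F))"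
    and lmul_hom: "a \<in> Obj (src F) \<Longrightarrow> b \<in> Obj (src F) \<Longrightarrow>
      lmul F (a, b) \<in> homset (tgt F) (fobj F a \<odot>\<^bsub>tgt F\<^esub> fobj F b) (fobj F (a \<odot>\<^bsub>src F\<^esub> b))"
    and lone_hom: "lone F \<in> homset (tgt F) (tunit (tgt F)) (fobj F (tunit (src F)))"
    and lmul_natural: "f \<in> homset (src F) a a' \<Longrightarrow> g \<in> homset (src F) b b' \<Longrightarrow>
      lmul F (a', b') \<cdot>\<^bsub>tgt F\<^esub> (farr F f \<boxtimes>\<^bsub>tgt F\<^esub> farr F g)
        = farr F (f \<boxtimes>\<^bsub>src F\<^esub> g) \<cdot>\<^bsub>tgt F\<^esub> lmul F (a, b)"
    and lax_assoc: "a \<in> Obj (src F) \<Longrightarrow> b \<in> Obj (src F) \<Longrightarrow> c \<in> Obj (src F) \<Longrightarrow>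
      farr F (assoc (src F) a b c) \<cdot>\<^bsub>tgt F\<^esub> (lmul F (a \<odot>\<^bsub>src F\<^esub> b, c)
          \<cdot>\<^bsub>tgt F\<^esub> (lmul F (a, b) \<boxtimes>\<^bsub>tgt F\<^esub> ident (tgt F) (fobj F c)))
        = lmul F (a, b \<odot>\<^bsub>src F\<^esub> c) \<cdot>\<^bsub>tgt F\<^esub> ((ident (tgt F) (fobj F a) \<boxtimes>\<^bsub>tgt F\<^esub> lmul F (b, c))
          \<cdot>\<^bsub>tgt F\<^esub> assoc (tgt F) (fobj F a) (fobj F b) (fobj F c))"
    and lax_lunit: "a \<in> Obj (src F) \<Longrightarrow>
      farr F (lunit (src F) a) \<cdot>\<^bsub>tgt F\<^esub> (lmul F (tunit (src F), a)
          \<cdot>\<^bsub>tgt F\<^esub> (lone F \<boxtimes>\<^bsub>tgt F\<^esub> ident (tgt F) (fobj F a)))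
        = lunit (tgt F) (fobj F a)"
    and lax_runit: "a \<in> Obj (src F) \<Longrightarrow>
      farr F (runit (src F) a) \<cdot>\<^bsub>tgt F\<^esub> (lmul F (a, tunit (src F))
          \<cdot>\<^bsub>tgt F\<^esub> (ident (tgt F) (fobj F a) \<boxtimes>\<^bsub>tgt F\<^esub> lone F))
        = runit (tgt F) (fobj F a)"

definition lax_comp ::
  "('p, 'q, 'r, 's) laxfun \<Rightarrow> ('o, 'm, 'p, 'q) laxfun \<Rightarrow> ('o, 'm, 'r, 's) laxfun"
  where "lax_comp G F = \<lparr>
    fobj = (\<lambda>a\<in>Obj (src F). fobj G (fobj F a)),
    farr = (\<lambda>f\<in>Arr (src F). farr G (farr F f)),
    src = src F, tgt = tgt G,
    lmul = (\<lambda>(a, b)\<in>Obj (src F) \<times> Obj (src F).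
      farr G (lmul F (a, b)) \<cdot>\<^bsub>tgt G\<^esub> lmul G (fobj F a, fobj F b)),
    lone = farr G (lone F) \<cdot>\<^bsub>tgt G\<^esub> lone G\<rparr>"

text \<open>
  For maps \<open>fo\<close>, \<open>fa\<close> strictly preserving tensor and unit: the same functor with identities as
  coherence maps.
\<close>

definition strict_lax ::
  "('o, 'm) moncat \<Rightarrow> ('p, 'q) moncat \<Rightarrow> ('o \<Rightarrow> 'p) \<Rightarrow> ('m \<Rightarrow> 'q) \<Rightarrow> ('o, 'm, 'p, 'q) laxfun"
  where "strict_lax S T fo fa = \<lparr>
    fobj = restrict fo (Obj S), farr = restrict fa (Arr S), src = S, tgt = T,
    lmul = (\<lambda>(a, b)\<in>Obj S \<times> Obj S. ident T (fo (a \<odot>\<^bsub>S\<^esub> b))),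
    lone = ident T (tunit T)\<rparr>"

definition lax_id :: "('o, 'm) moncat \<Rightarrow> ('o, 'm, 'o, 'm) laxfun"
  where "lax_id C = strict_lax C C id id"

text \<open>Natural transformations have a component at every object, and are extensional as well.\<close>

definition monoidal_transformation ::
  "('o, 'm, 'p, 'q) laxfun \<Rightarrow> ('o, 'm, 'p, 'q) laxfun \<Rightarrow> ('o \<Rightarrow> 'q) \<Rightarrow> bool"
  where "monoidal_transformation F G \<theta> \<longleftrightarrow>
    src F = src G \<and> tgt F = tgt G \<and> \<theta> \<in> extensional (Obj (src F)) \<and>
    (\<forall>a\<in>Obj (src F). \<theta> a \<in> homset (tgt F) (fobj F a) (fobj G a)) \<and>
    (\<forall>a\<in>Obj (src F). \<forall>b\<in>Obj (src F). \<forall>f\<in>homset (src F) a b.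
      \<theta> b \<cdot>\<^bsub>tgt F\<^esub> farr F f = farr G f \<cdot>\<^bsub>tgt F\<^esub> \<theta> a) \<and>
    (\<forall>a\<in>Obj (src F). \<forall>b\<in>Obj (src F).
      \<theta> (a \<odot>\<^bsub>src F\<^esub> b) \<cdot>\<^bsub>tgt F\<^esub> lmul F (a, b) = lmul G (a, b) \<cdot>\<^bsub>tgt F\<^esub> (\<theta> a \<boxtimes>\<^bsub>tgt F\<^esub> \<theta> b)) \<and>
    \<theta> (tunit (src F)) \<cdot>\<^bsub>tgt F\<^esub> lone F = lone G"


section \<open>The monoidal category of small monoidal categories\<close>

definition prod_moncat ::
  "('v \<Rightarrow> 'v set) \<Rightarrow> ('v, 'v) moncat \<Rightarrow> ('v, 'v) moncat \<Rightarrow> ('v, 'v) moncat"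
  where "prod_moncat el A B = (let \<pi> = ufst el; \<rho> = usnd el in \<lparr>
    Obj = {upair el a b | a b. a \<in> Obj A \<and> b \<in> Obj B},
    Arr = {upair el f g | f g. f \<in> Arr A \<and> g \<in> Arr B},
    Dom = (\<lambda>f. upair el (Dom A (\<pi> f)) (Dom B (\<rho> f))),
    Cod = (\<lambda>f. upair el (Cod A (\<pi> f)) (Cod B (\<rho> f))),
    ident = (\<lambda>a. upair el (ident A (\<pi> a)) (ident B (\<rho> a))),
    cmp = (\<lambda>g f. upair el (\<pi> g \<cdot>\<^bsub>A\<^esub> \<pi> f) (\<rho> g \<cdot>\<^bsub>B\<^esub> \<rho> f)),
    tobj = (\<lambda>a b. upair el (\<pi> a \<odot>\<^bsub>A\<^esub> \<pi> b) (\<rho> a \<odot>\<^bsub>B\<^esub> \<rho> b)),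
    tarr = (\<lambda>f g. upair el (\<pi> f \<boxtimes>\<^bsub>A\<^esub> \<pi> g) (\<rho> f \<boxtimes>\<^bsub>B\<^esub> \<rho> g)),
    tunit = upair el (tunit A) (tunit B),
    assoc = (\<lambda>a b c. upair el (assoc A (\<pi> a) (\<pi> b) (\<pi> c)) (assoc B (\<rho> a) (\<rho> b) (\<rho> c))),
    lunit = (\<lambda>a. upair el (lunit A (\<pi> a)) (lunit B (\<rho> a))),
    runit = (\<lambda>a. upair el (runit A (\<pi> a)) (runit B (\<rho> a)))\<rparr>)"

definition prod_lax ::
  "('v \<Rightarrow> 'v set) \<Rightarrow> ('v, 'v, 'v, 'v) laxfun \<Rightarrow> ('v, 'v, 'v, 'v) laxfun \<Rightarrow> ('v, 'v, 'v, 'v) laxfun"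
  where "prod_lax el F G = (let \<pi> = ufst el; \<rho> = usnd el; S = prod_moncat el (src F) (src G) in \<lparr>
    fobj = (\<lambda>a\<in>Obj S. upair el (fobj F (\<pi> a)) (fobj G (\<rho> a))),
    farr = (\<lambda>f\<in>Arr S. upair el (farr F (\<pi> f)) (farr G (\<rho> f))),
    src = S, tgt = prod_moncat el (tgt F) (tgt G),
    lmul = (\<lambda>(a, b)\<in>Obj S \<times> Obj S. upair el (lmul F (\<pi> a, \<pi> b)) (lmul G (\<rho> a, \<rho> b))),
    lone = upair el (lone F) (lone G)\<rparr>)"

definition bullet :: "('v \<Rightarrow> 'v set) \<Rightarrow> 'v"
  where "bullet el = uset el {}"

definition terminal_moncat :: "('v \<Rightarrow> 'v set) \<Rightarrow> ('v, 'v) moncat"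
  where "terminal_moncat el = \<lparr>Obj = {bullet el}, Arr = {bullet el},
    Dom = (\<lambda>_. bullet el), Cod = (\<lambda>_. bullet el), ident = (\<lambda>_. bullet el),
    cmp = (\<lambda>_ _. bullet el), tobj = (\<lambda>_ _. bullet el), tarr = (\<lambda>_ _. bullet el),
    tunit = bullet el, assoc = (\<lambda>_ _ _. bullet el),
    lunit = (\<lambda>_. bullet el), runit = (\<lambda>_. bullet el)\<rparr>"

definition reassoc :: "('v \<Rightarrow> 'v set) \<Rightarrow> 'v \<Rightarrow> 'v"
  where "reassoc el p = upair el (ufst el (ufst el p)) (upair el (usnd el (ufst el p)) (usnd el p))"

definition MonCat ::
  "('v \<Rightarrow> 'v set) \<Rightarrow> (('v, 'v) moncat, ('v, 'v, 'v, 'v) laxfun) moncat"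
  where "MonCat el = (let
      Ob = {C. monoidal_category C \<and> small el (Obj C) \<and> small el (Arr C)};
      pr = prod_moncat el
    in \<lparr>
    Obj = Ob,
    Arr = {F. lax_monoidal_functor F \<and> src F \<in> Ob \<and> tgt F \<in> Ob},
    Dom = src, Cod = tgt, ident = lax_id, cmp = lax_comp,
    tobj = pr, tarr = prod_lax el, tunit = terminal_moncat el,
    assoc = (\<lambda>A B C. strict_lax (pr (pr A B) C) (pr A (pr B C)) (reassoc el) (reassoc el)),
    lunit = (\<lambda>C. strict_lax (pr (terminal_moncat el) C) C (usnd el) (usnd el)),
    runit = (\<lambda>C. strict_lax (pr C (terminal_moncat el)) C (ufst el) (ufst el))\<rparr>)"


section \<open>Monoidal strictly-indexed monoidal categories\<close>

text \<open>
  The lax slice of the category of \<open>elU\<close>-small monoidal categories over \<open>MonCat elV\<close>. An object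
  \<open>(C, N)\<close> is the 1-cell \<open>N : C\<^sup>o\<^sup>p \<rightarrow> MonCat elV\<close>. In an arrow \<open>(F, \<gamma>)\<close> from \<open>(C, N)\<close> to \<open>(D, M)\<close>
  the component \<open>F\<close> is stored as the 1-cell \<open>C\<^sup>o\<^sup>p \<rightarrow> D\<^sup>o\<^sup>p\<close> of the slice: it is this functor that has
  to be lax monoidal, as otherwise the target \<open>M F\<^sup>o\<^sup>p\<close> of \<open>\<gamma>\<close> would not be lax monoidal.
\<close>

type_synonym ('u, 'v) indexed =
  "('u, 'u) moncat \<times> ('u, 'u, ('v, 'v) moncat, ('v, 'v, 'v, 'v) laxfun) laxfun"

type_synonym ('u, 'v) indexed_arrow =
  "('u, 'v) indexed \<times> (('u, 'u, 'u, 'u) laxfun \<times> ('u \<Rightarrow> ('v, 'v, 'v, 'v) laxfun)) \<times> ('u, 'v) indexed"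

definition MonSiMonCat ::
  "('v \<Rightarrow> 'v set) \<Rightarrow> ('u \<Rightarrow> 'u set) \<Rightarrow> (('u, 'v) indexed, ('u, 'v) indexed_arrow) cat"
  where "MonSiMonCat elV elU = (let
      Ob = {(C, N). C \<in> Obj (MonCat elU) \<and>
        lax_monoidal_functor N \<and> src N = op_moncat C \<and> tgt N = MonCat elV}
    in \<lparr>
    Obj = Ob,
    Arr = {((C, N), (F, \<gamma>), (D, M)) | C N F \<gamma> D M. (C, N) \<in> Ob \<and> (D, M) \<in> Ob \<and>
      lax_monoidal_functor F \<and> src F = op_moncat C \<and> tgt F = op_moncat D \<and>
      monoidal_transformation N (lax_comp M F) \<gamma>},
    Dom = (\<lambda>(X, _, _). X),
    Cod = (\<lambda>(_, _, Y). Y),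
    ident = (\<lambda>(C, N).
      ((C, N), (lax_id (op_moncat C), \<lambda>a\<in>Obj C. ident (MonCat elV) (fobj N a)), (C, N))),
    cmp = (\<lambda>(_, (F2, \<gamma>2), Z) (X, (F1, \<gamma>1), _).
      (X, (lax_comp F2 F1, \<lambda>a\<in>Obj (src F1). \<gamma>2 (fobj F1 a) \<cdot>\<^bsub>MonCat elV\<^esub> \<gamma>1 a), Z))\<rparr>)"


section \<open>Partially ordered commutative monoids\<close>

text \<open>The monoid is written multiplicatively; \<open>(x, y) \<in> geq W\<close> means \<open>x \<ge> y\<close>.\<close>

record 'a ordmon = "'a monoid" +
  geq :: "('a \<times> 'a) set"

locale ord_comm_monoid = comm_monoid W for W :: "'a ordmon" (structure) +
  assumes geq_order: "partial_order_on (carrier W) (geq W)"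
    and geq_mult: "(x, y) \<in> geq W \<Longrightarrow> (z, w) \<in> geq W \<Longrightarrow> (x \<otimes> z, y \<otimes> w) \<in> geq W"

definition ord_hom :: "'a ordmon \<Rightarrow> 'a ordmon \<Rightarrow> ('a \<Rightarrow> 'a) set"
  where "ord_hom W W' = {t \<in> hom W W'. t \<one>\<^bsub>W\<^esub> = \<one>\<^bsub>W'\<^esub> \<and>
    (\<forall>(x, y)\<in>geq W. (t x, t y) \<in> geq W') \<and> t \<in> extensional (carrier W)}"

definition OrdCMon ::
  "('v \<Rightarrow> 'v set) \<Rightarrow> ('v ordmon, 'v ordmon \<times> ('v \<Rightarrow> 'v) \<times> 'v ordmon) cat"
  where "OrdCMon el = (let Ob = {W. ord_comm_monoid W \<and> small el (carrier W)} in \<lparr>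
    Obj = Ob,
    Arr = {(W, t, W') | W t W'. W \<in> Ob \<and> W' \<in> Ob \<and> t \<in> ord_hom W W'},
    Dom = (\<lambda>(W, _, _). W),
    Cod = (\<lambda>(_, _, W'). W'),
    ident = (\<lambda>W. (W, \<lambda>x\<in>carrier W. x, W)),
    cmp = (\<lambda>(_, s, W'') (W, t, _). (W, \<lambda>x\<in>carrier W. s (t x), W''))\<rparr>)"

text \<open>The unique arrow \<open>a \<rightarrow> b\<close> is encoded as the pair of \<open>a\<close> and \<open>b\<close>.\<close>

definition posetal :: "('v \<Rightarrow> 'v set) \<Rightarrow> 'v ordmon \<Rightarrow> ('v, 'v) moncat"
  where "posetal el W = \<lparr>
    Obj = carrier W,
    Arr = {upair el a b | a b. (a, b) \<in> geq W},
    Dom = ufst el, Cod = usnd el,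
    ident = (\<lambda>a. upair el a a),
    cmp = (\<lambda>g f. upair el (ufst el f) (usnd el g)),
    tobj = (\<lambda>a b. a \<otimes>\<^bsub>W\<^esub> b),
    tarr = (\<lambda>f g. upair el (ufst el f \<otimes>\<^bsub>W\<^esub> ufst el g) (usnd el f \<otimes>\<^bsub>W\<^esub> usnd el g)),
    tunit = \<one>\<^bsub>W\<^esub>,
    assoc = (\<lambda>a b c. upair el ((a \<otimes>\<^bsub>W\<^esub> b) \<otimes>\<^bsub>W\<^esub> c) (a \<otimes>\<^bsub>W\<^esub> (b \<otimes>\<^bsub>W\<^esub> c))),
    lunit = (\<lambda>a. upair el (\<one>\<^bsub>W\<^esub> \<otimes>\<^bsub>W\<^esub> a) a),
    runit = (\<lambda>a. upair el (a \<otimes>\<^bsub>W\<^esub> \<one>\<^bsub>W\<^esub>) a)\<rparr>"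


section \<open>The functor \<open>R\<close>\<close>

definition N_of :: "('v \<Rightarrow> 'v set) \<Rightarrow> ('u \<Rightarrow> 'u set) \<Rightarrow> 'v ordmon
    \<Rightarrow> ('u, 'u, ('v, 'v) moncat, ('v, 'v, 'v, 'v) laxfun) laxfun"
  where "N_of elV elU W = (let
      S = op_moncat (terminal_moncat elU); P = posetal elV W; \<pi> = ufst elV; \<rho> = usnd elV
    in \<lparr>
    fobj = (\<lambda>_\<in>Obj S. P),
    farr = (\<lambda>_\<in>Arr S. lax_id P),
    src = S, tgt = MonCat elV,
    lmul = (\<lambda>_\<in>Obj S \<times> Obj S.
      strict_lax (prod_moncat elV P P) P (\<lambda>p. \<pi> p \<odot>\<^bsub>P\<^esub> \<rho> p) (\<lambda>f. \<pi> f \<boxtimes>\<^bsub>P\<^esub> \<rho> f)),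
    lone = strict_lax (terminal_moncat elV) P (\<lambda>_. tunit P) (\<lambda>_. ident P (tunit P))\<rparr>)"

definition R_obj :: "('v \<Rightarrow> 'v set) \<Rightarrow> ('u \<Rightarrow> 'u set) \<Rightarrow> 'v ordmon \<Rightarrow> ('u, 'v) indexed"
  where "R_obj elV elU W = (terminal_moncat elU, N_of elV elU W)"

definition R_functor :: "('v \<Rightarrow> 'v set) \<Rightarrow> ('u \<Rightarrow> 'u set) \<Rightarrow>
    ('v ordmon, 'v ordmon \<times> ('v \<Rightarrow> 'v) \<times> 'v ordmon, ('u, 'v) indexed, ('u, 'v) indexed_arrow) func"
  where "R_functor elV elU = \<lparr>
    fobj = R_obj elV elU,
    farr = (\<lambda>(W, t, W').
      (R_obj elV elU W,
       (lax_id (op_moncat (terminal_moncat elU)),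
        \<lambda>_\<in>{bullet elU}. strict_lax (posetal elV W) (posetal elV W') t
          (\<lambda>f. upair elV (t (ufst elV f)) (t (usnd elV f)))),
       R_obj elV elU W'))\<rparr>"

end

theory Submission
  imports Defs
begin

text \<open>
  A lax monoidal functor into the posetal category of an ordered monoid \<open>W\<close> is determined by its
  object map, since parallel arrows of a poset are equal. Hence an arrow \<open>(C, N) \<rightarrow> R W\<close> amounts to
  a family of maps \<open>\<delta> a : Obj (N a) \<rightarrow> W\<close> which is invariant under reindexing, turns the lax structure
  of \<open>N\<close> into the multiplication of \<open>W\<close>, and is compatible with the arrows and the tensor products
  of the fibres: a cocone. For \<open>(C, N) = R W'\<close> such a family is a single monotone homomorphism
  \<open>W' \<rightarrow> W\<close>, so \<open>R\<close> is fully faithful. The reflection of \<open>(C, N)\<close> is the total set of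
  objects of the fibres, with the product \<open>(a, x) (b, y) = (a \<odot> b, \<mu> (x, y))\<close>, modulo what all
  cocones identify and ordered by the inequalities that hold under all cocones. It is commutative
  because every target \<open>W\<close> is.
\<close>

section \<open>Universes\<close>

text \<open>Two obstacles shape the construction. The first is size. The cocones under
  \<open>(C, N)\<close> range over all small \<open>W\<close> and are too many to form a small set,
  so the reflection is not cut out of the product of their targets. They only define an equality and
  an order on the total set of objects, and that set can be coded inside the universe
  \<open>elV\<close> as soon as \<open>Obj C\<close> can, which is what \<open>no_larger\<close>
  provides. The second is that a fibre carries a tensor product of its own. For \<open>x\<close> and
  \<open>y\<close> over \<open>a\<close> this tensor product lies over \<open>a\<close> again, while
  their product in the reflection lies over \<open>a \<odot> a\<close>. The components of a cocone
  are only lax, so the two are related by an inequality, with the product above the tensor product.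
  Hence the tensor products of the fibres contribute relations to the order, and the multiplication
  comes from the lax structure of \<open>N\<close> alone, which a cocone respects on the nose
  because monoidal transformations satisfy equations between functors.\<close>

context grothendieck_universe
begin

lemma el_uset: "small el A \<Longrightarrow> el (uset el A) = A"
  using extensionality by (simp add: small_def uset_def f_the_inv_into_f)

lemma uset_eq_iff: "small el A \<Longrightarrow> small el B \<Longrightarrow> uset el A = uset el B \<longleftrightarrow> A = B"
  by (metis el_uset)

lemma small_subset: "small el A \<Longrightarrow> B \<subseteq> A \<Longrightarrow> small el B"
  unfolding small_def using subset_closed by blast

lemma small_pair: "small el {x, y}"
  unfolding small_def by (rule pair_closed)

lemma small_singleton: "small el {x}"
  using small_pair[of x x] by simp

lemma upair_eq_iff [simp]: "upair el x y = upair el x' y' \<longleftrightarrow> x = x' \<and> y = y'"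
  unfolding upair_def
  by (auto simp: uset_eq_iff small_pair small_singleton doubleton_eq_iff)

lemma ufst_upair [simp]: "ufst el (upair el x y) = x"
  unfolding ufst_def by auto

lemma usnd_upair [simp]: "usnd el (upair el x y) = y"
  unfolding usnd_def by auto

text \<open>The union axiom speaks of families of elements of the universe; \<open>uset\<close>
  turns a family of small sets into one.\<close>

lemma small_UN:
  assumes "small el A" "\<And>i. i \<in> A \<Longrightarrow> small el (B i)"
  shows "small el (\<Union>i\<in>A. B i)"
proof -
  from assms(1) obtain x where x: "A = el x"
    by (auto simp: small_def)
  have "(\<Union>i\<in>A. B i) = (\<Union>i\<in>el x. el (uset el (B i)))"
    using assms(2) by (simp add: x el_uset)
  then show ?thesis
    by (simp add: small_def union_closed)
qed

text \<open>Replacement follows from pairing and indexed union, as an image is a union of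
  singletons.\<close>

lemma small_image: "small el A \<Longrightarrow> small el (f ` A)"
  using small_UN[of A "\<lambda>i. {f i}"] by (simp add: small_singleton UNION_singleton_eq_range)

lemma small_upairs:
  assumes "small el A" "small el B"
  shows "small el {upair el a b | a b. a \<in> A \<and> b \<in> B}"
proof -
  have "{upair el a b | a b. a \<in> A \<and> b \<in> B} = (\<Union>a\<in>A. upair el a ` B)"
    by auto
  then show ?thesis
    using assms by (simp add: small_UN small_image)
qed

end


section \<open>Categories with a tensor product\<close>

context category
begin

lemma cmp_arr [simp]: "f \<in> Arr C \<Longrightarrow> g \<in> Arr C \<Longrightarrow> Cod C f = Dom C g \<Longrightarrow> g \<cdot> f \<in> Arr C"
  and dom_cmp [simp]: "f \<in> Arr C \<Longrightarrow> g \<in> Arr C \<Longrightarrow> Cod C f = Dom C g \<Longrightarrow> Dom C (g \<cdot> f) = Dom C f"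
  and cod_cmp [simp]: "f \<in> Arr C \<Longrightarrow> g \<in> Arr C \<Longrightarrow> Cod C f = Dom C g \<Longrightarrow> Cod C (g \<cdot> f) = Cod C g"
  using cmp_hom[of f "Dom C f" "Cod C f" g "Cod C g"] by (auto simp: homset_def)

lemma ident_arr [simp]: "a \<in> Obj C \<Longrightarrow> ident C a \<in> Arr C"
  and dom_ident [simp]: "a \<in> Obj C \<Longrightarrow> Dom C (ident C a) = a"
  and cod_ident [simp]: "a \<in> Obj C \<Longrightarrow> Cod C (ident C a) = a"
  using ident_hom[of a] by (auto simp: homset_def)

lemma ident_cmp [simp]: "f \<in> Arr C \<Longrightarrow> Cod C f = b \<Longrightarrow> ident C b \<cdot> f = f"
  and cmp_ident [simp]: "f \<in> Arr C \<Longrightarrow> Dom C f = a \<Longrightarrow> f \<cdot> ident C a = f"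
  using ident_left[of f "Dom C f" "Cod C f"] ident_right[of f "Dom C f" "Cod C f"]
  by (auto simp: homset_def)

lemma assoc_cmp:
  "f \<in> Arr C \<Longrightarrow> g \<in> Arr C \<Longrightarrow> h \<in> Arr C \<Longrightarrow> Cod C f = Dom C g \<Longrightarrow> Cod C g = Dom C h
    \<Longrightarrow> (h \<cdot> g) \<cdot> f = h \<cdot> (g \<cdot> f)"
  using cmp_assoc[of f "Dom C f" "Cod C f" g "Cod C g" h "Cod C h"] by (auto simp: homset_def)

declare dom_obj [simp] cod_obj [simp]

end

text \<open>
  No coherence laws are required: composing lax monoidal functors only uses that the tensor
  product is functorial and that the structure arrows are well typed. So neither the naturality
  of the associator of \<^const>\<open>MonCat\<close> nor the pentagon for \<open>C\<^sup>o\<^sup>p\<close> has to be verified.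
\<close>

locale tensor_category = category C for C :: "('o, 'm, 'z) moncat_scheme" (structure) +
  assumes tobj_obj [simp]: "a \<in> Obj C \<Longrightarrow> b \<in> Obj C \<Longrightarrow> a \<odot> b \<in> Obj C"
    and tarr_hom: "f \<in> homset C a a' \<Longrightarrow> g \<in> homset C b b' \<Longrightarrow> f \<boxtimes> g \<in> homset C (a \<odot> b) (a' \<odot> b')"
    and tarr_ident [simp]:
      "a \<in> Obj C \<Longrightarrow> b \<in> Obj C \<Longrightarrow> ident C a \<boxtimes> ident C b = ident C (a \<odot> b)"
    and tarr_cmp_hom: "f \<in> homset C a a' \<Longrightarrow> f' \<in> homset C a' a'' \<Longrightarrow>
      g \<in> homset C b b' \<Longrightarrow> g' \<in> homset C b' b'' \<Longrightarrow>
      (f' \<cdot> f) \<boxtimes> (g' \<cdot> g) = (f' \<boxtimes> g') \<cdot> (f \<boxtimes> g)"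
    and tunit_obj [simp]: "\<I> \<in> Obj C"
    and assoc_hom: "a \<in> Obj C \<Longrightarrow> b \<in> Obj C \<Longrightarrow> c \<in> Obj C \<Longrightarrow>
      assoc C a b c \<in> homset C ((a \<odot> b) \<odot> c) (a \<odot> (b \<odot> c))"
    and lunit_hom: "a \<in> Obj C \<Longrightarrow> lunit C a \<in> homset C (\<I> \<odot> a) a"
    and runit_hom: "a \<in> Obj C \<Longrightarrow> runit C a \<in> homset C (a \<odot> \<I>) a"
begin

lemma tarr_arr [simp]: "f \<in> Arr C \<Longrightarrow> g \<in> Arr C \<Longrightarrow> f \<boxtimes> g \<in> Arr C"
  and dom_tarr [simp]: "f \<in> Arr C \<Longrightarrow> g \<in> Arr C \<Longrightarrow> Dom C (f \<boxtimes> g) = Dom C f \<odot> Dom C g"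
  and cod_tarr [simp]: "f \<in> Arr C \<Longrightarrow> g \<in> Arr C \<Longrightarrow> Cod C (f \<boxtimes> g) = Cod C f \<odot> Cod C g"
  using tarr_hom[of f "Dom C f" "Cod C f" g "Dom C g" "Cod C g"] by (auto simp: homset_def)

lemma tarr_cmp:
  "f \<in> Arr C \<Longrightarrow> f' \<in> Arr C \<Longrightarrow> g \<in> Arr C \<Longrightarrow> g' \<in> Arr C \<Longrightarrow> Cod C f = Dom C f' \<Longrightarrow> Cod C g = Dom C g'
    \<Longrightarrow> (f' \<cdot> f) \<boxtimes> (g' \<cdot> g) = (f' \<boxtimes> g') \<cdot> (f \<boxtimes> g)"
  using tarr_cmp_hom[of f "Dom C f" "Cod C f" f' "Cod C f'" g "Dom C g" "Cod C g" g' "Cod C g'"]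
  by (auto simp: homset_def)

lemma cmp_tarr_ident:
  "f \<in> Arr C \<Longrightarrow> f' \<in> Arr C \<Longrightarrow> Cod C f = Dom C f' \<Longrightarrow> b \<in> Obj C
    \<Longrightarrow> (f' \<cdot> f) \<boxtimes> ident C b = (f' \<boxtimes> ident C b) \<cdot> (f \<boxtimes> ident C b)"
  using tarr_cmp[of f f' "ident C b" "ident C b"] by simp

lemma ident_tarr_cmp:
  "f \<in> Arr C \<Longrightarrow> f' \<in> Arr C \<Longrightarrow> Cod C f = Dom C f' \<Longrightarrow> b \<in> Obj C
    \<Longrightarrow> ident C b \<boxtimes> (f' \<cdot> f) = (ident C b \<boxtimes> f') \<cdot> (ident C b \<boxtimes> f)"
  using tarr_cmp[of "ident C b" "ident C b" f f'] by simp

lemma assoc_arr [simp]: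
  "a \<in> Obj C \<Longrightarrow> b \<in> Obj C \<Longrightarrow> c \<in> Obj C \<Longrightarrow> assoc C a b c \<in> Arr C"
  "a \<in> Obj C \<Longrightarrow> b \<in> Obj C \<Longrightarrow> c \<in> Obj C \<Longrightarrow> Dom C (assoc C a b c) = (a \<odot> b) \<odot> c"
  "a \<in> Obj C \<Longrightarrow> b \<in> Obj C \<Longrightarrow> c \<in> Obj C \<Longrightarrow> Cod C (assoc C a b c) = a \<odot> (b \<odot> c)"
  using assoc_hom[of a b c] by (auto simp: homset_def)

lemma lunit_arr [simp]:
  "a \<in> Obj C \<Longrightarrow> lunit C a \<in> Arr C"
  "a \<in> Obj C \<Longrightarrow> Dom C (lunit C a) = \<I> \<odot> a"
  "a \<in> Obj C \<Longrightarrow> Cod C (lunit C a) = a"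
  using lunit_hom[of a] by (auto simp: homset_def)

lemma runit_arr [simp]:
  "a \<in> Obj C \<Longrightarrow> runit C a \<in> Arr C"
  "a \<in> Obj C \<Longrightarrow> Dom C (runit C a) = a \<odot> \<I>"
  "a \<in> Obj C \<Longrightarrow> Cod C (runit C a) = a"
  using runit_hom[of a] by (auto simp: homset_def)

end

sublocale monoidal_category \<subseteq> tensor_category
  using tobj_obj tarr_hom tarr_ident tarr_cmp tunit_obj assoc_hom lunit_hom runit_hom
  by unfold_locales blast+

text \<open>The sublocale as an implication, for discharging premises where \<open>C\<close> has not
  been interpreted.\<close>

lemma monoidal_category_tensor: "monoidal_category C \<Longrightarrow> tensor_category C"
  by (simp add: monoidal_category.axioms(1) monoidal_category_def tensor_category_def
    tensor_category_axioms_def monoidal_category_axioms_def)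

section \<open>Inverse arrows and the opposite of a monoidal category\<close>

context category
begin

lemma inverse_arrows_unique:
  assumes "inverse_arrows C f g" "inverse_arrows C f h"
  shows "g = h"
proof -
  have "g = (h \<cdot> f) \<cdot> g"
    using assms by (auto simp: inverse_arrows_def homset_def)
  also have "\<dots> = h \<cdot> (f \<cdot> g)"
    using assms by (intro assoc_cmp) (auto simp: inverse_arrows_def homset_def)
  also have "\<dots> = h"
    using assms by (auto simp: inverse_arrows_def homset_def)
  finally show ?thesis .
qed

text \<open>Uniqueness of inverses is what makes the \<open>THE\<close> in \<open>inv_arr\<close>
  denote one.\<close>

lemma inverse_arrows_inv_arr: "is_iso C f \<Longrightarrow> inverse_arrows C f (inv_arr C f)"
  unfolding inv_arr_def is_iso_def by (metis inverse_arrows_unique theI)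

lemma inv_arr_hom: "is_iso C f \<Longrightarrow> f \<in> homset C a b \<Longrightarrow> inv_arr C f \<in> homset C b a"
  using inverse_arrows_inv_arr[of f] by (auto simp: inverse_arrows_def homset_def)

end

lemma op_moncat_simps [simp]:
  "Obj (op_moncat C) = Obj C" "Arr (op_moncat C) = Arr C"
  "Dom (op_moncat C) = Cod C" "Cod (op_moncat C) = Dom C"
  "ident (op_moncat C) = ident C" "cmp (op_moncat C) g f = f \<cdot>\<^bsub>C\<^esub> g"
  "tobj (op_moncat C) = tobj C" "tarr (op_moncat C) = tarr C" "tunit (op_moncat C) = tunit C"
  by (simp_all add: op_moncat_def)

lemma homset_op [simp]: "homset (op_moncat C) a b = homset C b a"
  by (auto simp: homset_def)

text \<open>Passing to the opposite reverses the associator and the unitors, and inverting them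
  restores their direction. So their invertibility in \<open>C\<close> is what makes the structure
  arrows of the opposite well typed.\<close>

lemma op_tensor_category:
  fixes C :: "('o, 'm) moncat" (structure)
  assumes "monoidal_category C"
  shows "tensor_category (op_moncat C)"
proof -
  interpret monoidal_category C
    by fact
  show ?thesis
  proof
    fix a b c d f g h
    assume "f \<in> homset (op_moncat C) a b" "g \<in> homset (op_moncat C) b c" "h \<in> homset (op_moncat C) c d"
    then show "cmp (op_moncat C) (cmp (op_moncat C) h g) f = cmp (op_moncat C) h (cmp (op_moncat C) g f)"
      by (auto simp: homset_def assoc_cmp)
  next
    fix f a a' f' a'' g b b' g' b''
    assume "f \<in> homset (op_moncat C) a a'" "f' \<in> homset (op_moncat C) a' a''"
      "g \<in> homset (op_moncat C) b b'" "g' \<in> homset (op_moncat C) b' b''"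
    then show "cmp (op_moncat C) f' f \<boxtimes>\<^bsub>op_moncat C\<^esub> cmp (op_moncat C) g' g =
      cmp (op_moncat C) (f' \<boxtimes>\<^bsub>op_moncat C\<^esub> g') (f \<boxtimes>\<^bsub>op_moncat C\<^esub> g)"
      by (auto simp: homset_def tarr_cmp)
  next
    fix a b c assume *: "a \<in> Obj (op_moncat C)" "b \<in> Obj (op_moncat C)" "c \<in> Obj (op_moncat C)"
    then have "assoc (op_moncat C) a b c = inv_arr C (assoc C a b c)"
      by (simp add: op_moncat_def)
    with * show "assoc (op_moncat C) a b c
        \<in> homset (op_moncat C) (a \<odot>\<^bsub>op_moncat C\<^esub> b \<odot>\<^bsub>op_moncat C\<^esub> c) (a \<odot>\<^bsub>op_moncat C\<^esub> (b \<odot>\<^bsub>op_moncat C\<^esub> c))"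
      using inv_arr_hom[OF assoc_iso assoc_hom] by simp
  next
    fix a assume *: "a \<in> Obj (op_moncat C)"
    then have "lunit (op_moncat C) a = inv_arr C (lunit C a)" "runit (op_moncat C) a = inv_arr C (runit C a)"
      by (simp_all add: op_moncat_def)
    with * show "lunit (op_moncat C) a \<in> homset (op_moncat C) (tunit (op_moncat C) \<odot>\<^bsub>op_moncat C\<^esub> a) a"
      "runit (op_moncat C) a \<in> homset (op_moncat C) (a \<odot>\<^bsub>op_moncat C\<^esub> tunit (op_moncat C)) a"
      using inv_arr_hom[OF lunit_iso lunit_hom] inv_arr_hom[OF runit_iso runit_hom] by simp_all
  qed (auto simp: homset_def)
qed

section \<open>Lax monoidal functors\<close>

context is_functor
begin

declare fobj_obj [simp] farr_ident [simp]

lemma farr_arr [simp]: "f \<in> Arr A \<Longrightarrow> farr F f \<in> Arr B"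
  and dom_farr [simp]: "f \<in> Arr A \<Longrightarrow> Dom B (farr F f) = fobj F (Dom A f)"
  and cod_farr [simp]: "f \<in> Arr A \<Longrightarrow> Cod B (farr F f) = fobj F (Cod A f)"
  using farr_hom[of f "Dom A f" "Cod A f"] by (auto simp: homset_def)

lemma farr_cmp_arr: "f \<in> Arr A \<Longrightarrow> g \<in> Arr A \<Longrightarrow> Cod A f = Dom A g
    \<Longrightarrow> farr F (g \<cdot>\<^bsub>A\<^esub> f) = farr F g \<cdot>\<^bsub>B\<^esub> farr F f"
  using farr_cmp[of f "Dom A f" "Cod A f" g "Cod A g"] by (auto simp: homset_def)

end

context lax_monoidal_functor
begin

lemma lmul_arr [simp]:
  "a \<in> Obj (src F) \<Longrightarrow> b \<in> Obj (src F) \<Longrightarrow> lmul F (a, b) \<in> Arr (tgt F)"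
  "a \<in> Obj (src F) \<Longrightarrow> b \<in> Obj (src F)
    \<Longrightarrow> Dom (tgt F) (lmul F (a, b)) = fobj F a \<odot>\<^bsub>tgt F\<^esub> fobj F b"
  "a \<in> Obj (src F) \<Longrightarrow> b \<in> Obj (src F)
    \<Longrightarrow> Cod (tgt F) (lmul F (a, b)) = fobj F (a \<odot>\<^bsub>src F\<^esub> b)"
  using lmul_hom[of a b] by (auto simp: homset_def)

lemma lone_arr [simp]:
  "lone F \<in> Arr (tgt F)" "Dom (tgt F) (lone F) = tunit (tgt F)"
  "Cod (tgt F) (lone F) = fobj F (tunit (src F))"
  using lone_hom by (auto simp: homset_def)

lemma lmul_natural_arr: "f \<in> Arr (src F) \<Longrightarrow> g \<in> Arr (src F) \<Longrightarrow>
    lmul F (Cod (src F) f, Cod (src F) g) \<cdot>\<^bsub>tgt F\<^esub> (farr F f \<boxtimes>\<^bsub>tgt F\<^esub> farr F g)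
      = farr F (f \<boxtimes>\<^bsub>src F\<^esub> g) \<cdot>\<^bsub>tgt F\<^esub> lmul F (Dom (src F) f, Dom (src F) g)"
  using lmul_natural[of f "Dom (src F) f" "Cod (src F) f" g "Dom (src F) g" "Cod (src F) g"]
  by (auto simp: homset_def)

end

lemma lax_functor_eqI:
  assumes "lax_monoidal_functor F" "lax_monoidal_functor G" "src F = src G" "tgt F = tgt G"
    and obj: "\<And>a. a \<in> Obj (src F) \<Longrightarrow> fobj F a = fobj G a"
    and arr: "\<And>f. f \<in> Arr (src F) \<Longrightarrow> farr F f = farr G f"
    and mul: "\<And>a b. a \<in> Obj (src F) \<Longrightarrow> b \<in> Obj (src F) \<Longrightarrow> lmul F (a, b) = lmul G (a, b)"
    and one: "lone F = lone G"
  shows "F = G"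
proof -
  interpret F: lax_monoidal_functor F by fact
  interpret G: lax_monoidal_functor G by fact
  have "fobj F = fobj G"
    using F.fobj_ext G.fobj_ext obj assms(3) by (metis extensionalityI)
  moreover have "farr F = farr G"
    using F.farr_ext G.farr_ext arr assms(3) by (metis extensionalityI)
  moreover have "lmul F = lmul G"
    using F.lmul_ext G.lmul_ext mul assms(3) by (intro extensionalityI[of _ "Obj (src F) \<times> Obj (src F)"]) auto
  ultimately show ?thesis
    using assms(3,4) one by (intro laxfun.equality) auto
qed

section \<open>Composition of lax monoidal functors\<close>

lemma lax_comp_simps [simp]:
  "src (lax_comp G F) = src F" "tgt (lax_comp G F) = tgt G"
  "a \<in> Obj (src F) \<Longrightarrow> fobj (lax_comp G F) a = fobj G (fobj F a)"
  "f \<in> Arr (src F) \<Longrightarrow> farr (lax_comp G F) f = farr G (farr F f)"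
  "a \<in> Obj (src F) \<Longrightarrow> b \<in> Obj (src F) \<Longrightarrow> lmul (lax_comp G F) (a, b)
    = farr G (lmul F (a, b)) \<cdot>\<^bsub>tgt G\<^esub> lmul G (fobj F a, fobj F b)"
  "lone (lax_comp G F) = farr G (lone F) \<cdot>\<^bsub>tgt G\<^esub> lone G"
  by (simp_all add: lax_comp_def)

text \<open>Source and target are fields of the functors, so composability is an equation between
  categories and not a matter of types.\<close>

locale composable_lax_functors =
  F: lax_monoidal_functor F + G: lax_monoidal_functor G
  for F :: "('o, 'm, 'p, 'q) laxfun" and G :: "('p, 'q, 'r, 's) laxfun" +
  assumes tgt_F: "tgt F = src G"
    and A: "tensor_category (src F)" and B: "tensor_category (src G)" and T: "tensor_category (tgt G)"
begin

sublocale A: tensor_category "src F" by (rule A)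
sublocale B: tensor_category "src G" by (rule B)
sublocale T: tensor_category "tgt G" by (rule T)

text \<open>The facts about \<open>F\<close> mention \<open>tgt F\<close>. Restated over
  \<open>src G\<close> they fit the interpretation \<open>B\<close>, and one name is used
  throughout.\<close>

lemmas F_simps [simp] =
  F.fobj_obj[unfolded tgt_F] F.farr_ident[unfolded tgt_F] F.farr_arr[unfolded tgt_F]
  F.dom_farr[unfolded tgt_F] F.cod_farr[unfolded tgt_F] F.lmul_arr[unfolded tgt_F]
  F.lone_arr[unfolded tgt_F]

text \<open>A pasting of four diagrams: naturality of \<open>lmul G\<close> moves the coherence
  arrows of \<open>F\<close> past it, so that the \<open>G\<close>-image of the law for
  \<open>F\<close> and then the law for \<open>G\<close> apply, and a second naturality square
  restores the composite form.\<close>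

lemma lax_comp_assoc_law:
  assumes "a \<in> Obj (src F)" "b \<in> Obj (src F)" "c \<in> Obj (src F)"
  defines "H \<equiv> lax_comp G F"
  shows "farr H (assoc (src H) a b c) \<cdot>\<^bsub>tgt H\<^esub> (lmul H (a \<odot>\<^bsub>src H\<^esub> b, c)
          \<cdot>\<^bsub>tgt H\<^esub> (lmul H (a, b) \<boxtimes>\<^bsub>tgt H\<^esub> ident (tgt H) (fobj H c)))
        = lmul H (a, b \<odot>\<^bsub>src H\<^esub> c) \<cdot>\<^bsub>tgt H\<^esub> ((ident (tgt H) (fobj H a) \<boxtimes>\<^bsub>tgt H\<^esub> lmul H (b, c))
          \<cdot>\<^bsub>tgt H\<^esub> assoc (tgt H) (fobj H a) (fobj H b) (fobj H c))"
proof -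
  let ?T = "tgt G" and ?A = "src F" and ?B = "src G"
  let ?x = "fobj F a" and ?y = "fobj F b" and ?z = "fobj F c"
  let ?id = "ident (tgt G)"
  define ab where "ab = lmul F (a, b)"
  define ab_c where "ab_c = lmul F (a \<odot>\<^bsub>?A\<^esub> b, c)"
  define bc where "bc = lmul F (b, c)"
  define a_bc where "a_bc = lmul F (a, b \<odot>\<^bsub>?A\<^esub> c)"
  define \<alpha> where "\<alpha> = farr F (assoc ?A a b c)"
  note defs = ab_def ab_c_def bc_def a_bc_def \<alpha>_def
  \<comment> \<open>\<open>nat1\<close> and \<open>nat2\<close> are the naturality squares of
    \<open>lmul G\<close> in one argument at a time, with an identity arrow in the other.\<close>
  have nat1: "lmul G (fobj F (a \<odot>\<^bsub>?A\<^esub> b), ?z) \<cdot>\<^bsub>?T\<^esub> (farr G ab \<boxtimes>\<^bsub>?T\<^esub> ?id (fobj G ?z))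
      = farr G (ab \<boxtimes>\<^bsub>?B\<^esub> ident ?B ?z) \<cdot>\<^bsub>?T\<^esub> lmul G (?x \<odot>\<^bsub>?B\<^esub> ?y, ?z)"
    using G.lmul_natural_arr[of ab "ident ?B ?z"] assms(1-3) by (simp add: defs)
  have nat2: "lmul G (?x, fobj F (b \<odot>\<^bsub>?A\<^esub> c)) \<cdot>\<^bsub>?T\<^esub> (?id (fobj G ?x) \<boxtimes>\<^bsub>?T\<^esub> farr G bc)
      = farr G (ident ?B ?x \<boxtimes>\<^bsub>?B\<^esub> bc) \<cdot>\<^bsub>?T\<^esub> lmul G (?x, ?y \<odot>\<^bsub>?B\<^esub> ?z)"
    using G.lmul_natural_arr[of "ident ?B ?x" bc] assms(1-3) by (simp add: defs)
  have F_law: "\<alpha> \<cdot>\<^bsub>?B\<^esub> (ab_c \<cdot>\<^bsub>?B\<^esub> (ab \<boxtimes>\<^bsub>?B\<^esub> ident ?B ?z))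
      = a_bc \<cdot>\<^bsub>?B\<^esub> ((ident ?B ?x \<boxtimes>\<^bsub>?B\<^esub> bc) \<cdot>\<^bsub>?B\<^esub> assoc ?B ?x ?y ?z)"
    using F.lax_assoc[of a b c] assms(1-3) by (simp add: defs tgt_F)
  have "farr G \<alpha> \<cdot>\<^bsub>?T\<^esub> ((farr G ab_c \<cdot>\<^bsub>?T\<^esub> lmul G (fobj F (a \<odot>\<^bsub>?A\<^esub> b), ?z))
        \<cdot>\<^bsub>?T\<^esub> ((farr G ab \<cdot>\<^bsub>?T\<^esub> lmul G (?x, ?y)) \<boxtimes>\<^bsub>?T\<^esub> ?id (fobj G ?z)))
    = farr G \<alpha> \<cdot>\<^bsub>?T\<^esub> (farr G ab_c \<cdot>\<^bsub>?T\<^esub> ((lmul G (fobj F (a \<odot>\<^bsub>?A\<^esub> b), ?z)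
        \<cdot>\<^bsub>?T\<^esub> (farr G ab \<boxtimes>\<^bsub>?T\<^esub> ?id (fobj G ?z))) \<cdot>\<^bsub>?T\<^esub> (lmul G (?x, ?y) \<boxtimes>\<^bsub>?T\<^esub> ?id (fobj G ?z))))"
    using assms(1-3) by (simp add: defs T.cmp_tarr_ident G.B.assoc_cmp)
  also have "\<dots> = (farr G \<alpha> \<cdot>\<^bsub>?T\<^esub> (farr G ab_c \<cdot>\<^bsub>?T\<^esub> farr G (ab \<boxtimes>\<^bsub>?B\<^esub> ident ?B ?z))) \<cdot>\<^bsub>?T\<^esub>
        (lmul G (?x \<odot>\<^bsub>?B\<^esub> ?y, ?z) \<cdot>\<^bsub>?T\<^esub> (lmul G (?x, ?y) \<boxtimes>\<^bsub>?T\<^esub> ?id (fobj G ?z)))"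
    unfolding nat1 using assms(1-3) by (simp add: defs G.B.assoc_cmp)
  \<comment> \<open>The law for \<open>F\<close> enters here, as an equation under
    \<open>farr G\<close>; the law for \<open>G\<close> follows two steps later.\<close>
  also have "farr G \<alpha> \<cdot>\<^bsub>?T\<^esub> (farr G ab_c \<cdot>\<^bsub>?T\<^esub> farr G (ab \<boxtimes>\<^bsub>?B\<^esub> ident ?B ?z))
      = farr G (a_bc \<cdot>\<^bsub>?B\<^esub> ((ident ?B ?x \<boxtimes>\<^bsub>?B\<^esub> bc) \<cdot>\<^bsub>?B\<^esub> assoc ?B ?x ?y ?z))"
    unfolding F_law[symmetric] using assms(1-3) by (simp add: defs G.farr_cmp_arr)
  also have "\<dots> \<cdot>\<^bsub>?T\<^esub> (lmul G (?x \<odot>\<^bsub>?B\<^esub> ?y, ?z) \<cdot>\<^bsub>?T\<^esub> (lmul G (?x, ?y) \<boxtimes>\<^bsub>?T\<^esub> ?id (fobj G ?z)))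
      = farr G a_bc \<cdot>\<^bsub>?T\<^esub> (farr G (ident ?B ?x \<boxtimes>\<^bsub>?B\<^esub> bc) \<cdot>\<^bsub>?T\<^esub> (farr G (assoc ?B ?x ?y ?z) \<cdot>\<^bsub>?T\<^esub>
        (lmul G (?x \<odot>\<^bsub>?B\<^esub> ?y, ?z) \<cdot>\<^bsub>?T\<^esub> (lmul G (?x, ?y) \<boxtimes>\<^bsub>?T\<^esub> ?id (fobj G ?z)))))"
    using assms(1-3) by (simp add: defs G.B.assoc_cmp G.farr_cmp_arr)
  also have "\<dots> = farr G a_bc \<cdot>\<^bsub>?T\<^esub> ((farr G (ident ?B ?x \<boxtimes>\<^bsub>?B\<^esub> bc) \<cdot>\<^bsub>?T\<^esub> lmul G (?x, ?y \<odot>\<^bsub>?B\<^esub> ?z))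
        \<cdot>\<^bsub>?T\<^esub> ((?id (fobj G ?x) \<boxtimes>\<^bsub>?T\<^esub> lmul G (?y, ?z)) \<cdot>\<^bsub>?T\<^esub> assoc ?T (fobj G ?x) (fobj G ?y) (fobj G ?z)))"
    using assms(1-3) by (subst G.lax_assoc) (simp_all add: defs G.B.assoc_cmp)
  also have "\<dots> = (farr G a_bc \<cdot>\<^bsub>?T\<^esub> lmul G (?x, fobj F (b \<odot>\<^bsub>?A\<^esub> c)))
      \<cdot>\<^bsub>?T\<^esub> ((?id (fobj G ?x) \<boxtimes>\<^bsub>?T\<^esub> (farr G bc \<cdot>\<^bsub>?T\<^esub> lmul G (?y, ?z)))
        \<cdot>\<^bsub>?T\<^esub> assoc ?T (fobj G ?x) (fobj G ?y) (fobj G ?z))"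
    unfolding nat2[symmetric] using assms(1-3) by (simp add: defs T.ident_tarr_cmp G.B.assoc_cmp)
  finally show ?thesis
    using assms(1-3) by (simp add: H_def defs)
qed

text \<open>The same pasting as for associativity, with \<open>lone F\<close> in the place of one of
  the coherence arrows \<open>lmul F\<close>.\<close>

lemma lax_comp_unit_laws:
  assumes "a \<in> Obj (src F)"
  defines "H \<equiv> lax_comp G F"
  shows "farr H (lunit (src H) a) \<cdot>\<^bsub>tgt H\<^esub> (lmul H (tunit (src H), a)
          \<cdot>\<^bsub>tgt H\<^esub> (lone H \<boxtimes>\<^bsub>tgt H\<^esub> ident (tgt H) (fobj H a))) = lunit (tgt H) (fobj H a)" (is ?l)
    and "farr H (runit (src H) a) \<cdot>\<^bsub>tgt H\<^esub> (lmul H (a, tunit (src H))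
          \<cdot>\<^bsub>tgt H\<^esub> (ident (tgt H) (fobj H a) \<boxtimes>\<^bsub>tgt H\<^esub> lone H)) = runit (tgt H) (fobj H a)" (is ?r)
proof -
  let ?T = "tgt G" and ?A = "src F" and ?B = "src G"
  let ?x = "fobj F a" and ?I = "tunit (src F)" and ?J = "tunit (src G)"
  let ?id = "ident (tgt G) (fobj G (fobj F a))"
  have natl: "lmul G (fobj F ?I, ?x) \<cdot>\<^bsub>?T\<^esub> (farr G (lone F) \<boxtimes>\<^bsub>?T\<^esub> ?id)
      = farr G (lone F \<boxtimes>\<^bsub>?B\<^esub> ident ?B ?x) \<cdot>\<^bsub>?T\<^esub> lmul G (?J, ?x)"
    using G.lmul_natural_arr[of "lone F" "ident ?B ?x"] assms(1) by simp
  have natr: "lmul G (?x, fobj F ?I) \<cdot>\<^bsub>?T\<^esub> (?id \<boxtimes>\<^bsub>?T\<^esub> farr G (lone F))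
      = farr G (ident ?B ?x \<boxtimes>\<^bsub>?B\<^esub> lone F) \<cdot>\<^bsub>?T\<^esub> lmul G (?x, ?J)"
    using G.lmul_natural_arr[of "ident ?B ?x" "lone F"] assms(1) by simp
  have "farr G (farr F (lunit ?A a)) \<cdot>\<^bsub>?T\<^esub> ((farr G (lmul F (?I, a)) \<cdot>\<^bsub>?T\<^esub> lmul G (fobj F ?I, ?x))
        \<cdot>\<^bsub>?T\<^esub> ((farr G (lone F) \<cdot>\<^bsub>?T\<^esub> lone G) \<boxtimes>\<^bsub>?T\<^esub> ?id))
    = farr G (farr F (lunit ?A a)) \<cdot>\<^bsub>?T\<^esub> (farr G (lmul F (?I, a)) \<cdot>\<^bsub>?T\<^esub>
        ((lmul G (fobj F ?I, ?x) \<cdot>\<^bsub>?T\<^esub> (farr G (lone F) \<boxtimes>\<^bsub>?T\<^esub> ?id)) \<cdot>\<^bsub>?T\<^esub> (lone G \<boxtimes>\<^bsub>?T\<^esub> ?id)))"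
    using assms(1) by (simp add: T.cmp_tarr_ident G.B.assoc_cmp)
  also have "\<dots> = farr G (farr F (lunit ?A a) \<cdot>\<^bsub>?B\<^esub> (lmul F (?I, a) \<cdot>\<^bsub>?B\<^esub> (lone F \<boxtimes>\<^bsub>?B\<^esub> ident ?B ?x)))
      \<cdot>\<^bsub>?T\<^esub> (lmul G (?J, ?x) \<cdot>\<^bsub>?T\<^esub> (lone G \<boxtimes>\<^bsub>?T\<^esub> ?id))"
    unfolding natl using assms(1) by (simp add: G.B.assoc_cmp G.farr_cmp_arr)
  also have "\<dots> = lunit ?T (fobj G ?x)"
    using F.lax_lunit[of a] G.lax_lunit[of ?x] assms(1) by (simp add: tgt_F)
  finally show ?l
    using assms(1) by (simp add: H_def)
  have "farr G (farr F (runit ?A a)) \<cdot>\<^bsub>?T\<^esub> ((farr G (lmul F (a, ?I)) \<cdot>\<^bsub>?T\<^esub> lmul G (?x, fobj F ?I))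
        \<cdot>\<^bsub>?T\<^esub> (?id \<boxtimes>\<^bsub>?T\<^esub> (farr G (lone F) \<cdot>\<^bsub>?T\<^esub> lone G)))
    = farr G (farr F (runit ?A a)) \<cdot>\<^bsub>?T\<^esub> (farr G (lmul F (a, ?I)) \<cdot>\<^bsub>?T\<^esub>
        ((lmul G (?x, fobj F ?I) \<cdot>\<^bsub>?T\<^esub> (?id \<boxtimes>\<^bsub>?T\<^esub> farr G (lone F))) \<cdot>\<^bsub>?T\<^esub> (?id \<boxtimes>\<^bsub>?T\<^esub> lone G)))"
    using assms(1) by (simp add: T.ident_tarr_cmp G.B.assoc_cmp)
  also have "\<dots> = farr G (farr F (runit ?A a) \<cdot>\<^bsub>?B\<^esub> (lmul F (a, ?I) \<cdot>\<^bsub>?B\<^esub> (ident ?B ?x \<boxtimes>\<^bsub>?B\<^esub> lone F)))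
      \<cdot>\<^bsub>?T\<^esub> (lmul G (?x, ?J) \<cdot>\<^bsub>?T\<^esub> (?id \<boxtimes>\<^bsub>?T\<^esub> lone G))"
    unfolding natr using assms(1) by (simp add: G.B.assoc_cmp G.farr_cmp_arr)
  also have "\<dots> = runit ?T (fobj G ?x)"
    using F.lax_runit[of a] G.lax_runit[of ?x] assms(1) by (simp add: tgt_F)
  finally show ?r
    using assms(1) by (simp add: H_def)
qed

text \<open>Two squares side by side: naturality of \<open>lmul G\<close> at the images of
  \<open>f\<close> and \<open>g\<close>, and the \<open>G\<close>-image of naturality of
  \<open>lmul F\<close>.\<close>

lemma lax_comp_natural:
  assumes "f \<in> Arr (src F)" "g \<in> Arr (src F)"
  defines "H \<equiv> lax_comp G F"
  shows "lmul H (Cod (src H) f, Cod (src H) g) \<cdot>\<^bsub>tgt H\<^esub> (farr H f \<boxtimes>\<^bsub>tgt H\<^esub> farr H g)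
      = farr H (f \<boxtimes>\<^bsub>src H\<^esub> g) \<cdot>\<^bsub>tgt H\<^esub> lmul H (Dom (src H) f, Dom (src H) g)"
proof -
  have "(farr G (lmul F (Cod (src F) f, Cod (src F) g))
        \<cdot>\<^bsub>tgt G\<^esub> lmul G (fobj F (Cod (src F) f), fobj F (Cod (src F) g)))
      \<cdot>\<^bsub>tgt G\<^esub> (farr G (farr F f) \<boxtimes>\<^bsub>tgt G\<^esub> farr G (farr F g))
    = farr G (lmul F (Cod (src F) f, Cod (src F) g)) \<cdot>\<^bsub>tgt G\<^esub> (farr G (farr F f \<boxtimes>\<^bsub>src G\<^esub> farr F g)
        \<cdot>\<^bsub>tgt G\<^esub> lmul G (fobj F (Dom (src F) f), fobj F (Dom (src F) g)))"
    using G.lmul_natural_arr[of "farr F f" "farr F g"] assms(1,2) by (simp add: G.B.assoc_cmp)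
  also have "\<dots> = farr G (lmul F (Cod (src F) f, Cod (src F) g) \<cdot>\<^bsub>src G\<^esub> (farr F f \<boxtimes>\<^bsub>src G\<^esub> farr F g))
        \<cdot>\<^bsub>tgt G\<^esub> lmul G (fobj F (Dom (src F) f), fobj F (Dom (src F) g))"
    using assms(1,2) by (simp add: G.farr_cmp_arr G.B.assoc_cmp)
  also have "\<dots> = farr G (farr F (f \<boxtimes>\<^bsub>src F\<^esub> g)) \<cdot>\<^bsub>tgt G\<^esub>
      (farr G (lmul F (Dom (src F) f, Dom (src F) g))
        \<cdot>\<^bsub>tgt G\<^esub> lmul G (fobj F (Dom (src F) f), fobj F (Dom (src F) g)))"
    using F.lmul_natural_arr[of f g] assms(1,2) by (simp add: tgt_F G.farr_cmp_arr G.B.assoc_cmp)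
  finally show ?thesis
    using assms(1,2) by (simp add: H_def)
qed

lemma lax_comp_lax: "lax_monoidal_functor (lax_comp G F)"
proof
  show "fobj (lax_comp G F) \<in> extensional (Obj (src (lax_comp G F)))"
    "farr (lax_comp G F) \<in> extensional (Arr (src (lax_comp G F)))"
    "lmul (lax_comp G F) \<in> extensional (Obj (src (lax_comp G F)) \<times> Obj (src (lax_comp G F)))"
    by (simp_all add: lax_comp_def)
  fix f a b f' a' b'
  assume "f \<in> homset (src (lax_comp G F)) a b" "f' \<in> homset (src (lax_comp G F)) a' b'"
  then show "lmul (lax_comp G F) (b, b') \<cdot>\<^bsub>tgt (lax_comp G F)\<^esub>
        (farr (lax_comp G F) f \<boxtimes>\<^bsub>tgt (lax_comp G F)\<^esub> farr (lax_comp G F) f')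
      = farr (lax_comp G F) (f \<boxtimes>\<^bsub>src (lax_comp G F)\<^esub> f') \<cdot>\<^bsub>tgt (lax_comp G F)\<^esub> lmul (lax_comp G F) (a, a')"
    using lax_comp_natural[of f f'] by (auto simp: homset_def)
qed (use lax_comp_assoc_law lax_comp_unit_laws in
  \<open>auto simp: homset_def tgt_F F.farr_cmp_arr[unfolded tgt_F] G.farr_cmp_arr
      F.A.assoc_cmp G.B.assoc_cmp\<close>)

end

text \<open>On objects and arrows this is associativity of function composition. Only
  \<open>lmul\<close> and \<open>lone\<close> need an argument, namely functoriality of
  \<open>H\<close> and associativity in its target.\<close>

lemma lax_comp_assoc:
  assumes "lax_monoidal_functor F" "lax_monoidal_functor G" "lax_monoidal_functor H"
    and "tgt F = src G" "tgt G = src H"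
    and A: "tensor_category (src F)" and B: "tensor_category (src G)"
    and C: "tensor_category (src H)" and D: "tensor_category (tgt H)"
  shows "lax_comp (lax_comp H G) F = lax_comp H (lax_comp G F)"
proof -
  interpret FG: composable_lax_functors F G
    using assms by (simp add: composable_lax_functors_def composable_lax_functors_axioms_def)
  interpret GH: composable_lax_functors G H
    using assms by (simp add: composable_lax_functors_def composable_lax_functors_axioms_def)
  interpret FG_H: composable_lax_functors "lax_comp G F" H
    using FG.lax_comp_lax assms
    by (simp add: composable_lax_functors_def composable_lax_functors_axioms_def)
  interpret F_GH: composable_lax_functors F "lax_comp H G"
    using GH.lax_comp_lax assms
    by (simp add: composable_lax_functors_def composable_lax_functors_axioms_def)
  show ?thesis
    by (rule lax_functor_eqI[OF F_GH.lax_comp_lax FG_H.lax_comp_lax])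
      (simp_all add: assms GH.G.farr_cmp_arr GH.G.B.assoc_cmp)
qed

section \<open>Functors with identity coherence maps\<close>

lemma strict_lax_simps [simp]:
  "src (strict_lax S T fo fa) = S" "tgt (strict_lax S T fo fa) = T"
  "a \<in> Obj S \<Longrightarrow> fobj (strict_lax S T fo fa) a = fo a"
  "f \<in> Arr S \<Longrightarrow> farr (strict_lax S T fo fa) f = fa f"
  "a \<in> Obj S \<Longrightarrow> b \<in> Obj S \<Longrightarrow> lmul (strict_lax S T fo fa) (a, b) = ident T (fo (a \<odot>\<^bsub>S\<^esub> b))"
  "lone (strict_lax S T fo fa) = ident T (tunit T)"
  by (simp_all add: strict_lax_def)

text \<open>With identities as coherence maps every law of a lax functor collapses to the
  preservation of one structure arrow. This serves identity functors, the structure arrows of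
  \<open>MonCat\<close>, the product and unit of a posetal category, and the functor to the
  point.\<close>

lemma strict_lax_lax:
  assumes "tensor_category S" "tensor_category T"
    and fo: "\<And>a. a \<in> Obj S \<Longrightarrow> fo a \<in> Obj T"
    and fa: "\<And>f a b. f \<in> homset S a b \<Longrightarrow> fa f \<in> homset T (fo a) (fo b)"
    and fa_ident: "\<And>a. a \<in> Obj S \<Longrightarrow> fa (ident S a) = ident T (fo a)"
    and fa_cmp: "\<And>f g a b c. f \<in> homset S a b \<Longrightarrow> g \<in> homset S b c \<Longrightarrow>
      fa (g \<cdot>\<^bsub>S\<^esub> f) = fa g \<cdot>\<^bsub>T\<^esub> fa f"
    and fo_tensor: "\<And>a b. a \<in> Obj S \<Longrightarrow> b \<in> Obj S \<Longrightarrow> fo (a \<odot>\<^bsub>S\<^esub> b) = fo a \<odot>\<^bsub>T\<^esub> fo b"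
    and fa_tensor: "\<And>f g. f \<in> Arr S \<Longrightarrow> g \<in> Arr S \<Longrightarrow> fa (f \<boxtimes>\<^bsub>S\<^esub> g) = fa f \<boxtimes>\<^bsub>T\<^esub> fa g"
    and fo_unit: "fo (tunit S) = tunit T"
    and fa_assoc: "\<And>a b c. a \<in> Obj S \<Longrightarrow> b \<in> Obj S \<Longrightarrow> c \<in> Obj S \<Longrightarrow>
      fa (assoc S a b c) = assoc T (fo a) (fo b) (fo c)"
    and fa_lunit: "\<And>a. a \<in> Obj S \<Longrightarrow> fa (lunit S a) = lunit T (fo a)"
    and fa_runit: "\<And>a. a \<in> Obj S \<Longrightarrow> fa (runit S a) = runit T (fo a)"
  shows "lax_monoidal_functor (strict_lax S T fo fa)"
proof -
  interpret S: tensor_category S by fact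
  interpret T: tensor_category T by fact
  have [simp]: "f \<in> Arr S \<Longrightarrow> fa f \<in> Arr T" "f \<in> Arr S \<Longrightarrow> Dom T (fa f) = fo (Dom S f)"
    "f \<in> Arr S \<Longrightarrow> Cod T (fa f) = fo (Cod S f)" for f
    using fa[of f "Dom S f" "Cod S f"] by (auto simp: homset_def)
  have [simp]: "fa (g \<cdot>\<^bsub>S\<^esub> f) = fa g \<cdot>\<^bsub>T\<^esub> fa f" if "f \<in> Arr S" "g \<in> Arr S" "Cod S f = Dom S g" for f g
    using fa_cmp[of f "Dom S f" "Cod S f" g "Cod S g"] that by (auto simp: homset_def)
  have ext: "fobj (strict_lax S T fo fa) \<in> extensional (Obj S)"
    "farr (strict_lax S T fo fa) \<in> extensional (Arr S)"
    "lmul (strict_lax S T fo fa) \<in> extensional (Obj S \<times> Obj S)"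
    by (simp_all add: strict_lax_def)
  show ?thesis
    by unfold_locales
      (auto simp: homset_def fo fo_tensor fo_unit fa_ident fa_tensor fa_assoc fa_lunit fa_runit ext
        S.assoc_cmp T.assoc_cmp
        intro!: fo)
qed

lemma lax_id_simps [simp]:
  "src (lax_id C) = C" "tgt (lax_id C) = C"
  "a \<in> Obj C \<Longrightarrow> fobj (lax_id C) a = a"
  "f \<in> Arr C \<Longrightarrow> farr (lax_id C) f = f"
  "a \<in> Obj C \<Longrightarrow> b \<in> Obj C \<Longrightarrow> lmul (lax_id C) (a, b) = ident C (a \<odot>\<^bsub>C\<^esub> b)"
  "lone (lax_id C) = ident C (tunit C)"
  by (simp_all add: lax_id_def)

lemma lax_id_lax: "tensor_category C \<Longrightarrow> lax_monoidal_functor (lax_id C)"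
  unfolding lax_id_def by (rule strict_lax_lax) auto

lemma lax_comp_ident:
  assumes "lax_monoidal_functor F" and A: "tensor_category (src F)" and B: "tensor_category (tgt F)"
  shows "lax_comp (lax_id (tgt F)) F = F" and "lax_comp F (lax_id (src F)) = F"
proof -
  interpret F: lax_monoidal_functor F by fact
  interpret A: tensor_category "src F" by fact
  interpret B: tensor_category "tgt F" by fact
  interpret l: composable_lax_functors F "lax_id (tgt F)"
    using assms(1) lax_id_lax[OF B] A B by (simp add: composable_lax_functors_def composable_lax_functors_axioms_def)
  interpret r: composable_lax_functors "lax_id (src F)" F
    using assms(1) lax_id_lax[OF A] A B by (simp add: composable_lax_functors_def composable_lax_functors_axioms_def)
  show "lax_comp (lax_id (tgt F)) F = F"
    by (rule lax_functor_eqI[OF l.lax_comp_lax assms(1)]) simp_all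
  show "lax_comp F (lax_id (src F)) = F"
    by (rule lax_functor_eqI[OF r.lax_comp_lax assms(1)]) simp_all
qed

section \<open>The tensor category of small monoidal categories\<close>

context grothendieck_universe
begin

section \<open>Products of monoidal categories and of lax functors\<close>

abbreviation pair (\<open>\<langle>_, _\<rangle>\<close>) where "\<langle>a, b\<rangle> \<equiv> upair el a b"

abbreviation prod_cat (infixl \<open>\<times>\<^sub>C\<close> 70) where "A \<times>\<^sub>C B \<equiv> prod_moncat el A B"

lemma prod_moncat_simps [simp]:
  "\<langle>a, b\<rangle> \<in> Obj (A \<times>\<^sub>C B) \<longleftrightarrow> a \<in> Obj A \<and> b \<in> Obj B"
  "\<langle>f, g\<rangle> \<in> Arr (A \<times>\<^sub>C B) \<longleftrightarrow> f \<in> Arr A \<and> g \<in> Arr B"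
  "Dom (A \<times>\<^sub>C B) \<langle>f, g\<rangle> = \<langle>Dom A f, Dom B g\<rangle>"
  "Cod (A \<times>\<^sub>C B) \<langle>f, g\<rangle> = \<langle>Cod A f, Cod B g\<rangle>"
  "ident (A \<times>\<^sub>C B) \<langle>a, b\<rangle> = \<langle>ident A a, ident B b\<rangle>"
  "\<langle>f', g'\<rangle> \<cdot>\<^bsub>A \<times>\<^sub>C B\<^esub> \<langle>f, g\<rangle> = \<langle>f' \<cdot>\<^bsub>A\<^esub> f, g' \<cdot>\<^bsub>B\<^esub> g\<rangle>"
  "\<langle>a, b\<rangle> \<odot>\<^bsub>A \<times>\<^sub>C B\<^esub> \<langle>a', b'\<rangle> = \<langle>a \<odot>\<^bsub>A\<^esub> a', b \<odot>\<^bsub>B\<^esub> b'\<rangle>"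
  "\<langle>f, g\<rangle> \<boxtimes>\<^bsub>A \<times>\<^sub>C B\<^esub> \<langle>f', g'\<rangle> = \<langle>f \<boxtimes>\<^bsub>A\<^esub> f', g \<boxtimes>\<^bsub>B\<^esub> g'\<rangle>"
  "tunit (A \<times>\<^sub>C B) = \<langle>tunit A, tunit B\<rangle>"
  "assoc (A \<times>\<^sub>C B) \<langle>a, b\<rangle> \<langle>a', b'\<rangle> \<langle>a'', b''\<rangle> = \<langle>assoc A a a' a'', assoc B b b' b''\<rangle>"
  "lunit (A \<times>\<^sub>C B) \<langle>a, b\<rangle> = \<langle>lunit A a, lunit B b\<rangle>"
  "runit (A \<times>\<^sub>C B) \<langle>a, b\<rangle> = \<langle>runit A a, runit B b\<rangle>"
  by (auto simp: prod_moncat_def Let_def)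

lemma homset_prod [simp]:
  "\<langle>f, g\<rangle> \<in> homset (A \<times>\<^sub>C B) \<langle>a, b\<rangle> \<langle>a', b'\<rangle> \<longleftrightarrow> f \<in> homset A a a' \<and> g \<in> homset B b b'"
  by (auto simp: homset_def)

text \<open>The operations of a product are given through projections and compute only on explicit
  pairs. The elimination rules supply these pairs; the equations above do the rest
  componentwise.\<close>

lemma prod_ObjE:
  assumes "p \<in> Obj (A \<times>\<^sub>C B)"
  obtains a b where "p = \<langle>a, b\<rangle>" "a \<in> Obj A" "b \<in> Obj B"
  using assms by (auto simp: prod_moncat_def Let_def)

lemma prod_ArrE:
  assumes "p \<in> Arr (A \<times>\<^sub>C B)"
  obtains f g where "p = \<langle>f, g\<rangle>" "f \<in> Arr A" "g \<in> Arr B"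
  using assms by (auto simp: prod_moncat_def Let_def)

lemma prod_homsetE:
  assumes "p \<in> homset (A \<times>\<^sub>C B) x y"
  obtains f g a b a' b' where "p = \<langle>f, g\<rangle>" "x = \<langle>a, b\<rangle>" "y = \<langle>a', b'\<rangle>"
    "f \<in> homset A a a'" "g \<in> homset B b b'"
  using assms by (auto simp: homset_def elim!: prod_ArrE)

lemma prod_is_iso: "is_iso A f \<Longrightarrow> is_iso B g \<Longrightarrow> is_iso (A \<times>\<^sub>C B) \<langle>f, g\<rangle>"
proof -
  assume "is_iso A f" "is_iso B g"
  then obtain f' g' where "inverse_arrows A f f'" "inverse_arrows B g g'"
    by (auto simp: is_iso_def)
  then have "inverse_arrows (A \<times>\<^sub>C B) \<langle>f, g\<rangle> \<langle>f', g'\<rangle>"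
    by (auto simp: inverse_arrows_def)
  then show ?thesis
    by (auto simp: is_iso_def)
qed

text \<open>Here all coherence laws are checked, including pentagon and triangle, since a product
  has to be an object of \<open>MonCat\<close> again.\<close>

lemma prod_monoidal_category:
  assumes "monoidal_category A" "monoidal_category B"
  shows "monoidal_category (A \<times>\<^sub>C B)"
proof -
  interpret A: monoidal_category A by fact
  interpret B: monoidal_category B by fact
  show ?thesis
  proof
    show "\<And>f. f \<in> Arr (A \<times>\<^sub>C B) \<Longrightarrow> Dom (A \<times>\<^sub>C B) f \<in> Obj (A \<times>\<^sub>C B)"
      "\<And>f. f \<in> Arr (A \<times>\<^sub>C B) \<Longrightarrow> Cod (A \<times>\<^sub>C B) f \<in> Obj (A \<times>\<^sub>C B)"
      by (auto elim!: prod_ArrE)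
    show "\<And>a. a \<in> Obj (A \<times>\<^sub>C B) \<Longrightarrow> ident (A \<times>\<^sub>C B) a \<in> homset (A \<times>\<^sub>C B) a a"
      by (auto elim!: prod_ObjE intro: A.ident_hom B.ident_hom)
    show "f \<in> homset (A \<times>\<^sub>C B) a b \<Longrightarrow> g \<in> homset (A \<times>\<^sub>C B) b c
        \<Longrightarrow> g \<cdot>\<^bsub>A \<times>\<^sub>C B\<^esub> f \<in> homset (A \<times>\<^sub>C B) a c" for f g a b c
      by (auto elim!: prod_homsetE intro: A.cmp_hom B.cmp_hom)
    show "f \<in> homset (A \<times>\<^sub>C B) a b \<Longrightarrow> ident (A \<times>\<^sub>C B) b \<cdot>\<^bsub>A \<times>\<^sub>C B\<^esub> f = f"
      "f \<in> homset (A \<times>\<^sub>C B) a b \<Longrightarrow> f \<cdot>\<^bsub>A \<times>\<^sub>C B\<^esub> ident (A \<times>\<^sub>C B) a = f" for f a b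
      by (auto elim!: prod_homsetE intro: A.ident_left B.ident_left A.ident_right B.ident_right)
    show "f \<in> homset (A \<times>\<^sub>C B) a b \<Longrightarrow> g \<in> homset (A \<times>\<^sub>C B) b c \<Longrightarrow> h \<in> homset (A \<times>\<^sub>C B) c d
      \<Longrightarrow> (h \<cdot>\<^bsub>A \<times>\<^sub>C B\<^esub> g) \<cdot>\<^bsub>A \<times>\<^sub>C B\<^esub> f = h \<cdot>\<^bsub>A \<times>\<^sub>C B\<^esub> (g \<cdot>\<^bsub>A \<times>\<^sub>C B\<^esub> f)" for f g h a b c d
      by (auto elim!: prod_homsetE intro: A.cmp_assoc B.cmp_assoc)
    show "a \<in> Obj (A \<times>\<^sub>C B) \<Longrightarrow> b \<in> Obj (A \<times>\<^sub>C B) \<Longrightarrow> a \<odot>\<^bsub>A \<times>\<^sub>C B\<^esub> b \<in> Obj (A \<times>\<^sub>C B)" for a b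
      by (auto elim!: prod_ObjE)
    show "f \<in> homset (A \<times>\<^sub>C B) a a' \<Longrightarrow> g \<in> homset (A \<times>\<^sub>C B) b b'
      \<Longrightarrow> f \<boxtimes>\<^bsub>A \<times>\<^sub>C B\<^esub> g \<in> homset (A \<times>\<^sub>C B) (a \<odot>\<^bsub>A \<times>\<^sub>C B\<^esub> b) (a' \<odot>\<^bsub>A \<times>\<^sub>C B\<^esub> b')" for f g a b a' b'
      by (auto elim!: prod_homsetE intro: A.tarr_hom B.tarr_hom)
    show "a \<in> Obj (A \<times>\<^sub>C B) \<Longrightarrow> b \<in> Obj (A \<times>\<^sub>C B)
      \<Longrightarrow> ident (A \<times>\<^sub>C B) a \<boxtimes>\<^bsub>A \<times>\<^sub>C B\<^esub> ident (A \<times>\<^sub>C B) b = ident (A \<times>\<^sub>C B) (a \<odot>\<^bsub>A \<times>\<^sub>C B\<^esub> b)" for a b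
      by (auto elim!: prod_ObjE)
    show "f \<in> homset (A \<times>\<^sub>C B) a a' \<Longrightarrow> f' \<in> homset (A \<times>\<^sub>C B) a' a'' \<Longrightarrow>
      g \<in> homset (A \<times>\<^sub>C B) b b' \<Longrightarrow> g' \<in> homset (A \<times>\<^sub>C B) b' b'' \<Longrightarrow>
      (f' \<cdot>\<^bsub>A \<times>\<^sub>C B\<^esub> f) \<boxtimes>\<^bsub>A \<times>\<^sub>C B\<^esub> (g' \<cdot>\<^bsub>A \<times>\<^sub>C B\<^esub> g)
        = (f' \<boxtimes>\<^bsub>A \<times>\<^sub>C B\<^esub> g') \<cdot>\<^bsub>A \<times>\<^sub>C B\<^esub> (f \<boxtimes>\<^bsub>A \<times>\<^sub>C B\<^esub> g)" for f f' g g' a a' a'' b b' b''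
      by (auto elim!: prod_homsetE intro: A.tarr_cmp_hom B.tarr_cmp_hom)
    show "tunit (A \<times>\<^sub>C B) \<in> Obj (A \<times>\<^sub>C B)"
      by simp
    fix a b c assume a: "a \<in> Obj (A \<times>\<^sub>C B)" and b: "b \<in> Obj (A \<times>\<^sub>C B)"
    show "lunit (A \<times>\<^sub>C B) a \<in> homset (A \<times>\<^sub>C B) (tunit (A \<times>\<^sub>C B) \<odot>\<^bsub>A \<times>\<^sub>C B\<^esub> a) a"
      "runit (A \<times>\<^sub>C B) a \<in> homset (A \<times>\<^sub>C B) (a \<odot>\<^bsub>A \<times>\<^sub>C B\<^esub> tunit (A \<times>\<^sub>C B)) a"
      "is_iso (A \<times>\<^sub>C B) (lunit (A \<times>\<^sub>C B) a)" "is_iso (A \<times>\<^sub>C B) (runit (A \<times>\<^sub>C B) a)"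
      using a by (auto elim!: prod_ObjE intro!: A.lunit_hom B.lunit_hom A.runit_hom B.runit_hom
          prod_is_iso A.lunit_iso B.lunit_iso A.runit_iso B.runit_iso)
    show "(ident (A \<times>\<^sub>C B) a \<boxtimes>\<^bsub>A \<times>\<^sub>C B\<^esub> lunit (A \<times>\<^sub>C B) b) \<cdot>\<^bsub>A \<times>\<^sub>C B\<^esub> assoc (A \<times>\<^sub>C B) a (tunit (A \<times>\<^sub>C B)) b
        = runit (A \<times>\<^sub>C B) a \<boxtimes>\<^bsub>A \<times>\<^sub>C B\<^esub> ident (A \<times>\<^sub>C B) b"
      using a b by (auto elim!: prod_ObjE simp: A.triangle B.triangle)
    assume c: "c \<in> Obj (A \<times>\<^sub>C B)"
    show "assoc (A \<times>\<^sub>C B) a b c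
        \<in> homset (A \<times>\<^sub>C B) (a \<odot>\<^bsub>A \<times>\<^sub>C B\<^esub> b \<odot>\<^bsub>A \<times>\<^sub>C B\<^esub> c) (a \<odot>\<^bsub>A \<times>\<^sub>C B\<^esub> (b \<odot>\<^bsub>A \<times>\<^sub>C B\<^esub> c))"
      "is_iso (A \<times>\<^sub>C B) (assoc (A \<times>\<^sub>C B) a b c)"
      using a b c by (auto elim!: prod_ObjE intro!: A.assoc_hom B.assoc_hom prod_is_iso A.assoc_iso B.assoc_iso)
    fix d assume d: "d \<in> Obj (A \<times>\<^sub>C B)"
    show "(ident (A \<times>\<^sub>C B) a \<boxtimes>\<^bsub>A \<times>\<^sub>C B\<^esub> assoc (A \<times>\<^sub>C B) b c d) \<cdot>\<^bsub>A \<times>\<^sub>C B\<^esub>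
        (assoc (A \<times>\<^sub>C B) a (b \<odot>\<^bsub>A \<times>\<^sub>C B\<^esub> c) d \<cdot>\<^bsub>A \<times>\<^sub>C B\<^esub> (assoc (A \<times>\<^sub>C B) a b c \<boxtimes>\<^bsub>A \<times>\<^sub>C B\<^esub> ident (A \<times>\<^sub>C B) d))
      = assoc (A \<times>\<^sub>C B) a b (c \<odot>\<^bsub>A \<times>\<^sub>C B\<^esub> d) \<cdot>\<^bsub>A \<times>\<^sub>C B\<^esub> assoc (A \<times>\<^sub>C B) (a \<odot>\<^bsub>A \<times>\<^sub>C B\<^esub> b) c d"
      using a b c d by (auto elim!: prod_ObjE simp: A.pentagon B.pentagon)
  next
    fix f a a' g b b' h c c'
    assume f: "f \<in> homset (A \<times>\<^sub>C B) a a'"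
    then show "lunit (A \<times>\<^sub>C B) a' \<cdot>\<^bsub>A \<times>\<^sub>C B\<^esub> (ident (A \<times>\<^sub>C B) (tunit (A \<times>\<^sub>C B)) \<boxtimes>\<^bsub>A \<times>\<^sub>C B\<^esub> f)
        = f \<cdot>\<^bsub>A \<times>\<^sub>C B\<^esub> lunit (A \<times>\<^sub>C B) a"
      "runit (A \<times>\<^sub>C B) a' \<cdot>\<^bsub>A \<times>\<^sub>C B\<^esub> (f \<boxtimes>\<^bsub>A \<times>\<^sub>C B\<^esub> ident (A \<times>\<^sub>C B) (tunit (A \<times>\<^sub>C B)))
        = f \<cdot>\<^bsub>A \<times>\<^sub>C B\<^esub> runit (A \<times>\<^sub>C B) a"
      by (auto elim!: prod_homsetE
          intro: A.lunit_natural B.lunit_natural A.runit_natural B.runit_natural)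
    assume "g \<in> homset (A \<times>\<^sub>C B) b b'" "h \<in> homset (A \<times>\<^sub>C B) c c'"
    with f show "assoc (A \<times>\<^sub>C B) a' b' c' \<cdot>\<^bsub>A \<times>\<^sub>C B\<^esub> (f \<boxtimes>\<^bsub>A \<times>\<^sub>C B\<^esub> g \<boxtimes>\<^bsub>A \<times>\<^sub>C B\<^esub> h)
        = (f \<boxtimes>\<^bsub>A \<times>\<^sub>C B\<^esub> (g \<boxtimes>\<^bsub>A \<times>\<^sub>C B\<^esub> h)) \<cdot>\<^bsub>A \<times>\<^sub>C B\<^esub> assoc (A \<times>\<^sub>C B) a b c"
      by (auto elim!: prod_homsetE intro: A.assoc_natural B.assoc_natural)
  qed
qed

lemma prod_lax_simps [simp]:
  "src (prod_lax el F G) = src F \<times>\<^sub>C src G" "tgt (prod_lax el F G) = tgt F \<times>\<^sub>C tgt G"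
  "a \<in> Obj (src F) \<Longrightarrow> b \<in> Obj (src G) \<Longrightarrow> fobj (prod_lax el F G) \<langle>a, b\<rangle> = \<langle>fobj F a, fobj G b\<rangle>"
  "f \<in> Arr (src F) \<Longrightarrow> g \<in> Arr (src G) \<Longrightarrow> farr (prod_lax el F G) \<langle>f, g\<rangle> = \<langle>farr F f, farr G g\<rangle>"
  "a \<in> Obj (src F) \<Longrightarrow> b \<in> Obj (src G) \<Longrightarrow> a' \<in> Obj (src F) \<Longrightarrow> b' \<in> Obj (src G)
    \<Longrightarrow> lmul (prod_lax el F G) (\<langle>a, b\<rangle>, \<langle>a', b'\<rangle>) = \<langle>lmul F (a, a'), lmul G (b, b')\<rangle>"
  "lone (prod_lax el F G) = \<langle>lone F, lone G\<rangle>"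
  by (simp_all add: prod_lax_def Let_def)

lemma prod_lax_lax:
  assumes "lax_monoidal_functor F" "lax_monoidal_functor G"
    and A: "monoidal_category (src F)" and B: "monoidal_category (src G)"
    and A': "monoidal_category (tgt F)" and B': "monoidal_category (tgt G)"
  shows "lax_monoidal_functor (prod_lax el F G)"
proof -
  interpret F: lax_monoidal_functor F by fact
  interpret G: lax_monoidal_functor G by fact
  interpret A: monoidal_category "src F" by fact
  interpret B: monoidal_category "src G" by fact
  interpret A': monoidal_category "tgt F" by fact
  interpret B': monoidal_category "tgt G" by fact
  interpret S: monoidal_category "src F \<times>\<^sub>C src G"
    using A B by (rule prod_monoidal_category)
  interpret T: monoidal_category "tgt F \<times>\<^sub>C tgt G"
    using A' B' by (rule prod_monoidal_category)
  let ?H = "prod_lax el F G"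
  show ?thesis
  \<comment> \<open>The locale predicates are opened by hand so that source and target can be
    rewritten to the product categories in all goals at once.\<close>
  proof (intro lax_monoidal_functor.intro is_functor.intro is_functor_axioms.intro
      lax_monoidal_functor_axioms.intro, unfold prod_lax_simps(1,2))
    show "category (src F \<times>\<^sub>C src G)" "category (tgt F \<times>\<^sub>C tgt G)"
      by unfold_locales
    show "fobj ?H \<in> extensional (Obj (src F \<times>\<^sub>C src G))"
      "farr ?H \<in> extensional (Arr (src F \<times>\<^sub>C src G))"
      "lmul ?H \<in> extensional (Obj (src F \<times>\<^sub>C src G) \<times> Obj (src F \<times>\<^sub>C src G))"
      by (simp_all add: prod_lax_def Let_def)
    fix a assume a: "a \<in> Obj (src F \<times>\<^sub>C src G)"
    then show "fobj ?H a \<in> Obj (tgt F \<times>\<^sub>C tgt G)"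
      "farr ?H (ident (src F \<times>\<^sub>C src G) a) = ident (tgt F \<times>\<^sub>C tgt G) (fobj ?H a)"
      by (auto elim!: prod_ObjE)
    show "farr ?H (lunit (src F \<times>\<^sub>C src G) a) \<cdot>\<^bsub>tgt F \<times>\<^sub>C tgt G\<^esub>
        (lmul ?H (tunit (src F \<times>\<^sub>C src G), a) \<cdot>\<^bsub>tgt F \<times>\<^sub>C tgt G\<^esub>
          (lone ?H \<boxtimes>\<^bsub>tgt F \<times>\<^sub>C tgt G\<^esub> ident (tgt F \<times>\<^sub>C tgt G) (fobj ?H a)))
      = lunit (tgt F \<times>\<^sub>C tgt G) (fobj ?H a)"
      using a by (auto elim!: prod_ObjE simp: F.lax_lunit G.lax_lunit)
    show "farr ?H (runit (src F \<times>\<^sub>C src G) a) \<cdot>\<^bsub>tgt F \<times>\<^sub>C tgt G\<^esub>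
        (lmul ?H (a, tunit (src F \<times>\<^sub>C src G)) \<cdot>\<^bsub>tgt F \<times>\<^sub>C tgt G\<^esub>
          (ident (tgt F \<times>\<^sub>C tgt G) (fobj ?H a) \<boxtimes>\<^bsub>tgt F \<times>\<^sub>C tgt G\<^esub> lone ?H))
      = runit (tgt F \<times>\<^sub>C tgt G) (fobj ?H a)"
      using a by (auto elim!: prod_ObjE simp: F.lax_runit G.lax_runit)
    fix b assume b: "b \<in> Obj (src F \<times>\<^sub>C src G)"
    show "lmul ?H (a, b) \<in> homset (tgt F \<times>\<^sub>C tgt G)
        (fobj ?H a \<odot>\<^bsub>tgt F \<times>\<^sub>C tgt G\<^esub> fobj ?H b) (fobj ?H (a \<odot>\<^bsub>src F \<times>\<^sub>C src G\<^esub> b))"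
      using a b by (auto elim!: prod_ObjE intro: F.lmul_hom G.lmul_hom)
    fix c assume c: "c \<in> Obj (src F \<times>\<^sub>C src G)"
    show "farr ?H (assoc (src F \<times>\<^sub>C src G) a b c) \<cdot>\<^bsub>tgt F \<times>\<^sub>C tgt G\<^esub>
        (lmul ?H (a \<odot>\<^bsub>src F \<times>\<^sub>C src G\<^esub> b, c) \<cdot>\<^bsub>tgt F \<times>\<^sub>C tgt G\<^esub>
          (lmul ?H (a, b) \<boxtimes>\<^bsub>tgt F \<times>\<^sub>C tgt G\<^esub> ident (tgt F \<times>\<^sub>C tgt G) (fobj ?H c)))
      = lmul ?H (a, b \<odot>\<^bsub>src F \<times>\<^sub>C src G\<^esub> c) \<cdot>\<^bsub>tgt F \<times>\<^sub>C tgt G\<^esub>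
        ((ident (tgt F \<times>\<^sub>C tgt G) (fobj ?H a) \<boxtimes>\<^bsub>tgt F \<times>\<^sub>C tgt G\<^esub> lmul ?H (b, c)) \<cdot>\<^bsub>tgt F \<times>\<^sub>C tgt G\<^esub>
          assoc (tgt F \<times>\<^sub>C tgt G) (fobj ?H a) (fobj ?H b) (fobj ?H c))"
      using a b c by (auto elim!: prod_ObjE simp: F.lax_assoc G.lax_assoc)
  next
    show "lone ?H \<in> homset (tgt F \<times>\<^sub>C tgt G) (tunit (tgt F \<times>\<^sub>C tgt G))
        (fobj ?H (tunit (src F \<times>\<^sub>C src G)))"
      by (simp add: F.lone_hom G.lone_hom)
    fix f a a' g b b' assume f: "f \<in> homset (src F \<times>\<^sub>C src G) a a'"
    then show "farr ?H f \<in> homset (tgt F \<times>\<^sub>C tgt G) (fobj ?H a) (fobj ?H a')"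
      by (auto elim!: prod_ArrE simp: homset_def)
    { assume "g \<in> homset (src F \<times>\<^sub>C src G) b b'"
      with f show "lmul ?H (a', b') \<cdot>\<^bsub>tgt F \<times>\<^sub>C tgt G\<^esub> (farr ?H f \<boxtimes>\<^bsub>tgt F \<times>\<^sub>C tgt G\<^esub> farr ?H g)
          = farr ?H (f \<boxtimes>\<^bsub>src F \<times>\<^sub>C src G\<^esub> g) \<cdot>\<^bsub>tgt F \<times>\<^sub>C tgt G\<^esub> lmul ?H (a, b)"
        by (auto elim!: prod_ArrE simp: homset_def F.lmul_natural_arr G.lmul_natural_arr) }
    { assume "g \<in> homset (src F \<times>\<^sub>C src G) a' b'"
      with f show "farr ?H (g \<cdot>\<^bsub>src F \<times>\<^sub>C src G\<^esub> f) = farr ?H g \<cdot>\<^bsub>tgt F \<times>\<^sub>C tgt G\<^esub> farr ?H f"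
        by (auto elim!: prod_ArrE simp: homset_def F.farr_cmp_arr G.farr_cmp_arr) }
  qed
qed

text \<open>Together with \<open>prod_lax_comp\<close> this is the functoriality of the tensor
  product of \<open>MonCat\<close>.\<close>

lemma prod_lax_ident:
  assumes "monoidal_category A" "monoidal_category B"
  shows "prod_lax el (lax_id A) (lax_id B) = lax_id (A \<times>\<^sub>C B)"
  by (rule lax_functor_eqI[OF prod_lax_lax lax_id_lax])
    (auto elim!: prod_ObjE prod_ArrE
      simp: assms lax_id_lax monoidal_category_tensor prod_monoidal_category
        tensor_category.tobj_obj[OF monoidal_category_tensor])

lemma prod_lax_comp:
  assumes F: "lax_monoidal_functor F" "monoidal_category (src F)" "tgt F = src F'"
    and F': "lax_monoidal_functor F'" "monoidal_category (src F')" "monoidal_category (tgt F')"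
    and G: "lax_monoidal_functor G" "monoidal_category (src G)" "tgt G = src G'"
    and G': "lax_monoidal_functor G'" "monoidal_category (src G')" "monoidal_category (tgt G')"
  shows "lax_comp (prod_lax el F' G') (prod_lax el F G) = prod_lax el (lax_comp F' F) (lax_comp G' G)"
proof -
  interpret F: composable_lax_functors F F'
    using F F' by (simp add: composable_lax_functors_def composable_lax_functors_axioms_def
        monoidal_category_tensor)
  interpret G: composable_lax_functors G G'
    using G G' by (simp add: composable_lax_functors_def composable_lax_functors_axioms_def
        monoidal_category_tensor)
  interpret FG: composable_lax_functors "prod_lax el F G" "prod_lax el F' G'"
    using F F' G G' by (simp add: composable_lax_functors_def composable_lax_functors_axioms_def
        monoidal_category_tensor prod_monoidal_category prod_lax_lax)
  have *: "lax_monoidal_functor (prod_lax el (lax_comp F' F) (lax_comp G' G))"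
    using F F' G G' by (intro prod_lax_lax F.lax_comp_lax G.lax_comp_lax) simp_all
  show ?thesis
    by (rule lax_functor_eqI[OF FG.lax_comp_lax *])
      (auto elim!: prod_ObjE prod_ArrE simp: F.tgt_F G.tgt_F)
qed

section \<open>The terminal monoidal category and \<open>MonCat\<close>\<close>

lemma terminal_moncat_simps [simp]:
  "Obj (terminal_moncat el) = {bullet el}" "Arr (terminal_moncat el) = {bullet el}"
  "Dom (terminal_moncat el) f = bullet el" "Cod (terminal_moncat el) f = bullet el"
  "ident (terminal_moncat el) a = bullet el" "f \<cdot>\<^bsub>terminal_moncat el\<^esub> g = bullet el"
  "a \<odot>\<^bsub>terminal_moncat el\<^esub> b = bullet el" "f \<boxtimes>\<^bsub>terminal_moncat el\<^esub> g = bullet el"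
  "tunit (terminal_moncat el) = bullet el" "assoc (terminal_moncat el) a b c = bullet el"
  "lunit (terminal_moncat el) a = bullet el" "runit (terminal_moncat el) a = bullet el"
  by (simp_all add: terminal_moncat_def)

lemma terminal_monoidal_category: "monoidal_category (terminal_moncat el)"
  by unfold_locales (auto simp: homset_def is_iso_def inverse_arrows_def)

lemma MonCat_simps [simp]:
  "Dom (MonCat el) = src" "Cod (MonCat el) = tgt" "ident (MonCat el) = lax_id"
  "cmp (MonCat el) = lax_comp" "tobj (MonCat el) = prod_moncat el" "tarr (MonCat el) = prod_lax el"
  "tunit (MonCat el) = terminal_moncat el"
  "assoc (MonCat el) A B C = strict_lax (A \<times>\<^sub>C B \<times>\<^sub>C C) (A \<times>\<^sub>C (B \<times>\<^sub>C C)) (reassoc el) (reassoc el)"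
  "lunit (MonCat el) C = strict_lax (terminal_moncat el \<times>\<^sub>C C) C (usnd el) (usnd el)"
  "runit (MonCat el) C = strict_lax (C \<times>\<^sub>C terminal_moncat el) C (ufst el) (ufst el)"
  by (simp_all add: MonCat_def Let_def)

lemma MonCat_Obj:
  "C \<in> Obj (MonCat el) \<longleftrightarrow> monoidal_category C \<and> small el (Obj C) \<and> small el (Arr C)"
  by (simp add: MonCat_def Let_def)

lemma MonCat_Arr:
  "F \<in> Arr (MonCat el) \<longleftrightarrow>
    lax_monoidal_functor F \<and> src F \<in> Obj (MonCat el) \<and> tgt F \<in> Obj (MonCat el)"
  by (simp add: MonCat_def Let_def)

lemma MonCat_monoidal: "C \<in> Obj (MonCat el) \<Longrightarrow> monoidal_category C"
  by (simp add: MonCat_Obj)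

lemma MonCat_tensor: "C \<in> Obj (MonCat el) \<Longrightarrow> tensor_category C"
  by (simp add: MonCat_Obj monoidal_category_tensor)

lemma prod_in_MonCat: "A \<in> Obj (MonCat el) \<Longrightarrow> B \<in> Obj (MonCat el) \<Longrightarrow> A \<times>\<^sub>C B \<in> Obj (MonCat el)"
  by (simp add: MonCat_Obj prod_monoidal_category) (simp add: prod_moncat_def Let_def small_upairs)

lemma terminal_in_MonCat: "terminal_moncat el \<in> Obj (MonCat el)"
  by (simp add: MonCat_Obj terminal_monoidal_category small_singleton)

lemma MonCat_homset:
  "F \<in> homset (MonCat el) A B \<longleftrightarrow> lax_monoidal_functor F \<and> src F = A \<and> tgt F = B \<and>
    A \<in> Obj (MonCat el) \<and> B \<in> Obj (MonCat el)"
  by (auto simp: homset_def MonCat_Arr)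

lemma lax_comp_in_MonCat:
  assumes "F \<in> homset (MonCat el) A B" "G \<in> homset (MonCat el) B C"
  shows "lax_comp G F \<in> homset (MonCat el) A C"
proof -
  interpret composable_lax_functors F G
    using assms by (simp add: MonCat_homset composable_lax_functors_def composable_lax_functors_axioms_def
        MonCat_tensor)
  show ?thesis
    using assms by (simp add: MonCat_homset lax_comp_lax)
qed

lemma reassoc_pair [simp]: "reassoc el \<langle>\<langle>a, b\<rangle>, c\<rangle> = \<langle>a, \<langle>b, c\<rangle>\<rangle>"
  by (simp add: reassoc_def)

text \<open>The structure arrows are lax functors by \<open>strict_lax_lax\<close>: projecting and
  rebracketing commute strictly with the componentwise operations.\<close>

lemma MonCat_tensor_category: "tensor_category (MonCat el)"
proof
  fix F A B G C H D
  assume F: "F \<in> homset (MonCat el) A B"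
  show "ident (MonCat el) B \<cdot>\<^bsub>MonCat el\<^esub> F = F" "F \<cdot>\<^bsub>MonCat el\<^esub> ident (MonCat el) A = F"
    using F lax_comp_ident[of F] by (auto simp: MonCat_homset MonCat_tensor)
  assume G: "G \<in> homset (MonCat el) B C"
  show "G \<cdot>\<^bsub>MonCat el\<^esub> F \<in> homset (MonCat el) A C"
    using lax_comp_in_MonCat[OF F G] by simp
  assume "H \<in> homset (MonCat el) C D"
  with F G show "(H \<cdot>\<^bsub>MonCat el\<^esub> G) \<cdot>\<^bsub>MonCat el\<^esub> F = H \<cdot>\<^bsub>MonCat el\<^esub> (G \<cdot>\<^bsub>MonCat el\<^esub> F)"
    by (auto simp: MonCat_homset MonCat_tensor intro!: lax_comp_assoc)
next
  fix F A A' F' A'' G B B' G' B''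
  assume F: "F \<in> homset (MonCat el) A A'" and G: "G \<in> homset (MonCat el) B B'"
  then show "F \<boxtimes>\<^bsub>MonCat el\<^esub> G \<in> homset (MonCat el) (A \<odot>\<^bsub>MonCat el\<^esub> B) (A' \<odot>\<^bsub>MonCat el\<^esub> B')"
    by (auto simp: MonCat_homset MonCat_monoidal prod_in_MonCat intro!: prod_lax_lax)
  assume "F' \<in> homset (MonCat el) A' A''" "G' \<in> homset (MonCat el) B' B''"
  with F G show "(F' \<cdot>\<^bsub>MonCat el\<^esub> F) \<boxtimes>\<^bsub>MonCat el\<^esub> (G' \<cdot>\<^bsub>MonCat el\<^esub> G)
      = (F' \<boxtimes>\<^bsub>MonCat el\<^esub> G') \<cdot>\<^bsub>MonCat el\<^esub> (F \<boxtimes>\<^bsub>MonCat el\<^esub> G)"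
    by (auto simp: MonCat_homset MonCat_monoidal prod_lax_comp)
next
  fix A B C
  assume A: "A \<in> Obj (MonCat el)"
  interpret A: monoidal_category A using A by (rule MonCat_monoidal)
  interpret I: monoidal_category "terminal_moncat el" by (rule terminal_monoidal_category)
  have "lax_monoidal_functor (strict_lax (terminal_moncat el \<times>\<^sub>C A) A (usnd el) (usnd el))"
    "lax_monoidal_functor (strict_lax (A \<times>\<^sub>C terminal_moncat el) A (ufst el) (ufst el))"
    using A by (auto intro!: strict_lax_lax elim!: prod_ObjE prod_ArrE prod_homsetE
        simp: MonCat_tensor prod_in_MonCat terminal_in_MonCat)
  with A show "lunit (MonCat el) A \<in> homset (MonCat el) (tunit (MonCat el) \<odot>\<^bsub>MonCat el\<^esub> A) A"
    "runit (MonCat el) A \<in> homset (MonCat el) (A \<odot>\<^bsub>MonCat el\<^esub> tunit (MonCat el)) A"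
    by (auto simp: MonCat_homset prod_in_MonCat terminal_in_MonCat)
  assume B: "B \<in> Obj (MonCat el)"
  show "ident (MonCat el) A \<boxtimes>\<^bsub>MonCat el\<^esub> ident (MonCat el) B = ident (MonCat el) (A \<odot>\<^bsub>MonCat el\<^esub> B)"
    using A B by (simp add: prod_lax_ident MonCat_monoidal)
  assume C: "C \<in> Obj (MonCat el)"
  interpret B: monoidal_category B using B by (rule MonCat_monoidal)
  interpret C: monoidal_category C using C by (rule MonCat_monoidal)
  have "lax_monoidal_functor (strict_lax (A \<times>\<^sub>C B \<times>\<^sub>C C) (A \<times>\<^sub>C (B \<times>\<^sub>C C)) (reassoc el) (reassoc el))"
    using A B C by (auto intro!: strict_lax_lax elim!: prod_ObjE prod_ArrE prod_homsetE
        simp: MonCat_tensor prod_in_MonCat)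
  with A B C show "assoc (MonCat el) A B C
    \<in> homset (MonCat el) (A \<odot>\<^bsub>MonCat el\<^esub> B \<odot>\<^bsub>MonCat el\<^esub> C) (A \<odot>\<^bsub>MonCat el\<^esub> (B \<odot>\<^bsub>MonCat el\<^esub> C))"
    by (auto simp: MonCat_homset prod_in_MonCat)
qed (auto simp: MonCat_Arr MonCat_homset prod_in_MonCat terminal_in_MonCat lax_id_lax MonCat_tensor)

end

section \<open>Monoidal transformations and the category of indexed categories\<close>

lemma monoidal_transformationD:
  assumes "monoidal_transformation F G \<theta>"
  shows "src G = src F" "tgt G = tgt F" "\<theta> \<in> extensional (Obj (src F))"
    and "\<And>a. a \<in> Obj (src F) \<Longrightarrow> \<theta> a \<in> Arr (tgt F)"
    and "\<And>a. a \<in> Obj (src F) \<Longrightarrow> Dom (tgt F) (\<theta> a) = fobj F a"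
    and "\<And>a. a \<in> Obj (src F) \<Longrightarrow> Cod (tgt F) (\<theta> a) = fobj G a"
    and "\<And>f a b. a \<in> Obj (src F) \<Longrightarrow> b \<in> Obj (src F) \<Longrightarrow> f \<in> homset (src F) a b \<Longrightarrow>
      \<theta> b \<cdot>\<^bsub>tgt F\<^esub> farr F f = farr G f \<cdot>\<^bsub>tgt F\<^esub> \<theta> a"
    and "\<And>a b. a \<in> Obj (src F) \<Longrightarrow> b \<in> Obj (src F) \<Longrightarrow>
      \<theta> (a \<odot>\<^bsub>src F\<^esub> b) \<cdot>\<^bsub>tgt F\<^esub> lmul F (a, b) = lmul G (a, b) \<cdot>\<^bsub>tgt F\<^esub> (\<theta> a \<boxtimes>\<^bsub>tgt F\<^esub> \<theta> b)"
    and "\<theta> (tunit (src F)) \<cdot>\<^bsub>tgt F\<^esub> lone F = lone G"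
  using assms unfolding monoidal_transformation_def homset_def by auto

lemma identity_transformation:
  assumes "lax_monoidal_functor F" "tensor_category (src F)" "tensor_category (tgt F)"
  shows "monoidal_transformation F F (\<lambda>a\<in>Obj (src F). ident (tgt F) (fobj F a))"
proof -
  interpret F: lax_monoidal_functor F by fact
  interpret A: tensor_category "src F" by fact
  interpret B: tensor_category "tgt F" by fact
  show ?thesis
    by (auto simp: monoidal_transformation_def homset_def)
qed

text \<open>The squares of \<open>\<theta>\<close> and \<open>\<phi>\<close> are pasted;
  compatibility with \<open>lmul\<close> also uses the interchange law \<open>tarr_cmp\<close> of
  the target.\<close>

lemma vertical_composite:
  assumes F: "lax_monoidal_functor F" and G: "lax_monoidal_functor G" and H: "lax_monoidal_functor H"
    and A: "tensor_category (src F)" and B: "tensor_category (tgt F)"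
    and \<theta>: "monoidal_transformation F G \<theta>" and \<phi>: "monoidal_transformation G H \<phi>"
  shows "monoidal_transformation F H (\<lambda>a\<in>Obj (src F). \<phi> a \<cdot>\<^bsub>tgt F\<^esub> \<theta> a)"
proof -
  interpret F: lax_monoidal_functor F by fact
  interpret G: lax_monoidal_functor G by fact
  interpret H: lax_monoidal_functor H by fact
  interpret A: tensor_category "src F" by fact
  interpret B: tensor_category "tgt F" by fact
  \<comment> \<open>All facts about \<open>G\<close> and \<open>H\<close> are restated over the
    source and target of \<open>F\<close>, so that one pair of interpretations covers the three
    functors.\<close>
  note t = monoidal_transformationD[OF \<theta>]
  note p = monoidal_transformationD[OF \<phi>, unfolded t(1,2)]
  note Gs = G.lmul_arr[unfolded t(1,2)] G.lone_arr[unfolded t(1,2)]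
  note Hs = H.lmul_arr[unfolded p(1,2)] H.lone_arr[unfolded p(1,2)]
  note Ga = G.farr_arr[unfolded t(1,2)] G.dom_farr[unfolded t(1,2)] G.cod_farr[unfolded t(1,2)] and
    Ha = H.farr_arr[unfolded p(1,2)] H.dom_farr[unfolded p(1,2)] H.cod_farr[unfolded p(1,2)]
  show ?thesis
    unfolding monoidal_transformation_def
  proof (intro conjI ballI)
    show "src F = src H" "tgt F = tgt H"
      using t p by simp_all
    show "(\<lambda>a\<in>Obj (src F). \<phi> a \<cdot>\<^bsub>tgt F\<^esub> \<theta> a) \<in> extensional (Obj (src F))"
      by simp
    fix a assume a: "a \<in> Obj (src F)"
    then show "(\<lambda>a\<in>Obj (src F). \<phi> a \<cdot>\<^bsub>tgt F\<^esub> \<theta> a) a \<in> homset (tgt F) (fobj F a) (fobj H a)"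
      by (simp add: homset_def t p)
    fix b assume b: "b \<in> Obj (src F)"
    { fix f assume f: "f \<in> homset (src F) a b"
      then have f': "f \<in> Arr (src F)" "Dom (src F) f = a" "Cod (src F) f = b"
        by (auto simp: homset_def)
      have "(\<phi> b \<cdot>\<^bsub>tgt F\<^esub> \<theta> b) \<cdot>\<^bsub>tgt F\<^esub> farr F f = \<phi> b \<cdot>\<^bsub>tgt F\<^esub> (farr G f \<cdot>\<^bsub>tgt F\<^esub> \<theta> a)"
        using a b f' by (simp add: t(7)[OF a b f, symmetric] t(3-6) p(3-6) F.B.assoc_cmp)
      also have "\<dots> = (\<phi> b \<cdot>\<^bsub>tgt F\<^esub> farr G f) \<cdot>\<^bsub>tgt F\<^esub> \<theta> a"
        using a b f' by (simp add: t(3-6) p(3-6) F.B.assoc_cmp Ga)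
      also have "\<dots> = farr H f \<cdot>\<^bsub>tgt F\<^esub> (\<phi> a \<cdot>\<^bsub>tgt F\<^esub> \<theta> a)"
        using a b f' by (simp add: p(7)[OF a b f] t(3-6) p(3-6) F.B.assoc_cmp Ha)
      finally show "(\<lambda>a\<in>Obj (src F). \<phi> a \<cdot>\<^bsub>tgt F\<^esub> \<theta> a) b \<cdot>\<^bsub>tgt F\<^esub> farr F f
          = farr H f \<cdot>\<^bsub>tgt F\<^esub> (\<lambda>a\<in>Obj (src F). \<phi> a \<cdot>\<^bsub>tgt F\<^esub> \<theta> a) a"
        using a b by simp }
    let ?ab = "a \<odot>\<^bsub>src F\<^esub> b"
    have "(\<phi> ?ab \<cdot>\<^bsub>tgt F\<^esub> \<theta> ?ab) \<cdot>\<^bsub>tgt F\<^esub> lmul F (a, b)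
        = \<phi> ?ab \<cdot>\<^bsub>tgt F\<^esub> (lmul G (a, b) \<cdot>\<^bsub>tgt F\<^esub> (\<theta> a \<boxtimes>\<^bsub>tgt F\<^esub> \<theta> b))"
      using a b by (simp add: t(8)[OF a b, symmetric] t(3-6) p(3-6) F.B.assoc_cmp)
    also have "\<dots> = (\<phi> ?ab \<cdot>\<^bsub>tgt F\<^esub> lmul G (a, b)) \<cdot>\<^bsub>tgt F\<^esub> (\<theta> a \<boxtimes>\<^bsub>tgt F\<^esub> \<theta> b)"
      using a b by (simp add: t(3-6) p(3-6) Gs F.B.assoc_cmp)
    also have "\<dots> = lmul H (a, b) \<cdot>\<^bsub>tgt F\<^esub> ((\<phi> a \<cdot>\<^bsub>tgt F\<^esub> \<theta> a) \<boxtimes>\<^bsub>tgt F\<^esub> (\<phi> b \<cdot>\<^bsub>tgt F\<^esub> \<theta> b))"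
      using a b by (simp add: p(8)[OF a b] t(3-6) p(3-6) Hs F.B.assoc_cmp B.tarr_cmp)
    finally show "(\<lambda>a\<in>Obj (src F). \<phi> a \<cdot>\<^bsub>tgt F\<^esub> \<theta> a) ?ab \<cdot>\<^bsub>tgt F\<^esub> lmul F (a, b) = lmul H (a, b) \<cdot>\<^bsub>tgt F\<^esub>
        ((\<lambda>a\<in>Obj (src F). \<phi> a \<cdot>\<^bsub>tgt F\<^esub> \<theta> a) a \<boxtimes>\<^bsub>tgt F\<^esub> (\<lambda>a\<in>Obj (src F). \<phi> a \<cdot>\<^bsub>tgt F\<^esub> \<theta> a) b)"
      using a b by simp
  next
    show "(\<lambda>a\<in>Obj (src F). \<phi> a \<cdot>\<^bsub>tgt F\<^esub> \<theta> a) (tunit (src F)) \<cdot>\<^bsub>tgt F\<^esub> lone F = lone H"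
      by (simp add: F.B.assoc_cmp t p)
  qed
qed

text \<open>The coherence arrows of a composite contain images of those of \<open>K\<close>.
  Naturality of \<open>\<theta>\<close> carries it past these images, and monoidality of
  \<open>\<theta>\<close> past the coherence arrows of \<open>G\<close>.\<close>

lemma whiskered_transformation:
  assumes K: "lax_monoidal_functor K" and G: "lax_monoidal_functor G" and H: "lax_monoidal_functor H"
    and "tgt K = src G"
    and A: "tensor_category (src K)" and B: "tensor_category (src G)" and T: "tensor_category (tgt G)"
    and \<theta>: "monoidal_transformation G H \<theta>"
  shows "monoidal_transformation (lax_comp G K) (lax_comp H K) (\<lambda>a\<in>Obj (src K). \<theta> (fobj K a))"
proof -
  note t = monoidal_transformationD[OF \<theta>]
  interpret KG: composable_lax_functors K G
    using assms by (simp add: composable_lax_functors_def composable_lax_functors_axioms_def)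
  interpret KH: composable_lax_functors K H
    using assms by (simp add: composable_lax_functors_def composable_lax_functors_axioms_def t)
  note H_simps = KH.G.lmul_arr[unfolded t(1,2)] KH.G.lone_arr[unfolded t(1,2)]
    KH.G.farr_arr[unfolded t(1,2)] KH.G.dom_farr[unfolded t(1,2)] KH.G.cod_farr[unfolded t(1,2)]
  let ?T = "tgt G" and ?\<theta> = "\<lambda>a\<in>Obj (src K). \<theta> (fobj K a)"
  show ?thesis
    unfolding monoidal_transformation_def lax_comp_simps(1,2)
  proof (intro conjI ballI)
    fix a assume a: "a \<in> Obj (src K)"
    then show "?\<theta> a \<in> homset ?T (fobj (lax_comp G K) a) (fobj (lax_comp H K) a)"
      by (simp add: homset_def t)
    fix b assume b: "b \<in> Obj (src K)"
    { fix f assume "f \<in> homset (src K) a b"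
      then have f: "f \<in> Arr (src K)" "Dom (src K) f = a" "Cod (src K) f = b"
        by (auto simp: homset_def)
      then have "farr K f \<in> homset (src G) (fobj K a) (fobj K b)"
        by (auto simp: homset_def)
      then show "?\<theta> b \<cdot>\<^bsub>?T\<^esub> farr (lax_comp G K) f = farr (lax_comp H K) f \<cdot>\<^bsub>?T\<^esub> ?\<theta> a"
        using a b f by (simp add: t(7)[of "fobj K a" "fobj K b"]) }
    let ?ab = "a \<odot>\<^bsub>src K\<^esub> b" and ?x = "fobj K a" and ?y = "fobj K b"
    \<comment> \<open>The coherence arrow of \<open>K\<close> is itself an arrow of
      \<open>src G\<close>, so \<open>\<theta>\<close> is natural at it.\<close>
    have hom: "lmul K (a, b) \<in> homset (src G) (?x \<odot>\<^bsub>src G\<^esub> ?y) (fobj K ?ab)"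
      using a b by (simp add: homset_def)
    have "\<theta> (fobj K ?ab) \<cdot>\<^bsub>?T\<^esub> (farr G (lmul K (a, b)) \<cdot>\<^bsub>?T\<^esub> lmul G (?x, ?y))
        = (\<theta> (fobj K ?ab) \<cdot>\<^bsub>?T\<^esub> farr G (lmul K (a, b))) \<cdot>\<^bsub>?T\<^esub> lmul G (?x, ?y)"
      using a b by (simp add: KG.G.B.assoc_cmp t(3-6))
    also have "\<dots> = farr H (lmul K (a, b)) \<cdot>\<^bsub>?T\<^esub> (\<theta> (?x \<odot>\<^bsub>src G\<^esub> ?y) \<cdot>\<^bsub>?T\<^esub> lmul G (?x, ?y))"
      using a b by (subst t(7)[OF _ _ hom]) (simp_all add: KG.G.B.assoc_cmp t(3-6) H_simps)
    also have "\<dots> = (farr H (lmul K (a, b)) \<cdot>\<^bsub>?T\<^esub> lmul H (?x, ?y)) \<cdot>\<^bsub>?T\<^esub> (\<theta> ?x \<boxtimes>\<^bsub>?T\<^esub> \<theta> ?y)"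
      using a b by (simp add: KG.G.B.assoc_cmp t(3-6,8) H_simps)
    finally show "?\<theta> ?ab \<cdot>\<^bsub>?T\<^esub> lmul (lax_comp G K) (a, b) = lmul (lax_comp H K) (a, b) \<cdot>\<^bsub>?T\<^esub> (?\<theta> a \<boxtimes>\<^bsub>?T\<^esub> ?\<theta> b)"
      using a b by (simp add: t(1,2))
  next
    have hom: "lone K \<in> homset (src G) (tunit (src G)) (fobj K (tunit (src K)))"
      by (simp add: homset_def)
    have "\<theta> (fobj K (tunit (src K))) \<cdot>\<^bsub>?T\<^esub> (farr G (lone K) \<cdot>\<^bsub>?T\<^esub> lone G)
        = (\<theta> (fobj K (tunit (src K))) \<cdot>\<^bsub>?T\<^esub> farr G (lone K)) \<cdot>\<^bsub>?T\<^esub> lone G"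
      by (simp add: KG.G.B.assoc_cmp t(3-6))
    also have "\<dots> = farr H (lone K) \<cdot>\<^bsub>?T\<^esub> lone H"
      by (subst t(7)[OF _ _ hom]) (simp_all add: KG.G.B.assoc_cmp t(3-6,9) H_simps)
    finally show "?\<theta> (tunit (src K)) \<cdot>\<^bsub>?T\<^esub> lone (lax_comp G K) = lone (lax_comp H K)"
      by (simp add: t(1,2))
  qed (simp_all add: t(1,2))
qed

section \<open>The category of indexed categories\<close>

locale two_universes =
  V: grothendieck_universe elV + U: grothendieck_universe elU
  for elV :: "'v \<Rightarrow> 'v set" and elU :: "'u \<Rightarrow> 'u set"
begin

sublocale MV: tensor_category "MonCat elV" by (rule V.MonCat_tensor_category)

abbreviation "\<M> \<equiv> MonSiMonCat elV elU"

lemma MonSi_Obj: "(C, N) \<in> Obj \<M> \<longleftrightarrow> C \<in> Obj (MonCat elU) \<and>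
    lax_monoidal_functor N \<and> src N = op_moncat C \<and> tgt N = MonCat elV"
  by (simp add: MonSiMonCat_def Let_def)

lemma MonSi_fst: "X \<in> Obj \<M> \<Longrightarrow> fst X \<in> Obj (MonCat elU)"
  by (cases X) (simp add: MonSi_Obj)

lemma MonSi_Arr: "(X, (F, \<gamma>), Y) \<in> Arr \<M> \<longleftrightarrow> X \<in> Obj \<M> \<and> Y \<in> Obj \<M> \<and>
    lax_monoidal_functor F \<and> src F = op_moncat (fst X) \<and> tgt F = op_moncat (fst Y) \<and>
    monoidal_transformation (snd X) (lax_comp (snd Y) F) \<gamma>"
  by (auto simp: MonSiMonCat_def Let_def)

lemma MonSi_simps [simp]:
  "Dom \<M> (X, \<phi>, Y) = X" "Cod \<M> (X, \<phi>, Y) = Y"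
  "ident \<M> (C, N) = ((C, N), (lax_id (op_moncat C), \<lambda>a\<in>Obj C. lax_id (fobj N a)), (C, N))"
  "(X', (F', \<gamma>'), Y') \<cdot>\<^bsub>\<M>\<^esub> (X, (F, \<gamma>), Y) =
    (X, (lax_comp F' F, \<lambda>a\<in>Obj (src F). lax_comp (\<gamma>' (fobj F a)) (\<gamma> a)), Y')"
  by (simp_all add: MonSiMonCat_def Let_def)

lemma MonSi_homset: "(X, (F, \<gamma>), Y) \<in> homset \<M> X' Y' \<longleftrightarrow> X = X' \<and> Y = Y' \<and> X \<in> Obj \<M> \<and> Y \<in> Obj \<M> \<and>
    lax_monoidal_functor F \<and> src F = op_moncat (fst X) \<and> tgt F = op_moncat (fst Y) \<and>
    monoidal_transformation (snd X) (lax_comp (snd Y) F) \<gamma>"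
  by (auto simp: homset_def MonSi_Arr)

lemma MonSi_homsetE:
  assumes "\<phi> \<in> homset \<M> X Y"
  obtains F \<gamma> where "\<phi> = (X, (F, \<gamma>), Y)"
  using assms by (cases \<phi>) (auto simp: homset_def)

lemma op_tensor: "C \<in> Obj (MonCat elU) \<Longrightarrow> tensor_category (op_moncat C)"
  by (simp add: op_tensor_category U.MonCat_monoidal)

lemma MonSi_composable:
  assumes "(X, (F, \<gamma>), (D, M)) \<in> homset \<M> X (D, M)"
  shows "composable_lax_functors F M"
  using assms by (cases X) (simp add: composable_lax_functors_def composable_lax_functors_axioms_def
      MonSi_homset MonSi_Obj op_tensor V.MonCat_tensor_category)

text \<open>The second component of the composite is \<open>\<delta>\<close> whiskered with
  \<open>F\<close>, composed vertically with \<open>\<gamma>\<close>.\<close>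

lemma MonSi_cmp_hom:
  assumes f: "(X, (F, \<gamma>), Y) \<in> homset \<M> X Y" and g: "(Y, (G, \<delta>), Z) \<in> homset \<M> Y Z"
  shows "(Y, (G, \<delta>), Z) \<cdot>\<^bsub>\<M>\<^esub> (X, (F, \<gamma>), Y) \<in> homset \<M> X Z"
proof -
  obtain C N D M E P where XYZ [simp]: "X = (C, N)" "Y = (D, M)" "Z = (E, P)"
    by (metis surj_pair)
  interpret FM: composable_lax_functors F M
    using f by (simp add: MonSi_composable)
  interpret GP: composable_lax_functors G P
    using g by (simp add: MonSi_composable)
  have srcs: "src F = op_moncat C" "src G = op_moncat D" "src N = op_moncat C" "src P = op_moncat E"
    "tgt P = MonCat elV" "tgt M = MonCat elV" "tgt F = op_moncat D" "tgt G = op_moncat E"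
    "tgt N = MonCat elV" "src M = op_moncat D" and N: "lax_monoidal_functor N"
    and C: "C \<in> Obj (MonCat elU)" "D \<in> Obj (MonCat elU)" "E \<in> Obj (MonCat elU)"
    using f g by (simp_all add: MonSi_homset MonSi_Obj)
  interpret FG: composable_lax_functors F G
    using FM.F.lax_monoidal_functor_axioms GP.F.lax_monoidal_functor_axioms srcs C
    by (simp add: composable_lax_functors_def composable_lax_functors_axioms_def op_tensor)
  interpret F_GP: composable_lax_functors F "lax_comp P G"
    using FM.F.lax_monoidal_functor_axioms GP.lax_comp_lax srcs C
    by (simp add: composable_lax_functors_def composable_lax_functors_axioms_def op_tensor
        V.MonCat_tensor_category)
  have whisker: "monoidal_transformation (lax_comp M F) (lax_comp (lax_comp P G) F)
      (\<lambda>a\<in>Obj (src F). \<delta> (fobj F a))"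
    by (rule whiskered_transformation)
      (use f g srcs C in \<open>auto simp: MonSi_homset MonSi_Obj op_tensor V.MonCat_tensor_category GP.lax_comp_lax\<close>)
  have trans: "monoidal_transformation N (lax_comp (lax_comp P G) F)
      (\<lambda>a\<in>Obj (src N). (\<lambda>a\<in>Obj (src F). \<delta> (fobj F a)) a \<cdot>\<^bsub>tgt N\<^esub> \<gamma> a)"
    using f by (intro vertical_composite[OF N FM.lax_comp_lax F_GP.lax_comp_lax _ _ _ whisker])
      (simp_all add: srcs C MonSi_homset op_tensor V.MonCat_tensor_category)
  have 1: "(\<lambda>a\<in>Obj (src N). (\<lambda>a\<in>Obj (src F). \<delta> (fobj F a)) a \<cdot>\<^bsub>tgt N\<^esub> \<gamma> a)
      = (\<lambda>a\<in>Obj C. lax_comp (\<delta> (fobj F a)) (\<gamma> a))"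
    by (auto simp: srcs)
  \<comment> \<open>Whiskering ends in \<open>(P G) F\<close>, whereas an arrow of the slice has to
    end in \<open>P (G F)\<close>. Composition is strictly associative, so no further coherence
    arrow intervenes.\<close>
  have 2: "lax_comp (lax_comp P G) F = lax_comp P (lax_comp G F)"
    by (rule lax_comp_assoc)
      (use f g srcs C in \<open>auto simp: MonSi_homset MonSi_Obj op_tensor V.MonCat_tensor_category\<close>)
  show ?thesis
    using f g trans[unfolded 1 2] by (simp add: MonSi_homset srcs FG.lax_comp_lax)
qed

text \<open>This types the components, so that the laws of the slice category reduce to those of
  \<open>MonCat elV\<close> at each object of the base.\<close>

lemma MonSi_component:
  assumes "(X, (F, \<gamma>), Y) \<in> homset \<M> X Y" "a \<in> Obj (fst X)"
  shows "\<gamma> a \<in> homset (MonCat elV) (fobj (snd X) a) (fobj (snd Y) (fobj F a))" "fobj F a \<in> Obj (fst Y)"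
proof -
  obtain C N D M where [simp]: "X = (C, N)" "Y = (D, M)"
    by (metis surj_pair)
  interpret FM: composable_lax_functors F M
    using assms by (simp add: MonSi_composable)
  show "\<gamma> a \<in> homset (MonCat elV) (fobj (snd X) a) (fobj (snd Y) (fobj F a))"
  proof -
    have "monoidal_transformation N (lax_comp M F) \<gamma>" and srcs: "tgt N = MonCat elV"
      "src F = op_moncat C" "src N = op_moncat C"
      using assms by (simp_all add: MonSi_homset MonSi_Obj)
    note * = monoidal_transformationD(4-6)[OF this(1)]
    show ?thesis
      using *[of a] assms(2) by (simp add: homset_def srcs)
  qed
  show "fobj F a \<in> Obj (fst Y)"
    using assms FM.F.fobj_obj[of a] by (simp add: MonSi_homset)
qed

lemma MonSi_category: "category \<M>"
proof
  fix X :: "('u, 'v) indexed" assume X: "X \<in> Obj \<M>"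
  obtain C N where XCN: "X = (C, N)"
    by (metis surj_pair)
  then have N: "lax_monoidal_functor N" "src N = op_moncat C" "tgt N = MonCat elV"
    and C: "C \<in> Obj (MonCat elU)"
    using X by (simp_all add: MonSi_Obj)
  have "lax_comp N (lax_id (op_moncat C)) = N"
    using lax_comp_ident(2)[OF N(1)] N C by (simp add: op_tensor V.MonCat_tensor_category)
  moreover have "monoidal_transformation N N (\<lambda>a\<in>Obj C. lax_id (fobj N a))"
    using identity_transformation[OF N(1)] N C by (simp add: op_tensor V.MonCat_tensor_category)
  ultimately show "ident \<M> X \<in> homset \<M> X X"
    using X C by (simp add: XCN MonSi_homset lax_id_lax op_tensor)
next
  fix \<phi> X Y assume \<phi>: "\<phi> \<in> homset \<M> X Y"
  obtain C N D M where XY: "X = (C, N)" "Y = (D, M)"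
    by (metis surj_pair)
  obtain F \<gamma> where F: "\<phi> = (X, (F, \<gamma>), Y)"
    using \<phi> by (rule MonSi_homsetE)
  note comp = MonSi_component[OF \<phi>[unfolded F], unfolded XY fst_conv snd_conv]
  have lax: "lax_monoidal_functor F" "src F = op_moncat C" "tgt F = op_moncat D" "C \<in> Obj (MonCat elU)"
    "D \<in> Obj (MonCat elU)" "monoidal_transformation N (lax_comp M F) \<gamma>" "src N = op_moncat C"
    using \<phi> by (simp_all add: F XY MonSi_homset MonSi_Obj)
  have "\<gamma> \<in> extensional (Obj C)"
    using monoidal_transformationD(3)[OF lax(6)] by (simp add: lax)
  moreover have "lax_comp (lax_id (fobj M (fobj F a))) (\<gamma> a) = \<gamma> a" "lax_comp (\<gamma> a) (lax_id (fobj N a)) = \<gamma> a"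
    if "a \<in> Obj C" for a
    using MV.ident_left[OF comp(1)[OF that]] MV.ident_right[OF comp(1)[OF that]] by simp_all
  \<comment> \<open>Composites are restricted functions; \<open>\<gamma>\<close> equals them as a
    function, and not only on \<open>Obj C\<close>, because it is extensional.\<close>
  ultimately have "(\<lambda>a\<in>Obj C. lax_comp ((\<lambda>a\<in>Obj D. lax_id (fobj M a)) (fobj F a)) (\<gamma> a)) = \<gamma>"
    "(\<lambda>a\<in>Obj C. lax_comp (\<gamma> (fobj (lax_id (op_moncat C)) a)) (lax_id (fobj N a))) = \<gamma>"
    using comp(2) by (auto simp: restrict_def extensional_def fun_eq_iff)
  then show "ident \<M> Y \<cdot>\<^bsub>\<M>\<^esub> \<phi> = \<phi>" "\<phi> \<cdot>\<^bsub>\<M>\<^esub> ident \<M> X = \<phi>"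
    using lax_comp_ident[OF lax(1)] lax(2-5) by (simp_all add: F XY op_tensor cong: restrict_cong)
next
  fix \<phi> \<psi> X Y Z assume "\<phi> \<in> homset \<M> X Y" "\<psi> \<in> homset \<M> Y Z"
  then show "\<psi> \<cdot>\<^bsub>\<M>\<^esub> \<phi> \<in> homset \<M> X Z"
    by (metis MonSi_homsetE MonSi_cmp_hom)
next
  fix \<phi> \<psi> \<xi> X Y Z W assume *: "\<phi> \<in> homset \<M> X Y" "\<psi> \<in> homset \<M> Y Z" "\<xi> \<in> homset \<M> Z W"
  obtain F \<gamma> G \<delta> H \<epsilon> where a: "\<phi> = (X, (F, \<gamma>), Y)" "\<psi> = (Y, (G, \<delta>), Z)" "\<xi> = (Z, (H, \<epsilon>), W)"
    using * by (metis MonSi_homsetE)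
  have "lax_comp (lax_comp H G) F = lax_comp H (lax_comp G F)"
    using * by (intro lax_comp_assoc) (auto simp: a MonSi_homset MonSi_fst intro!: op_tensor)
  moreover have "lax_comp (lax_comp (\<epsilon> (fobj G (fobj F a))) (\<delta> (fobj F a))) (\<gamma> a)
      = lax_comp (\<epsilon> (fobj G (fobj F a))) (lax_comp (\<delta> (fobj F a)) (\<gamma> a))" if "a \<in> Obj (src F)" for a
  proof -
    have 1: "a \<in> Obj (fst X)"
      using that * by (simp add: a MonSi_homset)
    note 2 = MonSi_component[OF *(1)[unfolded a] 1]
    note 3 = MonSi_component[OF *(2)[unfolded a] 2(2)]
    note 4 = MonSi_component[OF *(3)[unfolded a] 3(2)]
    show ?thesis
      using MV.cmp_assoc[OF 2(1) 3(1) 4(1)] by simp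
  qed
  moreover have "fobj F a \<in> Obj (src G)" if "a \<in> Obj (src F)" for a
    using MonSi_component(2)[OF *(1)[unfolded a]] that * by (simp add: a MonSi_homset)
  ultimately show "(\<xi> \<cdot>\<^bsub>\<M>\<^esub> \<psi>) \<cdot>\<^bsub>\<M>\<^esub> \<phi> = \<xi> \<cdot>\<^bsub>\<M>\<^esub> (\<psi> \<cdot>\<^bsub>\<M>\<^esub> \<phi>)"
    by (simp add: a cong: restrict_cong)
qed (auto simp: MonSiMonCat_def Let_def)

end

section \<open>Ordered commutative monoids as monoidal categories\<close>

context ord_comm_monoid
begin

lemma geq_carrier: "(x, y) \<in> geq W \<Longrightarrow> x \<in> carrier W" "(x, y) \<in> geq W \<Longrightarrow> y \<in> carrier W"
  and geq_refl: "x \<in> carrier W \<Longrightarrow> (x, x) \<in> geq W"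
  and geq_trans: "(x, y) \<in> geq W \<Longrightarrow> (y, z) \<in> geq W \<Longrightarrow> (x, z) \<in> geq W"
  and geq_antisym: "(x, y) \<in> geq W \<Longrightarrow> (y, x) \<in> geq W \<Longrightarrow> x = y"
  using geq_order
  by (auto simp: partial_order_on_def preorder_on_def refl_on_def dest: transD antisymD)

end

lemma ord_homD:
  assumes "t \<in> ord_hom W W'"
  shows "x \<in> carrier W \<Longrightarrow> t x \<in> carrier W'"
    and "x \<in> carrier W \<Longrightarrow> y \<in> carrier W \<Longrightarrow> t (x \<otimes>\<^bsub>W\<^esub> y) = t x \<otimes>\<^bsub>W'\<^esub> t y"
    and "t \<one>\<^bsub>W\<^esub> = \<one>\<^bsub>W'\<^esub>" and "(x, y) \<in> geq W \<Longrightarrow> (t x, t y) \<in> geq W'"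
    and "t \<in> extensional (carrier W)"
  using assms by (auto simp: ord_hom_def hom_def)

context grothendieck_universe
begin

section \<open>The category of ordered commutative monoids\<close>

lemma OrdCMon_Obj: "W \<in> Obj (OrdCMon el) \<longleftrightarrow> ord_comm_monoid W \<and> small el (carrier W)"
  by (simp add: OrdCMon_def Let_def)

lemma OrdCMon_homset:
  "(W, t, W') \<in> homset (OrdCMon el) V V' \<longleftrightarrow>
    W = V \<and> W' = V' \<and> V \<in> Obj (OrdCMon el) \<and> V' \<in> Obj (OrdCMon el) \<and> t \<in> ord_hom V V'"
  by (auto simp: homset_def OrdCMon_def Let_def)

lemma OrdCMon_homsetE:
  assumes "f \<in> homset (OrdCMon el) W W'"
  obtains t where "f = (W, t, W')" "W \<in> Obj (OrdCMon el)" "W' \<in> Obj (OrdCMon el)" "t \<in> ord_hom W W'"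
  using assms by (auto simp: homset_def OrdCMon_def Let_def)

lemma OrdCMon_simps [simp]:
  "ident (OrdCMon el) W = (W, \<lambda>x\<in>carrier W. x, W)"
  "(V', s, W'') \<cdot>\<^bsub>OrdCMon el\<^esub> (W, t, V) = (W, \<lambda>x\<in>carrier W. s (t x), W'')"
  by (simp_all add: OrdCMon_def Let_def)

lemma OrdCMon_category: "category (OrdCMon el)"
proof
  fix W assume W: "W \<in> Obj (OrdCMon el)"
  then interpret ord_comm_monoid W
    by (simp add: OrdCMon_Obj)
  show "ident (OrdCMon el) W \<in> homset (OrdCMon el) W W"
    using W by (auto simp: OrdCMon_homset ord_hom_def hom_def geq_carrier)
next
  fix f g W W' W'' assume "f \<in> homset (OrdCMon el) W W'" "g \<in> homset (OrdCMon el) W' W''"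
  then obtain s t where f: "f = (W, s, W')" "s \<in> ord_hom W W'" and g: "g = (W', t, W'')" "t \<in> ord_hom W' W''"
    and Ob: "W \<in> Obj (OrdCMon el)" "W' \<in> Obj (OrdCMon el)" "W'' \<in> Obj (OrdCMon el)"
    by (auto elim!: OrdCMon_homsetE)
  interpret ord_comm_monoid W
    using Ob by (simp add: OrdCMon_Obj)
  note s = ord_homD[OF f(2)] and t = ord_homD[OF g(2)]
  show "g \<cdot>\<^bsub>OrdCMon el\<^esub> f \<in> homset (OrdCMon el) W W''"
    using Ob s t by (auto simp: f g OrdCMon_homset ord_hom_def hom_def geq_carrier)
next
  fix f W W' assume "f \<in> homset (OrdCMon el) W W'"
  then obtain t where f: "f = (W, t, W')" and "t \<in> ord_hom W W'"
    by (auto elim: OrdCMon_homsetE)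
  note t = ord_homD[OF this(2)]
  have "(\<lambda>x\<in>carrier W. (\<lambda>x\<in>carrier W'. x) (t x)) = t" "(\<lambda>x\<in>carrier W. t ((\<lambda>x\<in>carrier W. x) x)) = t"
    using t(1,5) by (auto simp: extensional_def fun_eq_iff restrict_def)
  then show "ident (OrdCMon el) W' \<cdot>\<^bsub>OrdCMon el\<^esub> f = f" "f \<cdot>\<^bsub>OrdCMon el\<^esub> ident (OrdCMon el) W = f"
    by (simp_all add: f)
next
  fix f g h W1 W2 W3 W4
  assume "f \<in> homset (OrdCMon el) W1 W2" "g \<in> homset (OrdCMon el) W2 W3" "h \<in> homset (OrdCMon el) W3 W4"
  then show "(h \<cdot>\<^bsub>OrdCMon el\<^esub> g) \<cdot>\<^bsub>OrdCMon el\<^esub> f = h \<cdot>\<^bsub>OrdCMon el\<^esub> (g \<cdot>\<^bsub>OrdCMon el\<^esub> f)"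
    by (auto elim!: OrdCMon_homsetE simp: ord_homD(1) cong: restrict_cong)
qed (auto simp: OrdCMon_def Let_def)

section \<open>Posetal categories and lax functors into them\<close>

lemma posetal_simps [simp]:
  "Obj (posetal el W) = carrier W"
  "upair el a b \<in> Arr (posetal el W) \<longleftrightarrow> (a, b) \<in> geq W"
  "Dom (posetal el W) (upair el a b) = a" "Cod (posetal el W) (upair el a b) = b"
  "ident (posetal el W) a = upair el a a"
  "upair el a b \<cdot>\<^bsub>posetal el W\<^esub> upair el c d = upair el c b"
  "a \<odot>\<^bsub>posetal el W\<^esub> b = a \<otimes>\<^bsub>W\<^esub> b"
  "upair el a b \<boxtimes>\<^bsub>posetal el W\<^esub> upair el c d = upair el (a \<otimes>\<^bsub>W\<^esub> c) (b \<otimes>\<^bsub>W\<^esub> d)"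
  "tunit (posetal el W) = \<one>\<^bsub>W\<^esub>"
  "assoc (posetal el W) a b c = upair el ((a \<otimes>\<^bsub>W\<^esub> b) \<otimes>\<^bsub>W\<^esub> c) (a \<otimes>\<^bsub>W\<^esub> (b \<otimes>\<^bsub>W\<^esub> c))"
  "lunit (posetal el W) a = upair el (\<one>\<^bsub>W\<^esub> \<otimes>\<^bsub>W\<^esub> a) a"
  "runit (posetal el W) a = upair el (a \<otimes>\<^bsub>W\<^esub> \<one>\<^bsub>W\<^esub>) a"
  by (simp_all add: posetal_def)

lemma posetal_Arr: "Arr (posetal el W) = (\<lambda>(a, b). upair el a b) ` geq W"
  by (auto simp: posetal_def)

lemma posetal_ArrE:
  assumes "f \<in> Arr (posetal el W)"
  obtains a b where "f = upair el a b" "(a, b) \<in> geq W"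
  using assms by (auto simp: posetal_def)

lemma posetal_homset: "f \<in> homset (posetal el W) a b \<longleftrightarrow> f = upair el a b \<and> (a, b) \<in> geq W"
  by (auto simp: homset_def elim: posetal_ArrE)

text \<open>An arrow is the pair of its ends, so every law is a comparison of ends and the existence
  of an arrow is an inequality.\<close>

lemma posetal_monoidal_category:
  assumes "ord_comm_monoid W"
  shows "monoidal_category (posetal el W)"
proof -
  interpret ord_comm_monoid W by fact
  \<comment> \<open>By the monoid laws the ends of the associator and of the unitors coincide, so
    invertibility of identities is enough.\<close>
  have iso: "is_iso (posetal el W) (upair el a a)" if "a \<in> carrier W" for a
    using that by (auto simp: is_iso_def inverse_arrows_def posetal_homset geq_refl)
  show ?thesis
    by unfold_locales
      (auto simp: posetal_homset geq_carrier geq_refl m_assoc iso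
        intro: geq_trans geq_mult elim!: posetal_ArrE)
qed

lemma posetal_in_MonCat:
  assumes "W \<in> Obj (OrdCMon el)"
  shows "posetal el W \<in> Obj (MonCat el)"
proof -
  interpret ord_comm_monoid W
    using assms by (simp add: OrdCMon_Obj)
  have "Arr (posetal el W) \<subseteq> {upair el a b | a b. a \<in> carrier W \<and> b \<in> carrier W}"
    by (auto elim!: posetal_ArrE dest: geq_carrier)
  with assms show ?thesis
    by (auto simp: MonCat_Obj OrdCMon_Obj posetal_monoidal_category intro: small_subset small_upairs)
qed

lemma lax_into_posetal_eqI:
  assumes F: "lax_monoidal_functor F" and G: "lax_monoidal_functor G"
    and "src F = src G" and W: "tgt F = posetal el W" "tgt G = posetal el W"
    and obj: "\<And>a. a \<in> Obj (src F) \<Longrightarrow> fobj F a = fobj G a" and A: "tensor_category (src F)"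
  shows "F = G"
proof -
  interpret F: lax_monoidal_functor F by fact
  interpret G: lax_monoidal_functor G by fact
  interpret A: tensor_category "src F" by fact
  have eq: "f = g" if "f \<in> Arr (posetal el W)" "g \<in> Arr (posetal el W)"
    "Dom (posetal el W) f = Dom (posetal el W) g" "Cod (posetal el W) f = Cod (posetal el W) g" for f g
    using that by (auto elim!: posetal_ArrE)
  note F' = F.farr_arr[unfolded W] F.dom_farr[unfolded W] F.cod_farr[unfolded W]
    F.lmul_arr[unfolded W] F.lone_arr[unfolded W]
  note G' = G.farr_arr[unfolded W] G.dom_farr[unfolded W] G.cod_farr[unfolded W]
    G.lmul_arr[unfolded W] G.lone_arr[unfolded W]
  show ?thesis
  proof (rule lax_functor_eqI[OF F G])
    show "farr F f = farr G f" if "f \<in> Arr (src F)" for f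
      by (rule eq) (use that in \<open>simp_all add: F' G' assms(3)[symmetric] obj\<close>)
    show "lmul F (a, b) = lmul G (a, b)" if "a \<in> Obj (src F)" "b \<in> Obj (src F)" for a b
      by (rule eq) (use that in \<open>simp_all add: F' G' assms(3)[symmetric] obj\<close>)
    show "lone F = lone G"
      by (rule eq) (simp_all add: F' G' assms(3)[symmetric] obj)
  qed (use assms in simp_all)
qed

text \<open>Membership in a hom set of \<open>posetal el W\<close> is an inequality, so each typing
  law of a lax functor yields one.\<close>

lemma lax_into_posetalD:
  assumes F: "lax_monoidal_functor F" and W: "tgt F = posetal el W"
  shows "a \<in> Obj (src F) \<Longrightarrow> fobj F a \<in> carrier W"
    and "f \<in> Arr (src F) \<Longrightarrow> (fobj F (Dom (src F) f), fobj F (Cod (src F) f)) \<in> geq W"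
    and "a \<in> Obj (src F) \<Longrightarrow> b \<in> Obj (src F) \<Longrightarrow>
      (fobj F a \<otimes>\<^bsub>W\<^esub> fobj F b, fobj F (a \<odot>\<^bsub>src F\<^esub> b)) \<in> geq W"
    and "(\<one>\<^bsub>W\<^esub>, fobj F (tunit (src F))) \<in> geq W"
proof -
  interpret F: lax_monoidal_functor F by fact
  show "a \<in> Obj (src F) \<Longrightarrow> fobj F a \<in> carrier W"
    using F.fobj_obj[of a] by (simp add: W)
  show "f \<in> Arr (src F) \<Longrightarrow> (fobj F (Dom (src F) f), fobj F (Cod (src F) f)) \<in> geq W"
    using F.farr_hom[of f "Dom (src F) f" "Cod (src F) f"]
    by (simp only: W posetal_homset) (simp add: homset_def)
  show "a \<in> Obj (src F) \<Longrightarrow> b \<in> Obj (src F) \<Longrightarrow>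
      (fobj F a \<otimes>\<^bsub>W\<^esub> fobj F b, fobj F (a \<odot>\<^bsub>src F\<^esub> b)) \<in> geq W"
    using F.lmul_hom[of a b] by (simp add: W posetal_homset)
  show "(\<one>\<^bsub>W\<^esub>, fobj F (tunit (src F))) \<in> geq W"
    using F.lone_hom by (simp add: W posetal_homset)
qed

text \<open>By \<open>lax_into_posetal_eq\<close> this recovers a lax functor from its object
  map.\<close>

definition lax_to_posetal :: "('u, 'u) moncat \<Rightarrow> 'u ordmon \<Rightarrow> ('u \<Rightarrow> 'u) \<Rightarrow> ('u, 'u, 'u, 'u) laxfun"
  where "lax_to_posetal S W t = \<lparr>
    fobj = restrict t (Obj S), farr = (\<lambda>f\<in>Arr S. upair el (t (Dom S f)) (t (Cod S f))),
    src = S, tgt = posetal el W,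
    lmul = (\<lambda>(a, b)\<in>Obj S \<times> Obj S. upair el (t a \<otimes>\<^bsub>W\<^esub> t b) (t (a \<odot>\<^bsub>S\<^esub> b))),
    lone = upair el \<one>\<^bsub>W\<^esub> (t (tunit S))\<rparr>"

lemma lax_to_posetal_simps [simp]:
  "src (lax_to_posetal S W t) = S" "tgt (lax_to_posetal S W t) = posetal el W"
  "a \<in> Obj S \<Longrightarrow> fobj (lax_to_posetal S W t) a = t a"
  by (simp_all add: lax_to_posetal_def)

text \<open>These inequalities say that the arrows named in \<open>lax_to_posetal S W t\<close>
  exist. Arrows point downwards, so \<open>t\<close> is submultiplicative: the product of two values
  lies above the value at the tensor product.\<close>

definition lax_map :: "('u, 'u) moncat \<Rightarrow> 'u ordmon \<Rightarrow> ('u \<Rightarrow> 'u) \<Rightarrow> bool"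
  where "lax_map S W t \<longleftrightarrow>
    (\<forall>a\<in>Obj S. t a \<in> carrier W) \<and> (\<forall>f\<in>Arr S. (t (Dom S f), t (Cod S f)) \<in> geq W) \<and>
    (\<forall>a\<in>Obj S. \<forall>b\<in>Obj S. (t a \<otimes>\<^bsub>W\<^esub> t b, t (a \<odot>\<^bsub>S\<^esub> b)) \<in> geq W) \<and>
    (\<one>\<^bsub>W\<^esub>, t (tunit S)) \<in> geq W"

lemma lax_to_posetal_lax:
  assumes "monoidal_category S" "ord_comm_monoid W" and t: "lax_map S W t"
  shows "lax_monoidal_functor (lax_to_posetal S W t)"
proof -
  interpret S: monoidal_category S by fact
  interpret W: ord_comm_monoid W by fact
  interpret P: monoidal_category "posetal el W"
    using assms(2) by (rule posetal_monoidal_category)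
  let ?F = "lax_to_posetal S W t"
  have F: "farr ?F f = upair el (t (Dom S f)) (t (Cod S f))" if "f \<in> Arr S" for f
    using that by (simp add: lax_to_posetal_def)
  have mul: "lmul ?F (a, b) = upair el (t a \<otimes>\<^bsub>W\<^esub> t b) (t (a \<odot>\<^bsub>S\<^esub> b))" if "a \<in> Obj S" "b \<in> Obj S" for a b
    using that by (simp add: lax_to_posetal_def)
  have one: "lone ?F = upair el \<one>\<^bsub>W\<^esub> (t (tunit S))"
    by (simp add: lax_to_posetal_def)
  note simps = F mul one
  have t: "a \<in> Obj S \<Longrightarrow> t a \<in> carrier W" "f \<in> Arr S \<Longrightarrow> (t (Dom S f), t (Cod S f)) \<in> geq W"
    "a \<in> Obj S \<Longrightarrow> b \<in> Obj S \<Longrightarrow> (t a \<otimes>\<^bsub>W\<^esub> t b, t (a \<odot>\<^bsub>S\<^esub> b)) \<in> geq W"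
    "(\<one>\<^bsub>W\<^esub>, t (tunit S)) \<in> geq W" for a b f
    using t by (auto simp: lax_map_def)
  show ?thesis
  proof (intro lax_monoidal_functor.intro is_functor.intro is_functor_axioms.intro
      lax_monoidal_functor_axioms.intro, unfold lax_to_posetal_simps(1,2))
    show "category S" "category (posetal el W)"
      by unfold_locales
    show "fobj ?F \<in> extensional (Obj S)" "farr ?F \<in> extensional (Arr S)"
      "lmul ?F \<in> extensional (Obj S \<times> Obj S)"
      by (simp_all add: lax_to_posetal_def)
  qed (auto simp: simps posetal_homset homset_def[of S] t)
qed

text \<open>If \<open>t\<close> preserves tensor and unit, the arrow from
  \<open>t a \<otimes> t b\<close> to \<open>t (a \<odot> b)\<close> is an identity. This relates
  the definition of \<open>R\<close> on arrows, which uses \<open>strict_lax\<close>, to the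
  description by object maps.\<close>

lemma strict_lax_to_posetal:
  assumes "lax_map S W t" and "\<And>a b. a \<in> Obj S \<Longrightarrow> b \<in> Obj S \<Longrightarrow> t (a \<odot>\<^bsub>S\<^esub> b) = t a \<otimes>\<^bsub>W\<^esub> t b"
    and "t (tunit S) = \<one>\<^bsub>W\<^esub>" and "\<And>f. f \<in> Arr S \<Longrightarrow> fa f = upair el (t (Dom S f)) (t (Cod S f))"
  shows "strict_lax S (posetal el W) t fa = lax_to_posetal S W t"
  using assms by (auto simp: strict_lax_def lax_to_posetal_def restrict_def fun_eq_iff)

lemma lax_into_posetal_eq:
  assumes "lax_monoidal_functor F" "tgt F = posetal el W" "monoidal_category (src F)" "ord_comm_monoid W"
  shows "lax_map (src F) W (fobj F)" and "lax_to_posetal (src F) W (fobj F) = F"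
proof -
  show "lax_map (src F) W (fobj F)"
    using lax_into_posetalD[OF assms(1,2)] by (simp add: lax_map_def)
  then show "lax_to_posetal (src F) W (fobj F) = F"
    using assms by (intro lax_into_posetal_eqI lax_to_posetal_lax)
      (simp_all add: monoidal_category_tensor)
qed

text \<open>Preservation of tensor products by multiplication is the interchange \<open>(a \<otimes>
  a') \<otimes> (b \<otimes> b') = (a \<otimes> b) \<otimes> (a' \<otimes> b')\<close>. This is
  where commutativity of \<open>W\<close> enters.\<close>

lemma posetal_mult_lax:
  assumes "ord_comm_monoid W"
  defines "P \<equiv> posetal el W"
  shows "lax_monoidal_functor (strict_lax (prod_moncat el P P) P
    (\<lambda>p. ufst el p \<odot>\<^bsub>P\<^esub> usnd el p) (\<lambda>f. ufst el f \<boxtimes>\<^bsub>P\<^esub> usnd el f))"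
proof -
  interpret ord_comm_monoid W by fact
  show ?thesis
    by (rule strict_lax_lax)
      (auto simp: assms(1) posetal_monoidal_category monoidal_category_tensor prod_monoidal_category P_def posetal_homset
        geq_carrier m_ac
        elim!: prod_ObjE prod_ArrE prod_homsetE posetal_ArrE intro!: geq_mult)
qed

lemma posetal_unit_lax:
  assumes "ord_comm_monoid W"
  defines "P \<equiv> posetal el W"
  shows "lax_monoidal_functor (strict_lax (terminal_moncat el) P (\<lambda>_. tunit P) (\<lambda>_. ident P (tunit P)))"
proof -
  interpret ord_comm_monoid W by fact
  show ?thesis
    by (rule strict_lax_lax)
      (auto simp: assms(1) posetal_monoidal_category monoidal_category_tensor terminal_monoidal_category P_def posetal_homset geq_refl)
qed

end

section \<open>Arrows into the image of the functor R\<close>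

context grothendieck_universe
begin

text \<open>Turns an equation between composites in \<open>MonCat el\<close> into equations between
  elements of \<open>W\<close>, once both sides have been typed.\<close>

lemma hom_into_posetal_eqI:
  assumes "F \<in> homset (MonCat el) A (posetal el W)" "G \<in> homset (MonCat el) A (posetal el W)"
    and "\<And>a. a \<in> Obj A \<Longrightarrow> fobj F a = fobj G a"
  shows "F = G"
  by (rule lax_into_posetal_eqI) (use assms in \<open>auto simp: MonCat_homset MonCat_tensor\<close>)

lemma terminal_homset:
  "f \<in> homset (terminal_moncat el) a b \<longleftrightarrow> f = bullet el \<and> a = bullet el \<and> b = bullet el"
  by (auto simp: homset_def)

lemma MonCat_hom_fobj: "F \<in> homset (MonCat el) A B \<Longrightarrow> a \<in> Obj A \<Longrightarrow> fobj F a \<in> Obj B"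
  using is_functor.fobj_obj[of A B F a] by (auto simp: MonCat_homset lax_monoidal_functor_def)

lemma MonCat_hom_src: "F \<in> homset (MonCat el) A B \<Longrightarrow> src F = A"
  by (simp add: MonCat_homset)

lemma lax_to_posetal_hom:
  assumes "S \<in> Obj (MonCat el)" "W \<in> Obj (OrdCMon el)" "lax_map S W t"
  shows "lax_to_posetal S W t \<in> homset (MonCat el) S (posetal el W)"
  using assms by (simp add: MonCat_homset posetal_in_MonCat)
    (simp add: lax_to_posetal_lax MonCat_monoidal OrdCMon_Obj)

lemma hom_into_posetalE:
  assumes "F \<in> homset (MonCat el) S (posetal el W)" "W \<in> Obj (OrdCMon el)"
  shows "lax_map S W (fobj F)" "lax_to_posetal S W (fobj F) = F"
  using assms lax_into_posetal_eq[of F W] by (auto simp: MonCat_homset MonCat_monoidal OrdCMon_Obj)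

text \<open>This and \<open>unit_functor\<close> name the coherence maps of \<open>N_of\<close>, so
  that they can be typed as arrows of \<open>MonCat el\<close>.\<close>

definition mult_functor :: "'u ordmon \<Rightarrow> ('u, 'u, 'u, 'u) laxfun"
  where "mult_functor W = (let P = posetal el W in strict_lax (prod_moncat el P P) P
    (\<lambda>p. ufst el p \<odot>\<^bsub>P\<^esub> usnd el p) (\<lambda>f. ufst el f \<boxtimes>\<^bsub>P\<^esub> usnd el f))"

definition unit_functor :: "'u ordmon \<Rightarrow> ('u, 'u, 'u, 'u) laxfun"
  where "unit_functor W = (let P = posetal el W in
    strict_lax (terminal_moncat el) P (\<lambda>_. tunit P) (\<lambda>_. ident P (tunit P)))"

lemma mult_functor_hom:
  "W \<in> Obj (OrdCMon el) \<Longrightarrow>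
    mult_functor W \<in> homset (MonCat el) (posetal el W \<times>\<^sub>C posetal el W) (posetal el W)"
  by (simp add: mult_functor_def Let_def MonCat_homset posetal_in_MonCat prod_in_MonCat)
    (use posetal_mult_lax[of W] in \<open>simp add: OrdCMon_Obj\<close>)

lemma unit_functor_hom:
  "W \<in> Obj (OrdCMon el) \<Longrightarrow> unit_functor W \<in> homset (MonCat el) (terminal_moncat el) (posetal el W)"
  by (simp add: unit_functor_def Let_def MonCat_homset posetal_in_MonCat terminal_in_MonCat)
    (use posetal_unit_lax[of W] in \<open>simp add: OrdCMon_Obj\<close>)

lemma fobj_mult_functor [simp]:
  "x \<in> carrier W \<Longrightarrow> y \<in> carrier W \<Longrightarrow> fobj (mult_functor W) \<langle>x, y\<rangle> = x \<otimes>\<^bsub>W\<^esub> y"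
  by (simp add: mult_functor_def Let_def)

lemma fobj_unit_functor [simp]: "fobj (unit_functor W) (bullet el) = \<one>\<^bsub>W\<^esub>"
  by (simp add: unit_functor_def Let_def)

end

section \<open>The one-object base and the objects in the image of \<open>R\<close>\<close>

context two_universes
begin

abbreviation pt :: "('u, 'u) moncat" where "pt \<equiv> op_moncat (terminal_moncat elU)"

lemma pt_tensor_category: "tensor_category pt"
  by (simp add: op_tensor_category U.terminal_monoidal_category)

text \<open>The structure arrows of the opposite are defined by \<open>inv_arr\<close>, hence by a
  description. Typing alone determines them, because \<open>pt\<close> has just one arrow.\<close>

lemma pt_coherence [simp]:
  "assoc pt (bullet elU) (bullet elU) (bullet elU) = bullet elU"
  "lunit pt (bullet elU) = bullet elU" "runit pt (bullet elU) = bullet elU"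
  using tensor_category.assoc_arr(1)[OF pt_tensor_category, of "bullet elU" "bullet elU" "bullet elU"]
    tensor_category.lunit_arr(1)[OF pt_tensor_category, of "bullet elU"]
    tensor_category.runit_arr(1)[OF pt_tensor_category, of "bullet elU"]
  by simp_all

definition to_point :: "('u, 'u) moncat \<Rightarrow> ('u, 'u, 'u, 'u) laxfun"
  where "to_point S = strict_lax S pt (\<lambda>_. bullet elU) (\<lambda>_. bullet elU)"

lemma to_point_simps [simp]:
  "src (to_point S) = S" "tgt (to_point S) = pt"
  "a \<in> Obj S \<Longrightarrow> fobj (to_point S) a = bullet elU"
  "f \<in> Arr S \<Longrightarrow> farr (to_point S) f = bullet elU"
  "a \<in> Obj S \<Longrightarrow> b \<in> Obj S \<Longrightarrow> lmul (to_point S) (a, b) = bullet elU"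
  "lone (to_point S) = bullet elU"
  by (simp_all add: to_point_def)

lemma to_point_lax: "tensor_category S \<Longrightarrow> lax_monoidal_functor (to_point S)"
  unfolding to_point_def
  by (rule strict_lax_lax) (auto simp: pt_tensor_category homset_def)

text \<open>Every component takes its values in a one-element set. So the base component of an arrow
  into the image of \<open>R\<close> carries no information.\<close>

lemma lax_to_point:
  assumes F: "lax_monoidal_functor F" and pt: "tgt F = pt" and S: "tensor_category (src F)"
  shows "F = to_point (src F)"
proof -
  interpret F: lax_monoidal_functor F by fact
  show ?thesis
    by (rule lax_functor_eqI[OF F to_point_lax[OF S]])
      (use F.fobj_obj F.farr_arr F.lmul_arr(1) F.lone_arr(1) in \<open>simp_all add: pt\<close>)
qed

lemma N_of_simps [simp]:
  "src (N_of elV elU W) = pt" "tgt (N_of elV elU W) = MonCat elV"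
  "fobj (N_of elV elU W) (bullet elU) = posetal elV W"
  "farr (N_of elV elU W) (bullet elU) = lax_id (posetal elV W)"
  "lmul (N_of elV elU W) (bullet elU, bullet elU) = V.mult_functor W"
  "lone (N_of elV elU W) = V.unit_functor W"
  by (simp_all add: N_of_def Let_def V.mult_functor_def V.unit_functor_def)

text \<open>Each law is an equation between functors into \<open>posetal elV W\<close> and is tested
  on objects, where it becomes associativity or a unit law of \<open>W\<close>. The nested
  \<open>cmp\<close> and \<open>tarr\<close> only type the two sides.\<close>

lemma N_of_lax:
  assumes W: "W \<in> Obj (OrdCMon elV)"
  shows "lax_monoidal_functor (N_of elV elU W)"
proof -
  let ?N = "N_of elV elU W" and ?P = "posetal elV W"
  interpret W: ord_comm_monoid W
    using W by (simp add: V.OrdCMon_Obj)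
  have P: "?P \<in> Obj (MonCat elV)"
    using W by (rule V.posetal_in_MonCat)
  note mult = V.mult_functor_hom[OF W] and unit = V.unit_functor_hom[OF W]
  have id: "lax_id ?P \<in> homset (MonCat elV) ?P ?P"
    using MV.ident_hom[OF P] by simp
  note cmp = MV.cmp_hom[unfolded V.MonCat_simps] and tarr = MV.tarr_hom[unfolded V.MonCat_simps]
    and coh = MV.assoc_hom[OF P P P, unfolded V.MonCat_simps] MV.lunit_hom[OF P, unfolded V.MonCat_simps]
      MV.runit_hom[OF P, unfolded V.MonCat_simps]
  have srcs: "src (V.mult_functor W) = prod_moncat elV ?P ?P" "src (V.unit_functor W) = terminal_moncat elV"
    using mult unit by (simp_all add: V.MonCat_homset)
  have assoc: "lax_comp (lax_id ?P) (lax_comp (V.mult_functor W) (prod_lax elV (V.mult_functor W) (lax_id ?P)))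
    = lax_comp (V.mult_functor W) (lax_comp (prod_lax elV (lax_id ?P) (V.mult_functor W))
        (assoc (MonCat elV) ?P ?P ?P))"
    unfolding V.MonCat_simps
    by (rule V.hom_into_posetal_eqI[OF cmp[OF cmp[OF tarr[OF mult id] mult] id]
          cmp[OF cmp[OF coh(1) tarr[OF id mult]] mult]])
      (auto elim!: V.prod_ObjE simp: srcs W.m_assoc)
  have lunit: "lax_comp (lax_id ?P) (lax_comp (V.mult_functor W) (prod_lax elV (V.unit_functor W) (lax_id ?P)))
      = lunit (MonCat elV) ?P"
    unfolding V.MonCat_simps
    by (rule V.hom_into_posetal_eqI[OF cmp[OF cmp[OF tarr[OF unit id] mult] id] coh(2)])
      (auto elim!: V.prod_ObjE simp: srcs)
  have runit: "lax_comp (lax_id ?P) (lax_comp (V.mult_functor W) (prod_lax elV (lax_id ?P) (V.unit_functor W)))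
      = runit (MonCat elV) ?P"
    unfolding V.MonCat_simps
    by (rule V.hom_into_posetal_eqI[OF cmp[OF cmp[OF tarr[OF id unit] mult] id] coh(3)])
      (auto elim!: V.prod_ObjE simp: srcs)
  have natural: "lax_comp (V.mult_functor W) (prod_lax elV (lax_id ?P) (lax_id ?P))
      = lax_comp (lax_id ?P) (V.mult_functor W)"
    by (rule V.hom_into_posetal_eqI[OF cmp[OF tarr[OF id id] mult] cmp[OF mult id]])
      (auto elim!: V.prod_ObjE simp: srcs)
  have idem: "lax_comp (lax_id ?P) (lax_id ?P) = lax_id ?P"
    using MV.ident_left[OF id] by simp
  show ?thesis
  proof (intro lax_monoidal_functor.intro is_functor.intro is_functor_axioms.intro
      lax_monoidal_functor_axioms.intro, unfold N_of_simps(1,2))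
    show "category pt" "category (MonCat elV)"
      using pt_tensor_category MV.category_axioms by (simp_all add: tensor_category_def)
    show "fobj ?N \<in> extensional (Obj pt)" "farr ?N \<in> extensional (Arr pt)"
      "lmul ?N \<in> extensional (Obj pt \<times> Obj pt)"
      by (simp_all add: N_of_def Let_def)
    fix a b c assume *: "a \<in> Obj pt" "b \<in> Obj pt" "c \<in> Obj pt"
    show "farr ?N (assoc pt a b c) \<cdot>\<^bsub>MonCat elV\<^esub> (lmul ?N (a \<odot>\<^bsub>pt\<^esub> b, c) \<cdot>\<^bsub>MonCat elV\<^esub>
          (lmul ?N (a, b) \<boxtimes>\<^bsub>MonCat elV\<^esub> ident (MonCat elV) (fobj ?N c)))
        = lmul ?N (a, b \<odot>\<^bsub>pt\<^esub> c) \<cdot>\<^bsub>MonCat elV\<^esub> ((ident (MonCat elV) (fobj ?N a) \<boxtimes>\<^bsub>MonCat elV\<^esub> lmul ?N (b, c))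
          \<cdot>\<^bsub>MonCat elV\<^esub> assoc (MonCat elV) (fobj ?N a) (fobj ?N b) (fobj ?N c))"
      using * assoc by simp
  next
    fix a assume "a \<in> Obj pt"
    then show "farr ?N (lunit pt a) \<cdot>\<^bsub>MonCat elV\<^esub> (lmul ?N (tunit pt, a)
          \<cdot>\<^bsub>MonCat elV\<^esub> (lone ?N \<boxtimes>\<^bsub>MonCat elV\<^esub> ident (MonCat elV) (fobj ?N a)))
        = lunit (MonCat elV) (fobj ?N a)"
      "farr ?N (runit pt a) \<cdot>\<^bsub>MonCat elV\<^esub> (lmul ?N (a, tunit pt)
          \<cdot>\<^bsub>MonCat elV\<^esub> (ident (MonCat elV) (fobj ?N a) \<boxtimes>\<^bsub>MonCat elV\<^esub> lone ?N))
        = runit (MonCat elV) (fobj ?N a)"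
      using lunit runit by simp_all
  qed (use P id mult unit natural in \<open>auto simp: U.terminal_homset idem\<close>)
qed

lemma R_obj_in_MonSi: "W \<in> Obj (OrdCMon elV) \<Longrightarrow> R_obj elV elU W \<in> Obj \<M>"
  by (simp add: R_obj_def MonSi_Obj U.terminal_in_MonCat N_of_lax)

text \<open>Indexing is contravariant: for \<open>f\<close> in \<open>C\<close> the functor
  \<open>farr N f\<close> runs from the fibre over \<open>Cod C f\<close> to the one over
  \<open>Dom C f\<close>. The first condition collects inequalities within single fibres; the others
  are naturality and monoidality of the transformation, evaluated at objects.\<close>

definition cocone ::
  "('u, 'v) indexed \<Rightarrow> 'v ordmon \<Rightarrow> ('u \<Rightarrow> 'v \<Rightarrow> 'v) \<Rightarrow> bool"
  where "cocone = (\<lambda>(C, N) W \<delta>.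
    (\<forall>a\<in>Obj C. V.lax_map (fobj N a) W (\<delta> a)) \<and>
    (\<forall>f\<in>Arr C. \<forall>x\<in>Obj (fobj N (Cod C f)).
      \<delta> (Dom C f) (fobj (farr N f) x) = \<delta> (Cod C f) x) \<and>
    (\<forall>a\<in>Obj C. \<forall>b\<in>Obj C. \<forall>x\<in>Obj (fobj N a). \<forall>y\<in>Obj (fobj N b).
      \<delta> (a \<odot>\<^bsub>C\<^esub> b) (fobj (lmul N (a, b)) (upair elV x y)) = \<delta> a x \<otimes>\<^bsub>W\<^esub> \<delta> b y) \<and>
    \<delta> (tunit C) (fobj (lone N) (bullet elV)) = \<one>\<^bsub>W\<^esub>)"

definition cocone_arrow ::
  "('u, 'v) indexed \<Rightarrow> 'v ordmon \<Rightarrow> ('u \<Rightarrow> 'v \<Rightarrow> 'v) \<Rightarrow> ('u, 'v) indexed_arrow"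
  where "cocone_arrow = (\<lambda>(C, N) W \<delta>. ((C, N),
    (to_point (op_moncat C), \<lambda>a\<in>Obj C. V.lax_to_posetal (fobj N a) W (\<delta> a)), R_obj elV elU W))"

end

section \<open>Transformations into the image of \<open>R\<close> as cocones\<close>

locale indexed_category = two_universes elV elU
  for elV :: "'v \<Rightarrow> 'v set" and elU :: "'u \<Rightarrow> 'u set" +
  fixes C N assumes obj: "(C, N) \<in> Obj (MonSiMonCat elV elU)"
begin

sublocale N: lax_monoidal_functor N
  using obj by (simp add: MonSi_Obj)

sublocale C: monoidal_category C
  using obj by (simp add: MonSi_Obj U.MonCat_monoidal)

lemma src_N: "src N = op_moncat C" and tgt_N: "tgt N = MonCat elV"
  and C_in_MonCat: "C \<in> Obj (MonCat elU)"
  using obj by (simp_all add: MonSi_Obj)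

lemma N_obj: "a \<in> Obj C \<Longrightarrow> fobj N a \<in> Obj (MonCat elV)"
  using N.fobj_obj[of a] by (simp add: src_N tgt_N)

lemma N_arr: "f \<in> Arr C \<Longrightarrow> farr N f \<in> homset (MonCat elV) (fobj N (Cod C f)) (fobj N (Dom C f))"
  using N.farr_hom[of f "Cod C f" "Dom C f"] by (simp add: src_N tgt_N) (simp add: homset_def)

lemma N_mul: "a \<in> Obj C \<Longrightarrow> b \<in> Obj C \<Longrightarrow> lmul N (a, b) \<in>
    homset (MonCat elV) (prod_moncat elV (fobj N a) (fobj N b)) (fobj N (a \<odot>\<^bsub>C\<^esub> b))"
  using N.lmul_hom[of a b] by (simp add: src_N tgt_N)

lemma N_one: "lone N \<in> homset (MonCat elV) (terminal_moncat elV) (fobj N (tunit C))"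
  using N.lone_hom by (simp add: src_N tgt_N)

lemma to_point_C: "lax_monoidal_functor (to_point (op_moncat C))"
  by (intro to_point_lax op_tensor C_in_MonCat)

text \<open>Every law of a monoidal transformation is here an equation between functors into
  \<open>posetal elV W\<close>, and by \<open>fobj_eq\<close> such functors are equal iff they agree
  on objects. The conditions of a cocone are these agreements.\<close>

lemma cocone_iff_transformation:
  assumes W: "W \<in> Obj (OrdCMon elV)" and \<delta>: "\<And>a. a \<in> Obj C \<Longrightarrow> V.lax_map (fobj N a) W (\<delta> a)"
  shows "monoidal_transformation N (lax_comp (N_of elV elU W) (to_point (op_moncat C)))
      (\<lambda>a\<in>Obj C. V.lax_to_posetal (fobj N a) W (\<delta> a)) \<longleftrightarrow> cocone (C, N) W \<delta>"
    (is "monoidal_transformation N ?M ?\<gamma> \<longleftrightarrow> _")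
proof -
  let ?P = "posetal elV W"
  have P: "?P \<in> Obj (MonCat elV)"
    using W by (rule V.posetal_in_MonCat)
  have \<gamma>: "V.lax_to_posetal (fobj N a) W (\<delta> a) \<in> homset (MonCat elV) (fobj N a) ?P" if "a \<in> Obj C" for a
    using that W \<delta> N_obj by (simp add: V.lax_to_posetal_hom)
  have carrier: "\<delta> a x \<in> carrier W" if "a \<in> Obj C" "x \<in> Obj (fobj N a)" for a x
    using \<delta>[of a] that by (simp add: V.lax_map_def)
  note cmp = MV.cmp_hom[unfolded V.MonCat_simps] and tarr = MV.tarr_hom[unfolded V.MonCat_simps]
  note mult = V.mult_functor_hom[OF W] and unit = V.unit_functor_hom[OF W]
  have id: "lax_id ?P \<in> homset (MonCat elV) ?P ?P"
    using MV.ident_hom[OF P] by simp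
  have fobj_eq: "F = G \<longleftrightarrow> (\<forall>x\<in>Obj A. fobj F x = fobj G x)"
    if "F \<in> homset (MonCat elV) A ?P" "G \<in> homset (MonCat elV) A ?P" for F G A
    using V.hom_into_posetal_eqI[OF that] by auto
  have natural: "lax_comp (?\<gamma> (Dom C f)) (farr N f) = lax_comp (farr ?M f) (?\<gamma> (Cod C f)) \<longleftrightarrow>
      (\<forall>x\<in>Obj (fobj N (Cod C f)). \<delta> (Dom C f) (fobj (farr N f) x) = \<delta> (Cod C f) x)"
    if f: "f \<in> Arr C" for f
  proof -
    note V.MonCat_hom_fobj[OF N_arr[OF f]] V.MonCat_hom_src[OF N_arr[OF f]]
    then show ?thesis
      using f by (simp add: src_N fobj_eq[OF cmp[OF N_arr \<gamma>] cmp[OF \<gamma> id]] carrier)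
  qed
  have mul: "lax_comp (?\<gamma> (a \<odot>\<^bsub>C\<^esub> b)) (lmul N (a, b)) = lax_comp (lmul ?M (a, b)) (prod_lax elV (?\<gamma> a) (?\<gamma> b)) \<longleftrightarrow>
      (\<forall>x\<in>Obj (fobj N a). \<forall>y\<in>Obj (fobj N b).
        \<delta> (a \<odot>\<^bsub>C\<^esub> b) (fobj (lmul N (a, b)) (upair elV x y)) = \<delta> a x \<otimes>\<^bsub>W\<^esub> \<delta> b y)"
    if ab: "a \<in> Obj C" "b \<in> Obj C" for a b
  proof -
    note N = V.MonCat_hom_fobj[OF N_mul[OF ab]] and src = V.MonCat_hom_src[OF N_mul[OF ab]]
    \<comment> \<open>The coherence map of the composite is \<open>mult_functor W\<close> followed
      by the image of the only arrow of \<open>pt\<close>, which is an identity functor.\<close>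
    have M: "lmul ?M (a, b) = V.mult_functor W"
      using MV.ident_left[OF mult] ab by (simp add: src_N)
    have "lax_comp (?\<gamma> (a \<odot>\<^bsub>C\<^esub> b)) (lmul N (a, b)) = lax_comp (lmul ?M (a, b)) (prod_lax elV (?\<gamma> a) (?\<gamma> b)) \<longleftrightarrow>
      (\<forall>p\<in>Obj (prod_moncat elV (fobj N a) (fobj N b)).
        fobj (lax_comp (?\<gamma> (a \<odot>\<^bsub>C\<^esub> b)) (lmul N (a, b))) p = fobj (lax_comp (V.mult_functor W) (prod_lax elV (?\<gamma> a) (?\<gamma> b))) p)"
      unfolding M using ab by (intro fobj_eq cmp[OF N_mul] cmp[OF tarr mult]) (simp_all add: \<gamma>)
    also have "\<dots> \<longleftrightarrow> (\<forall>x\<in>Obj (fobj N a). \<forall>y\<in>Obj (fobj N b).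
        \<delta> (a \<odot>\<^bsub>C\<^esub> b) (fobj (lmul N (a, b)) (upair elV x y)) = \<delta> a x \<otimes>\<^bsub>W\<^esub> \<delta> b y)"
      using ab N by (force elim!: V.prod_ObjE simp: src carrier)
    finally show ?thesis .
  qed
  have one: "lax_comp (?\<gamma> (tunit C)) (lone N) = lone ?M \<longleftrightarrow>
      \<delta> (tunit C) (fobj (lone N) (bullet elV)) = \<one>\<^bsub>W\<^esub>"
  proof -
    note N = V.MonCat_hom_fobj[OF N_one, of "bullet elV"] V.MonCat_hom_src[OF N_one]
    have M: "lone ?M = V.unit_functor W"
      using MV.ident_left[OF unit] by simp
    have "lax_comp (?\<gamma> (tunit C)) (lone N) = lone ?M \<longleftrightarrow> (\<forall>p\<in>Obj (terminal_moncat elV).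
        fobj (lax_comp (?\<gamma> (tunit C)) (lone N)) p = fobj (V.unit_functor W) p)"
      unfolding M by (intro fobj_eq cmp[OF N_one] unit) (simp_all add: \<gamma>)
    then show ?thesis
      using N by simp
  qed
  \<comment> \<open>Naturality quantifies over two objects of the opposite category and a hom set, a
    cocone over the arrows of \<open>C\<close>.\<close>
  have natural': "(\<forall>a\<in>Obj C. \<forall>b\<in>Obj C. \<forall>f\<in>homset C b a. Q a b f) \<longleftrightarrow> (\<forall>f\<in>Arr C. Q (Cod C f) (Dom C f) f)" for Q
    by (auto simp: homset_def)
  show ?thesis
    unfolding monoidal_transformation_def cocone_def prod.case src_N tgt_N lax_comp_simps(1,2) to_point_simps(1)
      N_of_simps(2) op_moncat_simps homset_op natural' V.MonCat_simps
    using natural mul one \<gamma> by (simp add: \<delta> src_N cong: ball_cong)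
qed

lemma cocone_arrow_hom:
  assumes W: "W \<in> Obj (OrdCMon elV)" and \<delta>: "cocone (C, N) W \<delta>"
  shows "cocone_arrow (C, N) W \<delta> \<in> homset \<M> (C, N) (R_obj elV elU W)"
proof -
  have "\<And>a. a \<in> Obj C \<Longrightarrow> V.lax_map (fobj N a) W (\<delta> a)"
    using \<delta> by (simp add: cocone_def)
  with \<delta> W show ?thesis
    using cocone_iff_transformation[of W \<delta>]
    by (simp add: cocone_arrow_def MonSi_homset obj R_obj_in_MonSi to_point_C)
      (simp add: R_obj_def)
qed

text \<open>The functor \<open>F\<close> is forced by \<open>lax_to_point\<close>, and each
  component \<open>\<gamma> a\<close> is recovered from its object map, so the object maps form the
  cocone.\<close>

lemma hom_into_R_cocone_arrow:
  assumes W: "W \<in> Obj (OrdCMon elV)" and \<phi>: "\<phi> \<in> homset \<M> (C, N) (R_obj elV elU W)"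
  obtains \<delta> where "cocone (C, N) W \<delta>" "\<phi> = cocone_arrow (C, N) W \<delta>"
proof -
  obtain F \<gamma> where F: "\<phi> = ((C, N), (F, \<gamma>), R_obj elV elU W)"
    using \<phi> by (rule MonSi_homsetE)
  have lax: "lax_monoidal_functor F" "src F = op_moncat C" "tgt F = pt"
    and trans: "monoidal_transformation N (lax_comp (N_of elV elU W) F) \<gamma>"
    using \<phi> by (simp_all add: F MonSi_homset R_obj_def)
  have F_eq: "F = to_point (op_moncat C)"
    using lax_to_point[OF lax(1,3)] by (simp add: lax(2) op_tensor C_in_MonCat)
  have \<gamma>: "\<gamma> a \<in> homset (MonCat elV) (fobj N a) (posetal elV W)" if "a \<in> Obj C" for a
    using MonSi_component(1)[OF \<phi>[unfolded F], of a] that by (simp add: F_eq R_obj_def)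
  have \<gamma>_eq: "\<gamma> = (\<lambda>a\<in>Obj C. V.lax_to_posetal (fobj N a) W (fobj (\<gamma> a)))"
    using monoidal_transformationD(3)[OF trans] V.hom_into_posetalE(2)[OF \<gamma> W]
    by (auto simp: src_N fun_eq_iff extensional_def)
  show thesis
  proof (rule that[of "\<lambda>a. fobj (\<gamma> a)"])
    show "cocone (C, N) W (\<lambda>a. fobj (\<gamma> a))"
      using cocone_iff_transformation[OF W, of "\<lambda>a. fobj (\<gamma> a)"] trans V.hom_into_posetalE(1)[OF \<gamma> W]
      by (simp add: F_eq \<gamma>_eq[symmetric])
    show "\<phi> = cocone_arrow (C, N) W (\<lambda>a. fobj (\<gamma> a))"
      using \<gamma>_eq by (simp add: cocone_arrow_def F F_eq)
  qed
qed

text \<open>A cocone is a plain function with arbitrary values outside the fibres. Different cocones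
  can therefore give the same arrow, and only the values on objects of fibres count.\<close>

lemma cocone_arrow_eq_iff:
  assumes W: "W \<in> Obj (OrdCMon elV)" and \<delta>: "cocone (C, N) W \<delta>" and \<delta>': "cocone (C, N) W \<delta>'"
  shows "cocone_arrow (C, N) W \<delta> = cocone_arrow (C, N) W \<delta>' \<longleftrightarrow>
    (\<forall>a\<in>Obj C. \<forall>x\<in>Obj (fobj N a). \<delta> a x = \<delta>' a x)"
proof
  assume eq: "cocone_arrow (C, N) W \<delta> = cocone_arrow (C, N) W \<delta>'"
  show "\<forall>a\<in>Obj C. \<forall>x\<in>Obj (fobj N a). \<delta> a x = \<delta>' a x"
  proof (intro ballI)
    fix a x assume ax: "a \<in> Obj C" "x \<in> Obj (fobj N a)"
    have "V.lax_to_posetal (fobj N a) W (\<delta> a) = V.lax_to_posetal (fobj N a) W (\<delta>' a)"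
      using eq ax by (simp add: cocone_arrow_def fun_eq_iff) (metis restrict_apply')
    then show "\<delta> a x = \<delta>' a x"
      using ax by (metis V.lax_to_posetal_simps(3))
  qed
next
  assume eq: "\<forall>a\<in>Obj C. \<forall>x\<in>Obj (fobj N a). \<delta> a x = \<delta>' a x"
  have "V.lax_to_posetal (fobj N a) W (\<delta> a) = V.lax_to_posetal (fobj N a) W (\<delta>' a)" if "a \<in> Obj C" for a
    by (rule V.hom_into_posetal_eqI[OF V.lax_to_posetal_hom V.lax_to_posetal_hom])
      (use \<delta> \<delta>' eq W that N_obj in \<open>auto simp: cocone_def\<close>)
  then show "cocone_arrow (C, N) W \<delta> = cocone_arrow (C, N) W \<delta>'"
    by (simp add: cocone_arrow_def cong: restrict_cong)
qed

end

section \<open>The functor R\<close>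

context two_universes
begin

text \<open>Reconciles the base component in \<open>R_functor\<close>, an identity, with the one in
  \<open>cocone_arrow\<close>.\<close>

lemma lax_id_pt: "lax_id pt = to_point pt"
  using lax_to_point[of "lax_id pt"] by (simp add: lax_id_lax pt_tensor_category)

lemma lax_map_ord_hom_comp:
  assumes "W \<in> Obj (OrdCMon elV)" "W' \<in> Obj (OrdCMon elV)" and t: "t \<in> ord_hom W W'"
    and d: "V.lax_map S W d"
  shows "V.lax_map S W' (\<lambda>x. t (d x))"
proof -
  interpret W: ord_comm_monoid W
    using assms(1) by (simp add: V.OrdCMon_Obj)
  note t = ord_homD[OF t]
  have "(t (d a) \<otimes>\<^bsub>W'\<^esub> t (d b), t (d (a \<odot>\<^bsub>S\<^esub> b))) \<in> geq W'" if "a \<in> Obj S" "b \<in> Obj S" for a b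
  proof -
    have "d a \<in> carrier W" "d b \<in> carrier W" "(d a \<otimes>\<^bsub>W\<^esub> d b, d (a \<odot>\<^bsub>S\<^esub> b)) \<in> geq W"
      using d that by (simp_all add: V.lax_map_def)
    then show ?thesis
      using t(4)[of "d a \<otimes>\<^bsub>W\<^esub> d b" "d (a \<odot>\<^bsub>S\<^esub> b)"] by (simp add: t(2))
  qed
  moreover have "(\<one>\<^bsub>W'\<^esub>, t (d (tunit S))) \<in> geq W'"
    using t(4)[of "\<one>\<^bsub>W\<^esub>" "d (tunit S)"] d by (simp add: t V.lax_map_def)
  ultimately show ?thesis
    using d by (auto simp: V.lax_map_def t)
qed

lemma lax_map_posetal_iff:
  "V.lax_map (posetal elV W) W' t \<longleftrightarrow>
    (\<forall>x\<in>carrier W. t x \<in> carrier W') \<and> (\<forall>(x, y)\<in>geq W. (t x, t y) \<in> geq W') \<and>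
    (\<forall>x\<in>carrier W. \<forall>y\<in>carrier W. (t x \<otimes>\<^bsub>W'\<^esub> t y, t (x \<otimes>\<^bsub>W\<^esub> y)) \<in> geq W') \<and>
    (\<one>\<^bsub>W'\<^esub>, t \<one>\<^bsub>W\<^esub>) \<in> geq W'"
proof -
  have "(\<forall>f\<in>Arr (posetal elV W). (t (Dom (posetal elV W) f), t (Cod (posetal elV W) f)) \<in> geq W')
    \<longleftrightarrow> (\<forall>(x, y)\<in>geq W. (t x, t y) \<in> geq W')"
    by (simp add: V.posetal_Arr split_def)
  then show ?thesis
    by (simp add: V.lax_map_def)
qed

lemma lax_map_posetal_ident:
  assumes "ord_comm_monoid W"
  shows "V.lax_map (posetal elV W) W (\<lambda>x. x)"
proof -
  interpret ord_comm_monoid W by fact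
  show ?thesis
    by (auto simp: lax_map_posetal_iff geq_refl)
qed

lemma lax_map_posetal:
  assumes "W \<in> Obj (OrdCMon elV)" "W' \<in> Obj (OrdCMon elV)" "t \<in> ord_hom W W'"
  shows "V.lax_map (posetal elV W) W' t"
  using lax_map_ord_hom_comp[OF assms lax_map_posetal_ident] assms(1) by (simp add: V.OrdCMon_Obj)

text \<open>The base has one object and its arrow acts as the identity, so invariance is automatic.
  The other conditions make the component a homomorphism, whose equations imply the lax inequalities
  by reflexivity. The restriction is there because \<open>ord_hom\<close> demands extensional
  functions.\<close>

lemma cocone_R_obj_iff:
  assumes W: "W \<in> Obj (OrdCMon elV)" and W': "W' \<in> Obj (OrdCMon elV)"
  shows "cocone (R_obj elV elU W) W' \<delta> \<longleftrightarrow> restrict (\<delta> (bullet elU)) (carrier W) \<in> ord_hom W W'"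
    (is "_ \<longleftrightarrow> ?t \<in> _")
proof -
  interpret W: ord_comm_monoid W
    using W by (simp add: V.OrdCMon_Obj)
  have "V.lax_map (posetal elV W) W' (\<delta> (bullet elU)) \<longleftrightarrow> V.lax_map (posetal elV W) W' ?t"
    by (auto simp: lax_map_posetal_iff W.geq_carrier)
  moreover have "V.lax_map (posetal elV W) W' ?t \<and>
      (\<forall>x\<in>carrier W. \<forall>y\<in>carrier W. ?t (x \<otimes>\<^bsub>W\<^esub> y) = ?t x \<otimes>\<^bsub>W'\<^esub> ?t y) \<and> ?t \<one>\<^bsub>W\<^esub> = \<one>\<^bsub>W'\<^esub>
      \<longleftrightarrow> ?t \<in> ord_hom W W'"
  proof
    assume *: "V.lax_map (posetal elV W) W' ?t \<and>
      (\<forall>x\<in>carrier W. \<forall>y\<in>carrier W. ?t (x \<otimes>\<^bsub>W\<^esub> y) = ?t x \<otimes>\<^bsub>W'\<^esub> ?t y) \<and> ?t \<one>\<^bsub>W\<^esub> = \<one>\<^bsub>W'\<^esub>"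
    then show "?t \<in> ord_hom W W'"
      unfolding lax_map_posetal_iff by (simp add: ord_hom_def hom_def Pi_def split_def)
  next
    assume t: "?t \<in> ord_hom W W'"
    then show "V.lax_map (posetal elV W) W' ?t \<and>
      (\<forall>x\<in>carrier W. \<forall>y\<in>carrier W. ?t (x \<otimes>\<^bsub>W\<^esub> y) = ?t x \<otimes>\<^bsub>W'\<^esub> ?t y) \<and> ?t \<one>\<^bsub>W\<^esub> = \<one>\<^bsub>W'\<^esub>"
      using lax_map_posetal[OF W W' t] ord_homD(2,3)[OF t] by blast
  qed
  ultimately show ?thesis
    by (simp add: cocone_def R_obj_def)
qed

lemma indexed_category_R_obj:
  "W \<in> Obj (OrdCMon elV) \<Longrightarrow> indexed_category elV elU (terminal_moncat elU) (N_of elV elU W)"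
  using R_obj_in_MonSi[of W]
  by (simp add: indexed_category_def indexed_category_axioms_def R_obj_def two_universes_axioms)

lemma R_functor_fobj [simp]: "fobj (R_functor elV elU) = R_obj elV elU"
  by (simp add: R_functor_def)

lemma R_functor_farr:
  assumes W: "W \<in> Obj (OrdCMon elV)" and W': "W' \<in> Obj (OrdCMon elV)" and t: "t \<in> ord_hom W W'"
  shows "farr (R_functor elV elU) (W, t, W') = cocone_arrow (R_obj elV elU W) W' (\<lambda>_. t)"
proof -
  have "strict_lax (posetal elV W) (posetal elV W') t (\<lambda>f. upair elV (t (ufst elV f)) (t (usnd elV f)))
      = V.lax_to_posetal (posetal elV W) W' t"
    by (rule V.strict_lax_to_posetal) (use lax_map_posetal[OF assms] ord_homD[OF t] in
        \<open>auto elim!: V.posetal_ArrE\<close>)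
  then show ?thesis
    by (simp add: R_functor_def cocone_arrow_def R_obj_def lax_id_pt cong: restrict_cong)
qed

lemma ord_hom_restrict: "t \<in> ord_hom W W' \<Longrightarrow> restrict t (carrier W) = t"
  using ord_homD(5) extensional_restrict by blast

lemma R_functor_farr_hom:
  assumes W: "W \<in> Obj (OrdCMon elV)" and W': "W' \<in> Obj (OrdCMon elV)" and t: "t \<in> ord_hom W W'"
  shows "farr (R_functor elV elU) (W, t, W') \<in> homset \<M> (R_obj elV elU W) (R_obj elV elU W')"
proof -
  interpret RW: indexed_category elV elU "terminal_moncat elU" "N_of elV elU W"
    using W by (rule indexed_category_R_obj)
  show ?thesis
    using RW.cocone_arrow_hom[OF W', folded R_obj_def] cocone_R_obj_iff[OF W W', of "\<lambda>_. t"] t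
    by (simp add: R_functor_farr[OF assms] ord_hom_restrict)
qed

end

context indexed_category
begin

text \<open>Composition with the image of \<open>t\<close> under \<open>R\<close> acts on cocones by
  applying \<open>t\<close> to their values. This controls both the functoriality of
  \<open>R\<close> and the universal property.\<close>

lemma ord_hom_cocone:
  assumes W: "W \<in> Obj (OrdCMon elV)" and W': "W' \<in> Obj (OrdCMon elV)" and t: "t \<in> ord_hom W W'"
    and \<delta>: "cocone (C, N) W \<delta>"
  shows "cocone (C, N) W' (\<lambda>a x. t (\<delta> a x))"
    and "farr (R_functor elV elU) (W, t, W') \<cdot>\<^bsub>\<M>\<^esub> cocone_arrow (C, N) W \<delta> = cocone_arrow (C, N) W' (\<lambda>a x. t (\<delta> a x))"
proof -
  have lax: "V.lax_map (fobj N a) W (\<delta> a)" if "a \<in> Obj C" for a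
    using \<delta> that by (simp add: cocone_def)
  then have carrier: "\<delta> a x \<in> carrier W" if "a \<in> Obj C" "x \<in> Obj (fobj N a)" for a x
    using that by (simp add: V.lax_map_def)
  have lax': "V.lax_map (fobj N a) W' (\<lambda>x. t (\<delta> a x))" if "a \<in> Obj C" for a
    using lax_map_ord_hom_comp[OF W W' t lax[OF that]] .
  show "cocone (C, N) W' (\<lambda>a x. t (\<delta> a x))"
    using \<delta> by (auto simp: cocone_def lax' carrier ord_homD[OF t])
  have comp: "lax_comp (V.lax_to_posetal (posetal elV W) W' t) (V.lax_to_posetal (fobj N a) W (\<delta> a))
      = V.lax_to_posetal (fobj N a) W' (\<lambda>x. t (\<delta> a x))" if "a \<in> Obj C" for a
    by (rule V.hom_into_posetal_eqI[OF V.lax_comp_in_MonCat])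
      (rule V.lax_to_posetal_hom lax lax' V.posetal_in_MonCat lax_map_posetal N_obj W W' t that
        | simp add: that carrier)+
  \<comment> \<open>The functor from the point to itself is the identity, so the base component is
    unchanged.\<close>
  have point: "lax_comp (to_point pt) (to_point (op_moncat C)) = to_point (op_moncat C)"
    using lax_comp_ident(1)[OF to_point_C] op_tensor[OF C_in_MonCat]
    by (simp add: lax_id_pt pt_tensor_category)
  show "farr (R_functor elV elU) (W, t, W') \<cdot>\<^bsub>\<M>\<^esub> cocone_arrow (C, N) W \<delta> = cocone_arrow (C, N) W' (\<lambda>a x. t (\<delta> a x))"
    by (simp add: R_functor_farr[OF W W' t] cocone_arrow_def R_obj_def point comp cong: restrict_cong)
qed

end

context two_universes
begin

lemma R_is_functor: "is_functor (OrdCMon elV) \<M> (R_functor elV elU)"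
proof (intro is_functor.intro is_functor_axioms.intro V.OrdCMon_category MonSi_category)
  show "fobj (R_functor elV elU) W \<in> Obj \<M>" if "W \<in> Obj (OrdCMon elV)" for W
    using that by (simp add: R_obj_in_MonSi)
  show "farr (R_functor elV elU) f
      \<in> homset \<M> (fobj (R_functor elV elU) W) (fobj (R_functor elV elU) W')"
    if "f \<in> homset (OrdCMon elV) W W'" for f W W'
    using that by (auto elim!: V.OrdCMon_homsetE simp: R_functor_farr_hom)
  show "farr (R_functor elV elU) (ident (OrdCMon elV) W) = ident \<M> (fobj (R_functor elV elU) W)"
    if W: "W \<in> Obj (OrdCMon elV)" for W
  proof -
    let ?t = "\<lambda>x\<in>carrier W. x"
    have t: "?t \<in> ord_hom W W"
      using category.ident_hom[OF V.OrdCMon_category W] by (simp add: V.OrdCMon_homset)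
    have "V.lax_to_posetal (posetal elV W) W ?t = lax_id (posetal elV W)"
      by (rule V.hom_into_posetal_eqI[OF V.lax_to_posetal_hom])
        (use W lax_map_posetal[OF W W t] MV.ident_hom[of "posetal elV W"] in \<open>simp_all add: V.posetal_in_MonCat\<close>)
    then show ?thesis
      using R_functor_farr[OF W W t]
      by (simp add: cocone_arrow_def R_obj_def lax_id_pt cong: restrict_cong)
  qed
  show "farr (R_functor elV elU) (g \<cdot>\<^bsub>OrdCMon elV\<^esub> f)
      = farr (R_functor elV elU) g \<cdot>\<^bsub>\<M>\<^esub> farr (R_functor elV elU) f"
    if fg: "f \<in> homset (OrdCMon elV) W W'" "g \<in> homset (OrdCMon elV) W' W''" for f g W W' W''
  proof -
    obtain s t where f: "f = (W, s, W')" "s \<in> ord_hom W W'" and g: "g = (W', t, W'')" "t \<in> ord_hom W' W''"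
      and Ob: "W \<in> Obj (OrdCMon elV)" "W' \<in> Obj (OrdCMon elV)" "W'' \<in> Obj (OrdCMon elV)"
      using fg by (auto elim!: V.OrdCMon_homsetE)
    interpret RW: indexed_category elV elU "terminal_moncat elU" "N_of elV elU W"
      using Ob(1) by (rule indexed_category_R_obj)
    have ts: "(\<lambda>x\<in>carrier W. t (s x)) \<in> ord_hom W W''"
      using category.cmp_hom[OF V.OrdCMon_category fg] by (simp add: f g V.OrdCMon_homset)
    have "cocone (R_obj elV elU W) W' (\<lambda>_. s)"
      using cocone_R_obj_iff[OF Ob(1,2), of "\<lambda>_. s"] f(2) by (simp add: ord_hom_restrict)
    note comp = RW.ord_hom_cocone[OF Ob(2,3) g(2) this[unfolded R_obj_def], folded R_obj_def]
    \<comment> \<open>Composition in \<open>OrdCMon\<close> restricts \<open>t \<circ> s\<close> to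
      the carrier, composition of cocones does not; \<open>cocone_arrow_eq_iff\<close> shows that
      the arrows agree.\<close>
    have "cocone (R_obj elV elU W) W'' (\<lambda>_. \<lambda>x\<in>carrier W. t (s x))"
      using cocone_R_obj_iff[OF Ob(1,3)] ts by simp
    then have "cocone_arrow (R_obj elV elU W) W'' (\<lambda>_. \<lambda>x\<in>carrier W. t (s x))
        = cocone_arrow (R_obj elV elU W) W'' (\<lambda>_ x. t (s x))"
      using RW.cocone_arrow_eq_iff[OF Ob(3), folded R_obj_def, OF _ comp(1)] by simp
    then show ?thesis
      by (simp add: f g R_functor_farr[OF Ob(1,3) ts] R_functor_farr[OF Ob(1,2) f(2)] comp(2))
  qed
qed

lemma R_fully_faithful: "fully_faithful (OrdCMon elV) \<M> (R_functor elV elU)"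
  unfolding fully_faithful_def
proof (intro conjI ballI R_is_functor)
  fix W W' assume W: "W \<in> Obj (OrdCMon elV)" and W': "W' \<in> Obj (OrdCMon elV)"
  interpret RW: indexed_category elV elU "terminal_moncat elU" "N_of elV elU W"
    using W by (rule indexed_category_R_obj)
  note eq_iff = RW.cocone_arrow_eq_iff[OF W', folded R_obj_def]
  have const: "cocone (R_obj elV elU W) W' (\<lambda>_. t)" if "t \<in> ord_hom W W'" for t
    using cocone_R_obj_iff[OF W W', of "\<lambda>_. t"] that by (simp add: ord_hom_restrict)
  show "bij_betw (farr (R_functor elV elU)) (homset (OrdCMon elV) W W')
      (homset \<M> (fobj (R_functor elV elU) W) (fobj (R_functor elV elU) W'))"
    unfolding bij_betw_def
  proof (intro conjI inj_onI subset_antisym subsetI)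
    fix f g assume "f \<in> homset (OrdCMon elV) W W'" "g \<in> homset (OrdCMon elV) W W'"
      and eq: "farr (R_functor elV elU) f = farr (R_functor elV elU) g"
    then obtain s t where f: "f = (W, s, W')" "s \<in> ord_hom W W'" and g: "g = (W, t, W')" "t \<in> ord_hom W W'"
      by (auto elim!: V.OrdCMon_homsetE)
    have "\<forall>x\<in>carrier W. s x = t x"
      using eq eq_iff[OF const[OF f(2)] const[OF g(2)]]
      by (simp add: f(1) g(1) R_functor_farr[OF W W'] f(2) g(2))
    then have "s = t"
      using ord_homD(5)[OF f(2)] ord_homD(5)[OF g(2)] by (metis extensionalityI)
    then show "f = g"
      by (simp add: f g)
  next
    fix \<phi> assume "\<phi> \<in> farr (R_functor elV elU) ` homset (OrdCMon elV) W W'"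
    then show "\<phi> \<in> homset \<M> (fobj (R_functor elV elU) W) (fobj (R_functor elV elU) W')"
      by (auto elim!: V.OrdCMon_homsetE simp: R_functor_farr_hom)
  next
    fix \<phi> assume "\<phi> \<in> homset \<M> (fobj (R_functor elV elU) W) (fobj (R_functor elV elU) W')"
    then have \<phi>: "\<phi> \<in> homset \<M> (R_obj elV elU W) (R_obj elV elU W')"
      by simp
    obtain \<delta> where \<delta>: "cocone (R_obj elV elU W) W' \<delta>" "\<phi> = cocone_arrow (R_obj elV elU W) W' \<delta>"
      by (rule RW.hom_into_R_cocone_arrow[OF W', folded R_obj_def, OF \<phi>])
    \<comment> \<open>The candidate preimage is the only component of the cocone, cut down to the
      carrier.\<close>
    let ?t = "restrict (\<delta> (bullet elU)) (carrier W)"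
    have t: "?t \<in> ord_hom W W'"
      using \<delta>(1) cocone_R_obj_iff[OF W W'] by simp
    have "\<phi> = farr (R_functor elV elU) (W, ?t, W')"
      using eq_iff[OF \<delta>(1) const[OF t]] by (simp add: R_functor_farr[OF W W' t] \<delta>(2))
    then show "\<phi> \<in> farr (R_functor elV elU) ` homset (OrdCMon elV) W W'"
      using W W' t by (force simp: V.OrdCMon_homset)
  qed
qed

end


section \<open>The reflection\<close>

text \<open>A choice of universal arrows defines \<open>L\<close> on objects; unique factorization
  defines it on arrows and makes it functorial. The adjunction bijection is composition with the
  universal arrow.\<close>

lemma left_adjoint_of_universal_arrows:
  fixes A :: "('o, 'm, 'y) cat_scheme" and B :: "('p, 'q, 'z) cat_scheme"
  assumes R: "is_functor A B R"
    and univ: "\<And>b. b \<in> Obj B \<Longrightarrow> \<exists>a \<eta>. a \<in> Obj A \<and> \<eta> \<in> homset B b (fobj R a) \<and>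
      (\<forall>a'\<in>Obj A. \<forall>g\<in>homset B b (fobj R a'). \<exists>!f. f \<in> homset A a a' \<and> farr R f \<cdot>\<^bsub>B\<^esub> \<eta> = g)"
  shows "\<exists>L :: ('p, 'q, 'o, 'm) func. left_adjoint A B L R"
proof -
  interpret R: is_functor A B R by fact
  from univ obtain Lo \<eta> where Lo: "\<And>b. b \<in> Obj B \<Longrightarrow> Lo b \<in> Obj A"
    and \<eta>: "\<And>b. b \<in> Obj B \<Longrightarrow> \<eta> b \<in> homset B b (fobj R (Lo b))"
    and ex1: "\<And>b a' g. b \<in> Obj B \<Longrightarrow> a' \<in> Obj A \<Longrightarrow> g \<in> homset B b (fobj R a')
      \<Longrightarrow> \<exists>!f. f \<in> homset A (Lo b) a' \<and> farr R f \<cdot>\<^bsub>B\<^esub> \<eta> b = g"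
    by metis
  \<comment> \<open>Uniqueness of factorizations as a cancellation rule; it also proves both functor
    laws for \<open>L\<close>.\<close>
  have inj: "f = f'" if "b \<in> Obj B" "a' \<in> Obj A" "f \<in> homset A (Lo b) a'" "f' \<in> homset A (Lo b) a'"
    "farr R f \<cdot>\<^bsub>B\<^esub> \<eta> b = farr R f' \<cdot>\<^bsub>B\<^esub> \<eta> b" for b a' f f'
    using ex1[OF that(1,2), of "farr R f \<cdot>\<^bsub>B\<^esub> \<eta> b"] R.B.cmp_hom[OF \<eta> R.farr_hom] that by metis
  \<comment> \<open>The arrow that makes the family \<open>\<eta>\<close> natural at
    \<open>g\<close>.\<close>
  define La where "La g = (THE f. f \<in> homset A (Lo (Dom B g)) (Lo (Cod B g)) \<and>
    farr R f \<cdot>\<^bsub>B\<^esub> \<eta> (Dom B g) = \<eta> (Cod B g) \<cdot>\<^bsub>B\<^esub> g)" for g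
  have La: "La g \<in> homset A (Lo b) (Lo b')" "farr R (La g) \<cdot>\<^bsub>B\<^esub> \<eta> b = \<eta> b' \<cdot>\<^bsub>B\<^esub> g"
    if g: "g \<in> homset B b b'" for g b b'
  proof -
    have b: "Dom B g = b" "Cod B g = b'" "b \<in> Obj B" "b' \<in> Obj B"
      using g by (auto simp: homset_def)
    show "La g \<in> homset A (Lo b) (Lo b')" "farr R (La g) \<cdot>\<^bsub>B\<^esub> \<eta> b = \<eta> b' \<cdot>\<^bsub>B\<^esub> g"
      using theI'[OF ex1[OF b(3) Lo[OF b(4)] R.B.cmp_hom[OF g \<eta>[OF b(4)]]]]
      by (simp_all add: La_def b)
  qed
  define L :: "('p, 'q, 'o, 'm) func" where "L = \<lparr>fobj = Lo, farr = La\<rparr>"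
  have L: "is_functor B A L"
  proof (intro is_functor.intro is_functor_axioms.intro R.A.category_axioms R.B.category_axioms)
    show "fobj L b \<in> Obj A" if "b \<in> Obj B" for b
      using that Lo by (simp add: L_def)
    show "farr L g \<in> homset A (fobj L b) (fobj L b')" if "g \<in> homset B b b'" for g b b'
      using La(1)[OF that] by (simp add: L_def)
    show "farr L (ident B b) = ident A (fobj L b)" if b: "b \<in> Obj B" for b
      using La[OF R.B.ident_hom[OF b]] \<eta>[OF b] R.A.ident_hom[OF Lo[OF b]] b Lo[OF b]
      by (intro inj[of b "Lo b"]) (auto simp: L_def R.B.ident_left[OF \<eta>[OF b]] R.B.ident_right[OF \<eta>[OF b]])
    show "farr L (g' \<cdot>\<^bsub>B\<^esub> g) = farr L g' \<cdot>\<^bsub>A\<^esub> farr L g"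
      if g: "g \<in> homset B b b'" and g': "g' \<in> homset B b' b''" for g g' b b' b''
    proof -
      have b: "b \<in> Obj B" "b' \<in> Obj B" "b'' \<in> Obj B"
        using g g' by (auto simp: homset_def)
      have "farr R (La g' \<cdot>\<^bsub>A\<^esub> La g) \<cdot>\<^bsub>B\<^esub> \<eta> b = farr R (La g') \<cdot>\<^bsub>B\<^esub> (\<eta> b' \<cdot>\<^bsub>B\<^esub> g)"
        using R.B.cmp_assoc[OF \<eta>[OF b(1)] R.farr_hom[OF La(1)[OF g]] R.farr_hom[OF La(1)[OF g']]]
        by (simp add: R.farr_cmp[OF La(1)[OF g] La(1)[OF g']] La(2)[OF g])
      also have "\<dots> = \<eta> b'' \<cdot>\<^bsub>B\<^esub> (g' \<cdot>\<^bsub>B\<^esub> g)"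
        using R.B.cmp_assoc[OF g \<eta>[OF b(2)] R.farr_hom[OF La(1)[OF g']]]
          R.B.cmp_assoc[OF g g' \<eta>[OF b(3)]]
        by (simp add: La(2)[OF g'])
      finally show ?thesis
        using La[OF R.B.cmp_hom[OF g g']] R.A.cmp_hom[OF La(1)[OF g] La(1)[OF g']] b
        by (intro inj[of b "Lo b''"]) (simp_all add: L_def Lo)
    qed
  qed
  define \<Phi> where "\<Phi> b a f = farr R f \<cdot>\<^bsub>B\<^esub> \<eta> b" for b and a :: 'o and f
  have "bij_betw (\<Phi> b a) (homset A (fobj L b) a) (homset B b (fobj R a))" if b: "b \<in> Obj B" and a: "a \<in> Obj A" for a b
    unfolding bij_betw_def
  proof (intro conjI inj_onI subset_antisym subsetI)
    show "f = f'" if "f \<in> homset A (fobj L b) a" "f' \<in> homset A (fobj L b) a" "\<Phi> b a f = \<Phi> b a f'" for f f'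
      using inj[OF b a] that by (simp add: L_def \<Phi>_def)
    show "g \<in> homset B b (fobj R a)" if "g \<in> \<Phi> b a ` homset A (fobj L b) a" for g
      using that R.B.cmp_hom[OF \<eta>[OF b] R.farr_hom] by (auto simp: L_def \<Phi>_def)
    show "g \<in> \<Phi> b a ` homset A (fobj L b) a" if "g \<in> homset B b (fobj R a)" for g
      using ex1[OF b a that] by (auto simp: L_def \<Phi>_def)
  qed
  moreover have "\<Phi> b' a' (h \<cdot>\<^bsub>A\<^esub> (f \<cdot>\<^bsub>A\<^esub> farr L g)) = farr R h \<cdot>\<^bsub>B\<^esub> (\<Phi> b a f \<cdot>\<^bsub>B\<^esub> g)"
    if b: "b \<in> Obj B" "b' \<in> Obj B" and g: "g \<in> homset B b' b" and h: "h \<in> homset A a a'"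
      and f: "f \<in> homset A (fobj L b) a" for b b' a a' f g h
  proof -
    have f: "f \<in> homset A (Lo b) a"
      using f by (simp add: L_def)
    note Lg = La[OF g] and RLg = R.farr_hom[OF La(1)[OF g]] and Rf = R.farr_hom[OF f] and Rh = R.farr_hom[OF h]
    have "farr R (h \<cdot>\<^bsub>A\<^esub> (f \<cdot>\<^bsub>A\<^esub> La g)) \<cdot>\<^bsub>B\<^esub> \<eta> b' = farr R h \<cdot>\<^bsub>B\<^esub> (farr R f \<cdot>\<^bsub>B\<^esub> (farr R (La g) \<cdot>\<^bsub>B\<^esub> \<eta> b'))"
      using R.B.cmp_assoc[OF \<eta>[OF b(2)] R.B.cmp_hom[OF RLg Rf] Rh] R.B.cmp_assoc[OF \<eta>[OF b(2)] RLg Rf]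
      by (simp add: R.farr_cmp[OF R.A.cmp_hom[OF Lg(1) f] h] R.farr_cmp[OF Lg(1) f])
    also have "\<dots> = farr R h \<cdot>\<^bsub>B\<^esub> ((farr R f \<cdot>\<^bsub>B\<^esub> \<eta> b) \<cdot>\<^bsub>B\<^esub> g)"
      using R.B.cmp_assoc[OF g \<eta>[OF b(1)] Rf] by (simp add: Lg(2))
    finally show ?thesis
      by (simp add: L_def \<Phi>_def)
  qed
  ultimately have "left_adjoint A B L R"
    unfolding left_adjoint_def using L R by blast
  then show ?thesis
    by blast
qed

text \<open>
  Both the identification of elements of \<open>S\<close> and their order are defined by comparing the values
  of all maps of \<open>P\<close>, so the monoid laws and the compatibility of the order are inherited from the
  targets and no congruence has to be generated. An element of the quotient is represented by the
  code, under \<open>h\<close>, of a chosen representative; this keeps the carrier inside the small set \<open>h ` S\<close>.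
\<close>

lemma (in grothendieck_universe) ordered_monoid_reflection:
  fixes S :: "'s set" and P :: "('u ordmon \<times> ('s \<Rightarrow> 'u)) set"
  assumes h: "inj_on h S" "small el (h ` S)"
    and mul: "\<And>p q. p \<in> S \<Longrightarrow> q \<in> S \<Longrightarrow> mul p q \<in> S" and e: "e \<in> S"
    and homs: "\<And>W d. (W, d) \<in> P \<Longrightarrow> ord_comm_monoid W \<and> (\<forall>p\<in>S. d p \<in> carrier W) \<and>
      (\<forall>p\<in>S. \<forall>q\<in>S. d (mul p q) = d p \<otimes>\<^bsub>W\<^esub> d q) \<and> d e = \<one>\<^bsub>W\<^esub>"
  obtains W\<^sub>0 rep where "W\<^sub>0 \<in> Obj (OrdCMon el)" "carrier W\<^sub>0 = rep ` S"
    "\<And>p q. p \<in> S \<Longrightarrow> q \<in> S \<Longrightarrow> rep (mul p q) = rep p \<otimes>\<^bsub>W\<^sub>0\<^esub> rep q" "rep e = \<one>\<^bsub>W\<^sub>0\<^esub>"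
    "\<And>p q. p \<in> S \<Longrightarrow> q \<in> S \<Longrightarrow> (rep p, rep q) \<in> geq W\<^sub>0 \<longleftrightarrow> (\<forall>(W, d)\<in>P. (d p, d q) \<in> geq W)"
    "\<And>p q. p \<in> S \<Longrightarrow> q \<in> S \<Longrightarrow> rep p = rep q \<longleftrightarrow> (\<forall>(W, d)\<in>P. d p = d q)"
    "\<And>W d. (W, d) \<in> P \<Longrightarrow> \<exists>t\<in>ord_hom W\<^sub>0 W. \<forall>p\<in>S. t (rep p) = d p"
proof -
  have P: "ord_comm_monoid W" "p \<in> S \<Longrightarrow> d p \<in> carrier W"
    "p \<in> S \<Longrightarrow> q \<in> S \<Longrightarrow> d (mul p q) = d p \<otimes>\<^bsub>W\<^esub> d q" "d e = \<one>\<^bsub>W\<^esub>" if "(W, d) \<in> P" for W d p q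
    using homs[OF that] by auto
  define eqv where "eqv p q \<longleftrightarrow> (\<forall>(W, d)\<in>P. d p = d q)" for p q
  define r where "r p = (SOME q. q \<in> S \<and> eqv p q)" for p
  define rep where "rep p = h (r p)" for p
  \<comment> \<open>\<open>k\<close> decodes: \<open>k (rep p)\<close> is the chosen representative
    \<open>r p\<close>.\<close>
  define k where "k = inv_into S h"
  have r: "r p \<in> S" "eqv p (r p)" if "p \<in> S" for p
    using someI[of "\<lambda>q. q \<in> S \<and> eqv p q" p] that by (auto simp: r_def eqv_def)
  \<comment> \<open>Equivalent elements have the same predicate \<open>eqv p\<close>, so
    \<open>SOME\<close> picks the same representative for both.\<close>
  have r_eq: "r p = r q" if "eqv p q" for p q
  proof -
    have "eqv p = eqv q"
      using that by (force simp: eqv_def fun_eq_iff)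
    then show ?thesis
      by (simp add: r_def)
  qed
  have rep_eq: "rep p = rep q \<longleftrightarrow> eqv p q" if "p \<in> S" "q \<in> S" for p q
  proof
    assume "rep p = rep q"
    then have "r p = r q"
      using h(1) r(1) that by (auto simp: rep_def dest: inj_onD)
    then show "eqv p q"
      using r(2)[OF that(1)] r(2)[OF that(2)] by (force simp: eqv_def)
  qed (simp add: rep_def r_eq)
  have k_rep: "k (rep p) \<in> S" "eqv (k (rep p)) p" if "p \<in> S" for p
    using that r[OF that] h(1) by (auto simp: k_def rep_def eqv_def)
  \<comment> \<open>The product is formed from decoded representatives, and \<open>mult\<close>
    shows that any others give the same class. The order is declared for all pairs of elements of
    \<open>S\<close>, so \<open>geq\<close> has to show that it depends on the classes only.\<close>
  define W\<^sub>0 :: "'u ordmon" where "W\<^sub>0 = \<lparr>carrier = rep ` S, mult = (\<lambda>x y. rep (mul (k x) (k y))),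
    one = rep e, geq = {(rep p, rep q) | p q. p \<in> S \<and> q \<in> S \<and> (\<forall>(W, d)\<in>P. (d p, d q) \<in> geq W)}\<rparr>"
  have mult: "rep p \<otimes>\<^bsub>W\<^sub>0\<^esub> rep q = rep (mul p q)" if "p \<in> S" "q \<in> S" for p q
  proof -
    have "d (mul (k (rep p)) (k (rep q))) = d (mul p q)" if Wd: "(W, d) \<in> P" for W d
    proof -
      have "d (k (rep p)) = d p" "d (k (rep q)) = d q"
        using k_rep(2)[OF \<open>p \<in> S\<close>] k_rep(2)[OF \<open>q \<in> S\<close>] Wd by (auto simp: eqv_def)
      then show ?thesis
        using k_rep(1) \<open>p \<in> S\<close> \<open>q \<in> S\<close> by (simp add: P(3)[OF Wd])
    qed
    then have "eqv (mul (k (rep p)) (k (rep q))) (mul p q)"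
      by (auto simp: eqv_def)
    then show ?thesis
      using k_rep(1) that mul by (simp add: W\<^sub>0_def rep_eq)
  qed
  have carrier: "carrier W\<^sub>0 = rep ` S" and one: "\<one>\<^bsub>W\<^sub>0\<^esub> = rep e"
    by (simp_all add: W\<^sub>0_def)
  have geq: "(rep p, rep q) \<in> geq W\<^sub>0 \<longleftrightarrow> (\<forall>(W, d)\<in>P. (d p, d q) \<in> geq W)" if "p \<in> S" "q \<in> S" for p q
  proof
    assume "(rep p, rep q) \<in> geq W\<^sub>0"
    then obtain p' q' where "p' \<in> S" "q' \<in> S" "rep p = rep p'" "rep q = rep q'"
      and *: "\<forall>(W, d)\<in>P. (d p', d q') \<in> geq W"
      by (auto simp: W\<^sub>0_def)
    then have "eqv p p'" "eqv q q'"
      using that by (simp_all add: rep_eq)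
    then have "d p = d p'" "d q = d q'" if "(W, d) \<in> P" for W d
      using that by (auto simp: eqv_def)
    with * show "\<forall>(W, d)\<in>P. (d p, d q) \<in> geq W"
      by (metis (no_types, lifting) case_prodD case_prodI2)
  qed (use that in \<open>auto simp: W\<^sub>0_def\<close>)
  have geq_carrier: "geq W\<^sub>0 \<subseteq> carrier W\<^sub>0 \<times> carrier W\<^sub>0"
    by (auto simp: W\<^sub>0_def)
  have laws: "eqv (mul (mul p q) s) (mul p (mul q s)) \<and> eqv (mul p q) (mul q p) \<and> eqv (mul e p) p"
    if pqs: "p \<in> S" "q \<in> S" "s \<in> S" for p q s
  proof -
    have "d (mul (mul p q) s) = d (mul p (mul q s)) \<and> d (mul p q) = d (mul q p) \<and> d (mul e p) = d p"
      if Wd: "(W, d) \<in> P" for W d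
    proof -
      interpret W: ord_comm_monoid W
        using Wd by (rule P(1))
      show ?thesis
        using pqs by (simp add: P(2-4)[OF Wd] mul e W.m_ac)
    qed
    then show ?thesis
      by (auto simp: eqv_def)
  qed
  have "comm_monoid W\<^sub>0"
    by (rule comm_monoidI) (auto simp: carrier one mult mul e rep_eq laws)
  moreover have "partial_order_on (carrier W\<^sub>0) (geq W\<^sub>0)"
    unfolding partial_order_on_def preorder_on_def
  proof (intro conjI geq_carrier)
    show "refl_on (carrier W\<^sub>0) (geq W\<^sub>0)"
      using ord_comm_monoid.geq_refl[OF P(1) P(2)] by (auto simp: refl_on_def carrier geq)
    show "trans (geq W\<^sub>0)"
    proof (rule transI)
      fix x y z assume "(x, y) \<in> geq W\<^sub>0" "(y, z) \<in> geq W\<^sub>0"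
      moreover obtain p q s where "x = rep p" "y = rep q" "z = rep s" "p \<in> S" "q \<in> S" "s \<in> S"
        using calculation geq_carrier unfolding carrier by blast
      moreover from calculation have "(d p, d s) \<in> geq W" if "(W, d) \<in> P" for W d
        using ord_comm_monoid.geq_trans[OF P(1)[OF that], of "d p" "d q" "d s"] that by (auto simp: geq)
      ultimately show "(x, z) \<in> geq W\<^sub>0"
        by (auto simp: geq)
    qed
    \<comment> \<open>Antisymmetry in every target turns the two comparisons into equality of
      values, which is the relation \<open>eqv\<close> of the quotient.\<close>
    show "antisym (geq W\<^sub>0)"
    proof (rule antisymI)
      fix x y assume "(x, y) \<in> geq W\<^sub>0" "(y, x) \<in> geq W\<^sub>0"
      moreover obtain p q where "x = rep p" "y = rep q" "p \<in> S" "q \<in> S"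
        using calculation geq_carrier unfolding carrier by blast
      moreover from calculation have "d p = d q" if "(W, d) \<in> P" for W d
        using ord_comm_monoid.geq_antisym[OF P(1)[OF that], of "d p" "d q"] that by (auto simp: geq)
      ultimately show "x = y"
        by (auto simp: rep_eq eqv_def)
    qed
  qed
  moreover have "(x \<otimes>\<^bsub>W\<^sub>0\<^esub> z, y \<otimes>\<^bsub>W\<^sub>0\<^esub> w) \<in> geq W\<^sub>0"
    if xyzw: "(x, y) \<in> geq W\<^sub>0" "(z, w) \<in> geq W\<^sub>0" for x y z w
  proof -
    obtain p q u v where "x = rep p" "y = rep q" "z = rep u" "w = rep v" "p \<in> S" "q \<in> S" "u \<in> S" "v \<in> S"
      using xyzw geq_carrier unfolding carrier by blast
    moreover from this xyzw have "(d (mul p u), d (mul q v)) \<in> geq W" if Wd: "(W, d) \<in> P" for W d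
      using ord_comm_monoid.geq_mult[OF P(1)[OF Wd], of "d p" "d q" "d u" "d v"] Wd
      by (auto simp: geq P(3)[OF Wd])
    ultimately show ?thesis
      by (auto simp: geq mult mul)
  qed
  ultimately have W\<^sub>0: "ord_comm_monoid W\<^sub>0"
    by (simp add: ord_comm_monoid_def ord_comm_monoid_axioms_def)
  \<comment> \<open>Smallness comes from the codes alone, however many targets \<open>P\<close>
    contains.\<close>
  have "rep ` S \<subseteq> h ` S"
    using r(1) by (auto simp: rep_def)
  then have "W\<^sub>0 \<in> Obj (OrdCMon el)"
    using W\<^sub>0 h(2) by (auto simp: OrdCMon_Obj carrier intro: small_subset)
  moreover have "\<exists>t\<in>ord_hom W\<^sub>0 W. \<forall>p\<in>S. t (rep p) = d p" if Wd: "(W, d) \<in> P" for W d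
  \<comment> \<open>The factorization decodes a class and applies \<open>d\<close>, which is
    constant on classes by the definition of \<open>eqv\<close>.\<close>
  proof (rule bexI[of _ "\<lambda>x\<in>carrier W\<^sub>0. d (k x)"])
    have t: "d (k (rep p)) = d p" if "p \<in> S" for p
      using k_rep(2)[OF that] Wd by (auto simp: eqv_def)
    then show "\<forall>p\<in>S. (\<lambda>x\<in>carrier W\<^sub>0. d (k x)) (rep p) = d p"
      by (simp add: carrier)
    have mono: "(d (k x), d (k y)) \<in> geq W \<and> x \<in> carrier W\<^sub>0 \<and> y \<in> carrier W\<^sub>0"
      if xy: "(x, y) \<in> geq W\<^sub>0" for x y
    proof -
      obtain p q where "x = rep p" "y = rep q" "p \<in> S" "q \<in> S"
        using xy geq_carrier unfolding carrier by blast
      with xy Wd show ?thesis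
        by (auto simp: geq t carrier)
    qed
    have "(\<lambda>x\<in>carrier W\<^sub>0. d (k x)) \<in> hom W\<^sub>0 W" "(\<lambda>x\<in>carrier W\<^sub>0. d (k x)) \<one>\<^bsub>W\<^sub>0\<^esub> = \<one>\<^bsub>W\<^esub>"
      by (auto simp: hom_def carrier mult one t mul e P(2-4)[OF Wd])
    then show "(\<lambda>x\<in>carrier W\<^sub>0. d (k x)) \<in> ord_hom W\<^sub>0 W"
      by (auto simp: ord_hom_def dest: mono)
  qed
  ultimately show thesis
    using that[of W\<^sub>0 rep] carrier mult one geq rep_eq by (auto simp: eqv_def)
qed

section \<open>The universal arrow from an indexed category to the functor \<open>R\<close>\<close>

context indexed_category
begin

text \<open>The indices live in the universe \<open>elU\<close> and the fibres in
  \<open>elV\<close>. A bijection from \<open>Obj C\<close> to a set of \<open>elV\<close> renames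
  the indices, and then a pair is coded by a pair inside \<open>elV\<close>.\<close>

lemma total_objects_small:
  assumes "no_larger elU elV"
  obtains h :: "'u \<times> 'v \<Rightarrow> 'v"
  where "inj_on h (SIGMA a:Obj C. Obj (fobj N a))" "small elV (h ` (SIGMA a:Obj C. Obj (fobj N a)))"
proof -
  obtain X where "Obj C = elU X"
    using C_in_MonCat by (auto simp: U.MonCat_Obj small_def)
  then obtain y f where f: "bij_betw f (Obj C) (elV y)"
    using assms unfolding no_larger_def by metis
  define h where "h = (\<lambda>(a, x). upair elV (f a) x)"
  have f_inv: "a \<in> Obj C \<Longrightarrow> inv_into (Obj C) f (f a) = a" "i \<in> elV y \<Longrightarrow> inv_into (Obj C) f i \<in> Obj C" for a i
    using f by (auto simp: bij_betw_def inv_into_into)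
  have "inj_on h (SIGMA a:Obj C. Obj (fobj N a))"
    using f by (auto simp: inj_on_def h_def bij_betw_def)
  \<comment> \<open>Indexing by \<open>elV y\<close> instead of \<open>Obj C\<close> makes this a
    union within the universe \<open>elV\<close>.\<close>
  moreover have "h ` (SIGMA a:Obj C. Obj (fobj N a)) \<subseteq>
      (\<Union>i\<in>elV y. upair elV i ` Obj (fobj N (inv_into (Obj C) f i)))"
    using f by (force simp: h_def f_inv bij_betw_def)
  moreover have "small elV (\<Union>i\<in>elV y. upair elV i ` Obj (fobj N (inv_into (Obj C) f i)))"
    using N_obj[OF f_inv(2)] by (intro V.small_UN V.small_image) (auto simp: V.MonCat_Obj small_def)
  ultimately show thesis
    using that V.small_subset by blast
qed

lemma universal_arrow:
  assumes "no_larger elU elV"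
  shows "\<exists>W\<^sub>0 \<eta>. W\<^sub>0 \<in> Obj (OrdCMon elV) \<and> \<eta> \<in> homset \<M> (C, N) (R_obj elV elU W\<^sub>0) \<and>
    (\<forall>W\<in>Obj (OrdCMon elV). \<forall>g\<in>homset \<M> (C, N) (R_obj elV elU W).
      \<exists>!f. f \<in> homset (OrdCMon elV) W\<^sub>0 W \<and> farr (R_functor elV elU) f \<cdot>\<^bsub>\<M>\<^esub> \<eta> = g)"
proof -
  define S where "S = (SIGMA a:Obj C. Obj (fobj N a))"
  define mul where "mul = (\<lambda>(a, x) (b, y). (a \<odot>\<^bsub>C\<^esub> b, fobj (lmul N (a, b)) (upair elV x y)))"
  define e where "e = (tunit C, fobj (lone N) (bullet elV))"
  \<comment> \<open>All cocones at once, uncurried to functions on the total set of objects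
    \<open>S\<close>.\<close>
  define P where "P = {(W, \<lambda>(a, x). \<delta> a x) | W \<delta>. W \<in> Obj (OrdCMon elV) \<and> cocone (C, N) W \<delta>}"
  obtain h :: "'u \<times> 'v \<Rightarrow> 'v" where h: "inj_on h S" "small elV (h ` S)"
    using total_objects_small[OF assms] unfolding S_def .
  have mul: "mul p q \<in> S" if "p \<in> S" "q \<in> S" for p q
    using that V.MonCat_hom_fobj[OF N_mul] by (auto simp: S_def mul_def)
  have e: "e \<in> S"
    using V.MonCat_hom_fobj[OF N_one] by (simp add: S_def e_def)
  have lax: "V.lax_map (fobj N a) W (\<delta> a)" if "cocone (C, N) W \<delta>" "a \<in> Obj C" for W \<delta> a
    using that by (simp add: cocone_def)
  obtain W\<^sub>0 rep where W\<^sub>0: "W\<^sub>0 \<in> Obj (OrdCMon elV)" "carrier W\<^sub>0 = rep ` S"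
    "\<And>p q. p \<in> S \<Longrightarrow> q \<in> S \<Longrightarrow> rep (mul p q) = rep p \<otimes>\<^bsub>W\<^sub>0\<^esub> rep q" "rep e = \<one>\<^bsub>W\<^sub>0\<^esub>"
    and geq: "\<And>p q. p \<in> S \<Longrightarrow> q \<in> S \<Longrightarrow> (rep p, rep q) \<in> geq W\<^sub>0 \<longleftrightarrow> (\<forall>(W, d)\<in>P. (d p, d q) \<in> geq W)"
    and rep_eq: "\<And>p q. p \<in> S \<Longrightarrow> q \<in> S \<Longrightarrow> rep p = rep q \<longleftrightarrow> (\<forall>(W, d)\<in>P. d p = d q)"
    and factor: "\<And>W d. (W, d) \<in> P \<Longrightarrow> \<exists>t\<in>ord_hom W\<^sub>0 W. \<forall>p\<in>S. t (rep p) = d p"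
  proof (rule V.ordered_monoid_reflection[OF h, where mul = mul and e = e and P = P])
    show "mul p q \<in> S" if "p \<in> S" "q \<in> S" for p q
      using that by (rule mul)
    show "ord_comm_monoid W \<and> (\<forall>p\<in>S. d p \<in> carrier W) \<and>
      (\<forall>p\<in>S. \<forall>q\<in>S. d (mul p q) = d p \<otimes>\<^bsub>W\<^esub> d q) \<and> d e = \<one>\<^bsub>W\<^esub>" if "(W, d) \<in> P" for W d
      using that by (auto simp: P_def S_def mul_def e_def V.OrdCMon_Obj cocone_def V.lax_map_def)
    show "e \<in> S"
      by (fact e)
  qed (rule that; assumption)
  \<comment> \<open>The universal cocone sends an object of a fibre to its class.\<close>
  define \<delta>\<^sub>0 where "\<delta>\<^sub>0 a x = rep (a, x)" for a x
  have "V.lax_map (fobj N a) W\<^sub>0 (\<delta>\<^sub>0 a)" if a: "a \<in> Obj C" for a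
    unfolding V.lax_map_def
  proof (intro conjI ballI)
    interpret Na: monoidal_category "fobj N a"
      using N_obj[OF a] by (rule V.MonCat_monoidal)
    note I = V.MonCat_hom_fobj[OF N_one, of "bullet elV"]
    fix x y assume x: "x \<in> Obj (fobj N a)" and y: "y \<in> Obj (fobj N a)"
    have m: "mul (a, x) (a, y) \<in> S"
      using a x y by (intro mul) (simp_all add: S_def)
    show "\<delta>\<^sub>0 a x \<in> carrier W\<^sub>0"
      using a x by (simp add: \<delta>\<^sub>0_def W\<^sub>0(2) S_def)
    \<comment> \<open>The two elements lie over different objects, \<open>a \<odot> a\<close> and
      \<open>a\<close>. Every cocone sends the first to the product of the values at
      \<open>x\<close> and \<open>y\<close>, which lies above the value at
      \<open>x \<odot> y\<close> by laxness of its component.\<close>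
    have "(rep (mul (a, x) (a, y)), rep (a, x \<odot>\<^bsub>fobj N a\<^esub> y)) \<in> geq W\<^sub>0"
      using a x y m by (auto simp: geq S_def P_def mul_def cocone_def V.lax_map_def)
    then show "(\<delta>\<^sub>0 a x \<otimes>\<^bsub>W\<^sub>0\<^esub> \<delta>\<^sub>0 a y, \<delta>\<^sub>0 a (x \<odot>\<^bsub>fobj N a\<^esub> y)) \<in> geq W\<^sub>0"
      using a x y by (simp add: \<delta>\<^sub>0_def W\<^sub>0(3) S_def)
  next
    interpret Na: monoidal_category "fobj N a"
      using N_obj[OF a] by (rule V.MonCat_monoidal)
    fix f assume "f \<in> Arr (fobj N a)"
    then show "(\<delta>\<^sub>0 a (Dom (fobj N a) f), \<delta>\<^sub>0 a (Cod (fobj N a) f)) \<in> geq W\<^sub>0"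
      using a by (auto simp: \<delta>\<^sub>0_def geq S_def P_def cocone_def V.lax_map_def)
  next
    interpret Na: monoidal_category "fobj N a"
      using N_obj[OF a] by (rule V.MonCat_monoidal)
    have "(\<one>\<^bsub>W\<^esub>, \<delta> a (tunit (fobj N a))) \<in> geq W" if "cocone (C, N) W \<delta>" for W \<delta>
      using lax[OF that a] by (simp add: V.lax_map_def)
    \<comment> \<open>Likewise for units: \<open>e\<close> lies over the unit of \<open>C\<close>
      and has value one under every cocone, which dominates the value at the unit of the fibre over
      \<open>a\<close>.\<close>
    then have "(rep e, rep (a, tunit (fobj N a))) \<in> geq W\<^sub>0"
      using a e by (auto simp: geq S_def P_def e_def cocone_def)
    then show "(\<one>\<^bsub>W\<^sub>0\<^esub>, \<delta>\<^sub>0 a (tunit (fobj N a))) \<in> geq W\<^sub>0"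
      by (simp add: \<delta>\<^sub>0_def W\<^sub>0(4))
  qed
  \<comment> \<open>Reindexing changes the fibre but not the class, because all cocones are
    invariant under it.\<close>
  moreover have "\<delta>\<^sub>0 (Dom C f) (fobj (farr N f) x) = \<delta>\<^sub>0 (Cod C f) x"
    if "f \<in> Arr C" "x \<in> Obj (fobj N (Cod C f))" for f x
    using that V.MonCat_hom_fobj[OF N_arr] by (auto simp: \<delta>\<^sub>0_def rep_eq S_def P_def cocone_def)
  moreover have "\<delta>\<^sub>0 (a \<odot>\<^bsub>C\<^esub> b) (fobj (lmul N (a, b)) (upair elV x y)) = \<delta>\<^sub>0 a x \<otimes>\<^bsub>W\<^sub>0\<^esub> \<delta>\<^sub>0 b y"
    if "a \<in> Obj C" "b \<in> Obj C" "x \<in> Obj (fobj N a)" "y \<in> Obj (fobj N b)" for a b x y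
    using W\<^sub>0(3)[of "(a, x)" "(b, y)"] that by (simp add: \<delta>\<^sub>0_def S_def mul_def)
  moreover have "\<delta>\<^sub>0 (tunit C) (fobj (lone N) (bullet elV)) = \<one>\<^bsub>W\<^sub>0\<^esub>"
    using W\<^sub>0(4) by (simp add: \<delta>\<^sub>0_def e_def)
  ultimately have \<delta>\<^sub>0: "cocone (C, N) W\<^sub>0 \<delta>\<^sub>0"
    by (simp add: cocone_def)
  show ?thesis
  proof (intro exI[of _ W\<^sub>0] exI[of _ "cocone_arrow (C, N) W\<^sub>0 \<delta>\<^sub>0"] conjI ballI)
    show "W\<^sub>0 \<in> Obj (OrdCMon elV)"
      by (fact W\<^sub>0(1))
    show "cocone_arrow (C, N) W\<^sub>0 \<delta>\<^sub>0 \<in> homset \<M> (C, N) (R_obj elV elU W\<^sub>0)"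
      using W\<^sub>0(1) \<delta>\<^sub>0 by (rule cocone_arrow_hom)
    fix W g assume W: "W \<in> Obj (OrdCMon elV)" and "g \<in> homset \<M> (C, N) (R_obj elV elU W)"
    then obtain \<delta> where \<delta>: "cocone (C, N) W \<delta>" "g = cocone_arrow (C, N) W \<delta>"
      by (rule hom_into_R_cocone_arrow)
    \<comment> \<open>Existence and uniqueness both reduce to this: the triangle commutes iff
      \<open>t\<close> takes prescribed values on the classes.\<close>
    have comm_iff: "farr (R_functor elV elU) (W\<^sub>0, t, W) \<cdot>\<^bsub>\<M>\<^esub> cocone_arrow (C, N) W\<^sub>0 \<delta>\<^sub>0 = g \<longleftrightarrow>
        (\<forall>(a, x)\<in>S. t (rep (a, x)) = \<delta> a x)" if "t \<in> ord_hom W\<^sub>0 W" for t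
      using cocone_arrow_eq_iff[OF W ord_hom_cocone(1)[OF W\<^sub>0(1) W that \<delta>\<^sub>0] \<delta>(1)]
      by (simp add: ord_hom_cocone(2)[OF W\<^sub>0(1) W that \<delta>\<^sub>0] \<delta>(2) \<delta>\<^sub>0_def S_def)
    have "(W, \<lambda>(a, x). \<delta> a x) \<in> P"
      using W \<delta>(1) by (auto simp: P_def)
    from factor[OF this] obtain t where "t \<in> ord_hom W\<^sub>0 W"
      "\<forall>p\<in>S. t (rep p) = (case p of (a, x) \<Rightarrow> \<delta> a x)"
      by blast
    then have t: "t \<in> ord_hom W\<^sub>0 W" "\<forall>(a, x)\<in>S. t (rep (a, x)) = \<delta> a x"
      by auto
    show "\<exists>!f. f \<in> homset (OrdCMon elV) W\<^sub>0 W \<and>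
        farr (R_functor elV elU) f \<cdot>\<^bsub>\<M>\<^esub> cocone_arrow (C, N) W\<^sub>0 \<delta>\<^sub>0 = g"
    proof (intro ex1I[of _ "(W\<^sub>0, t, W)"] conjI)
      show "(W\<^sub>0, t, W) \<in> homset (OrdCMon elV) W\<^sub>0 W"
        using W\<^sub>0(1) W t(1) by (simp add: V.OrdCMon_homset)
      show "farr (R_functor elV elU) (W\<^sub>0, t, W) \<cdot>\<^bsub>\<M>\<^esub> cocone_arrow (C, N) W\<^sub>0 \<delta>\<^sub>0 = g"
        using comm_iff[OF t(1)] t(2) by simp
    next
      fix f assume f: "f \<in> homset (OrdCMon elV) W\<^sub>0 W \<and>
        farr (R_functor elV elU) f \<cdot>\<^bsub>\<M>\<^esub> cocone_arrow (C, N) W\<^sub>0 \<delta>\<^sub>0 = g"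
      then obtain s where s: "f = (W\<^sub>0, s, W)" "s \<in> ord_hom W\<^sub>0 W"
        by (auto elim: V.OrdCMon_homsetE)
      \<comment> \<open>The classes exhaust \<open>carrier W\<^sub>0\<close>, so the prescribed
        values leave no freedom.\<close>
      have "s x = t x" if x: "x \<in> carrier W\<^sub>0" for x
      proof -
        obtain a y where ay: "(a, y) \<in> S" "x = rep (a, y)"
          using x W\<^sub>0(2) by auto
        have "\<forall>(a, x)\<in>S. s (rep (a, x)) = \<delta> a x"
          using comm_iff[OF s(2)] f by (simp add: s(1))
        from bspec[OF this ay(1)] bspec[OF t(2) ay(1)] show ?thesis
          by (simp add: ay(2))
      qed
      then have "s = t"
        using ord_homD(5)[OF s(2)] ord_homD(5)[OF t(1)] by (metis extensionalityI)
      then show "f = (W\<^sub>0, t, W)"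
        by (simp add: s)
    qed
  qed
qed

end

theorem lemma2:
  fixes elV :: "'v \<Rightarrow> 'v set" and elU :: "'u \<Rightarrow> 'u set"
  assumes "grothendieck_universe elV" and "grothendieck_universe elU"
  shows "fully_faithful (OrdCMon elV) (MonSiMonCat elV elU) (R_functor elV elU) \<and>
    (no_larger elU elV \<longrightarrow>
      (\<exists>L :: (('u, 'v) indexed, ('u, 'v) indexed_arrow,
               'v ordmon, 'v ordmon \<times> ('v \<Rightarrow> 'v) \<times> 'v ordmon) func.
         left_adjoint (OrdCMon elV) (MonSiMonCat elV elU) L (R_functor elV elU)) \<and>
      reflective_subcategory (OrdCMon elV) (MonSiMonCat elV elU) (R_functor elV elU))"
proof -
  interpret two_universes elV elU
    using assms by (simp add: two_universes_def)
  have "\<exists>L :: (('u, 'v) indexed, ('u, 'v) indexed_arrow,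
               'v ordmon, 'v ordmon \<times> ('v \<Rightarrow> 'v) \<times> 'v ordmon) func.
         left_adjoint (OrdCMon elV) (MonSiMonCat elV elU) L (R_functor elV elU)"
    if "no_larger elU elV"
  proof (rule left_adjoint_of_universal_arrows[OF R_is_functor])
    fix X :: "('u, 'v) indexed" assume "X \<in> Obj \<M>"
    then interpret indexed_category elV elU "fst X" "snd X"
      by unfold_locales simp
    show "\<exists>a \<eta>. a \<in> Obj (OrdCMon elV) \<and> \<eta> \<in> homset \<M> X (fobj (R_functor elV elU) a) \<and>
      (\<forall>a'\<in>Obj (OrdCMon elV). \<forall>g\<in>homset \<M> X (fobj (R_functor elV elU) a').
        \<exists>!f. f \<in> homset (OrdCMon elV) a a' \<and> farr (R_functor elV elU) f \<cdot>\<^bsub>\<M>\<^esub> \<eta> = g)"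
      using universal_arrow[OF that] by simp
  qed
  with R_fully_faithful show ?thesis
    by (simp add: reflective_subcategory_def)
qed

end
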